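(* The assignment $\mathcal{C} \mapsto \mathbf{Optic}_{\mathcal{C}}$ extends to a functor $$\mathbf{Optic} : \mathbf{SymmMonCat} \to \mathbf{SymmMonCat}.$$ That is: for every small symmetric monoidal category $\mathcal{C}$, the category $\mathbf{Optic}_{\mathcal{C}}$ with the tensor product, unit and structure isomorphisms given in the context is a symmetric monoidal category; for every strong symmetric monoidal functor $F : \mathcal{C} \to \mathcal{D}$ between small symmetric monoidal categories, the induced $\mathbf{Optic}(F) : \mathbf{Optic}_{\mathcal{C}} \to \mathbf{Optic}_{\mathcal{D}}$ given in the context is a strong symmetric monoidal functor; and $\mathbf{Optic}$ preserves identities and composition.
   Context: $\mathbf{SymmMonCat}$ is the (1-)category of small symmetric monoidal categories and strong symmetric monoidal functors. Associativity isomorphisms are suppressed from the notation; an object used in place of a morphism denotes its identity; $fg$ means "$f$ after $g$". Optics. Let $(\mathcal{C},\otimes,I)$ be a symmetric monoidal category with associator $\alpha$, unitors $\lambda_S : I\otimes S\to S$, $\rho_S : S \otimes I \to S$ and symmetry $s$. The category $\mathbf{Optic}_{\mathcal{C}}$ has as objects pairs $(S,S')$ of objects of $\mathcal{C}$, and hom-sets $$\mathbf{Optic}_{\mathcal{C}}((S,S'),(A,A')) := \int^{M\in\mathcal{C}} \mathcal{C}(S,M\otimes A)\times\mathcal{C}(M\otimes A',S'),$$ i.e. pairs $(l,r)$ with $l:S\to M\otimes A$, $r:M\otimes A'\to S'$ for some $M$ (the residual), modulo the equivalence relation generated by $((f\otimes A)l,\,r)\sim(l,\,r(f\otimes A'))$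 for $l:S\to M\otimes A$, $r:N\otimes A'\to S'$, $f:M\to N$. The class of $(l,r)$ is written $\langle l\mid r\rangle$. The identity of $(S,S')$ is $\langle\lambda_S^{-1}\mid\lambda_{S'}\rangle$. If $\langle l'\mid r'\rangle:(R,R')\to(S,S')$ has residual $M$ and $\langle l\mid r\rangle:(S,S')\to(A,A')$, then $\langle l\mid r\rangle\circ\langle l'\mid r'\rangle:=\langle (M\otimes l)l'\mid r'(M\otimes r)\rangle$. For $f:S\to A$ and $g:A'\to S'$ in $\mathcal{C}$ put $\iota(f,g):=\langle\lambda_A^{-1}f\mid g\lambda_{A'}\rangle:(S,S')\to(A,A')$; this gives a functor $\iota:\mathcal{C}\times\mathcal{C}^{\mathrm{op}}\to\mathbf{Optic}_{\mathcal{C}}$, identity on objects. Monoidal structure on $\mathbf{Optic}_{\mathcal{C}}$. $(S,S')\otimes(T,T'):=(S\otimes T,S'\otimes T')$; unit $(I,I)$; for $\langle l\mid r\rangle:(S,S')\to(A,A')$ with residual $M$ and $\langle l'\mid r'\rangle:(T,T')\to(B,B')$ with residual $N$, $$\langle l\mid r\rangle\otimes\langle l'\mid r'\rangle:=\langle (M\otimes s_{A,N}\otimes B)(l\otimes l')\mid (r\otimes r')(M\otimes s_{N,A'}\otimes B')\rangle .$$ Structure maps: $\alpha_{(R,R'),(S,S'),(T,T')}:=\iota(\alpha_{R,S,T},\alpha_{R',S',T'}^{-1})$, $\lambda_{(S,S')}:=\iota(\lambda_S,\lambda_{S'}^{-1})$, $\rho_{(S,S')}:=\iota(\rho_S,\rho_{S'}^{-1})$,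 $s_{(S,S'),(T,T')}:=\iota(s_{S,T},s_{T',S'})$. Action on functors. Let $F:\mathcal{C}\to\mathcal{D}$ be strong symmetric monoidal with structure isomorphisms $\phi_{M,A}:FM\otimes FA\to F(M\otimes A)$ and $\phi_I:I\to FI$. Define $\mathbf{Optic}(F)(S,S')=(FS,FS')$ and $\mathbf{Optic}(F)(\langle l\mid r\rangle)=\langle\phi_{M,A}^{-1}(Fl)\mid(Fr)\phi_{M,A'}\rangle$, where $M$ is the residual. Its monoidal structure maps are $\iota(\phi_{S,T},\phi_{S',T'}^{-1}):(FS,FS')\otimes(FT,FT')\to(F(S\otimes T),F(S'\otimes T'))$ and $\iota(\phi_I,\phi_I^{-1}):(I,I)\to(FI,FI)$. *)

theory Defs
  imports Main "HOL-Library.FuncSet"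
begin

section \<open>Categories and functors\<close>

text \<open>
  A small category is a set of objects and a set of arrows, each arrow carrying its domain and
  codomain. \<^term>\<open>Comp C g f\<close> is ``g after f''; it is meaningful only if
  \<^prop>\<open>Cod C f = Dom C g\<close>.
\<close>

record ('o, 'm) cat_data =
  Obj :: "'o set"
  Arr :: "'m set"
  Dom :: "'m \<Rightarrow> 'o"
  Cod :: "'m \<Rightarrow> 'o"
  Id :: "'o \<Rightarrow> 'm"
  Comp :: "'m \<Rightarrow> 'm \<Rightarrow> 'm"  (infixr "\<cdot>\<index>" 60)

definition Hom :: "('o, 'm, 'x) cat_data_scheme \<Rightarrow> 'o \<Rightarrow> 'o \<Rightarrow> 'm set" where
  "Hom C A B = {f \<in> Arr C. Dom C f = A \<and> Cod C f = B}"

locale category =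
  fixes C :: "('o, 'm, 'x) cat_data_scheme" (structure)
  assumes Dom_closed: "f \<in> Arr C \<Longrightarrow> Dom C f \<in> Obj C"
    and Cod_closed: "f \<in> Arr C \<Longrightarrow> Cod C f \<in> Obj C"
    and Id_closed: "A \<in> Obj C \<Longrightarrow> Id C A \<in> Hom C A A"
    and Comp_closed: "\<lbrakk>f \<in> Hom C A B; g \<in> Hom C B D\<rbrakk> \<Longrightarrow> g \<cdot> f \<in> Hom C A D"
    and Comp_Id: "f \<in> Hom C A B \<Longrightarrow> f \<cdot> Id C A = f"
    and Id_Comp: "f \<in> Hom C A B \<Longrightarrow> Id C B \<cdot> f = f"
    and Comp_assoc: "\<lbrakk>f \<in> Hom C A B; g \<in> Hom C B D; h \<in> Hom C D E\<rbrakk>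
      \<Longrightarrow> (h \<cdot> g) \<cdot> f = h \<cdot> (g \<cdot> f)"

definition inverse_arrows :: "('o, 'm, 'x) cat_data_scheme \<Rightarrow> 'm \<Rightarrow> 'm \<Rightarrow> bool" where
  "inverse_arrows C f g \<longleftrightarrow>
     f \<in> Arr C \<and> g \<in> Hom C (Cod C f) (Dom C f) \<and>
     Comp C g f = Id C (Dom C f) \<and> Comp C f g = Id C (Cod C f)"

definition is_iso :: "('o, 'm, 'x) cat_data_scheme \<Rightarrow> 'm \<Rightarrow> bool" where
  "is_iso C f \<longleftrightarrow> (\<exists>g. inverse_arrows C f g)"

definition inv_arr :: "('o, 'm, 'x) cat_data_scheme \<Rightarrow> 'm \<Rightarrow> 'm" where
  "inv_arr C f = (THE g. inverse_arrows C f g)"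

locale cat_functor = source: category C + target: category D
  for C :: "('o, 'm, 'x) cat_data_scheme" and D :: "('p, 'n, 'y) cat_data_scheme" +
  fixes FO :: "'o \<Rightarrow> 'p" and FA :: "'m \<Rightarrow> 'n"
  assumes FO_closed: "A \<in> Obj C \<Longrightarrow> FO A \<in> Obj D"
    and FA_closed: "f \<in> Hom C A B \<Longrightarrow> FA f \<in> Hom D (FO A) (FO B)"
    and FA_Id: "A \<in> Obj C \<Longrightarrow> FA (Id C A) = Id D (FO A)"
    and FA_Comp: "\<lbrakk>f \<in> Hom C A B; g \<in> Hom C B E\<rbrakk> \<Longrightarrow> FA (Comp C g f) = Comp D (FA g) (FA f)"


section \<open>Symmetric monoidal categories and strong symmetric monoidal functors\<close>

text \<open>
  Orientation: \<open>Assoc C A B D : (A \<otimes> B) \<otimes> D \<rightarrow> A \<otimes> (B \<otimes> D)\<close>, \<open>LUnit C A : I \<otimes> A \<rightarrow> A\<close>,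
  \<open>RUnit C A : A \<otimes> I \<rightarrow> A\<close>, \<open>Sym C A B : A \<otimes> B \<rightarrow> B \<otimes> A\<close>.
\<close>

record ('o, 'm) smc_data = "('o, 'm) cat_data" +
  TensorO :: "'o \<Rightarrow> 'o \<Rightarrow> 'o"  (infix "\<otimes>\<index>" 70)
  TensorA :: "'m \<Rightarrow> 'm \<Rightarrow> 'm"  (infix "\<otimes>\<^sub>a\<index>" 70)
  Unit :: "'o"
  Assoc :: "'o \<Rightarrow> 'o \<Rightarrow> 'o \<Rightarrow> 'm"
  LUnit :: "'o \<Rightarrow> 'm"
  RUnit :: "'o \<Rightarrow> 'm"
  Sym :: "'o \<Rightarrow> 'o \<Rightarrow> 'm"

text \<open>The axioms are those of Mac Lane; \<open>RUnit_Sym\<close> is his unit axiom for the symmetry.\<close>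

locale symmetric_monoidal_category = category C
  for C :: "('o, 'm) smc_data" (structure) +
  assumes Unit_closed: "Unit C \<in> Obj C"
    and TensorO_closed: "\<lbrakk>A \<in> Obj C; B \<in> Obj C\<rbrakk> \<Longrightarrow> A \<otimes> B \<in> Obj C"
    and TensorA_closed: "\<lbrakk>f \<in> Hom C A A'; g \<in> Hom C B B'\<rbrakk> \<Longrightarrow> f \<otimes>\<^sub>a g \<in> Hom C (A \<otimes> B) (A' \<otimes> B')"
    and TensorA_Id: "\<lbrakk>A \<in> Obj C; B \<in> Obj C\<rbrakk> \<Longrightarrow> Id C A \<otimes>\<^sub>a Id C B = Id C (A \<otimes> B)"
    and TensorA_Comp:
      "\<lbrakk>f \<in> Hom C A A'; f' \<in> Hom C A' A''; g \<in> Hom C B B'; g' \<in> Hom C B' B''\<rbrakk>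
        \<Longrightarrow> (f' \<cdot> f) \<otimes>\<^sub>a (g' \<cdot> g) = (f' \<otimes>\<^sub>a g') \<cdot> (f \<otimes>\<^sub>a g)"
    and Assoc_closed: "\<lbrakk>A \<in> Obj C; B \<in> Obj C; D \<in> Obj C\<rbrakk>
        \<Longrightarrow> Assoc C A B D \<in> Hom C ((A \<otimes> B) \<otimes> D) (A \<otimes> (B \<otimes> D))"
    and Assoc_iso: "\<lbrakk>A \<in> Obj C; B \<in> Obj C; D \<in> Obj C\<rbrakk> \<Longrightarrow> is_iso C (Assoc C A B D)"
    and Assoc_natural: "\<lbrakk>f \<in> Hom C A A'; g \<in> Hom C B B'; h \<in> Hom C D D'\<rbrakk>
        \<Longrightarrow> Assoc C A' B' D' \<cdot> ((f \<otimes>\<^sub>a g) \<otimes>\<^sub>a h) = (f \<otimes>\<^sub>a (g \<otimes>\<^sub>a h)) \<cdot> Assoc C A B D"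
    and LUnit_closed: "A \<in> Obj C \<Longrightarrow> LUnit C A \<in> Hom C (Unit C \<otimes> A) A"
    and LUnit_iso: "A \<in> Obj C \<Longrightarrow> is_iso C (LUnit C A)"
    and LUnit_natural: "f \<in> Hom C A B \<Longrightarrow> LUnit C B \<cdot> (Id C (Unit C) \<otimes>\<^sub>a f) = f \<cdot> LUnit C A"
    and RUnit_closed: "A \<in> Obj C \<Longrightarrow> RUnit C A \<in> Hom C (A \<otimes> Unit C) A"
    and RUnit_iso: "A \<in> Obj C \<Longrightarrow> is_iso C (RUnit C A)"
    and RUnit_natural: "f \<in> Hom C A B \<Longrightarrow> RUnit C B \<cdot> (f \<otimes>\<^sub>a Id C (Unit C)) = f \<cdot> RUnit C A"
    and Sym_closed: "\<lbrakk>A \<in> Obj C; B \<in> Obj C\<rbrakk> \<Longrightarrow> Sym C A B \<in> Hom C (A \<otimes> B) (B \<otimes> A)"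
    and Sym_natural: "\<lbrakk>f \<in> Hom C A A'; g \<in> Hom C B B'\<rbrakk>
        \<Longrightarrow> Sym C A' B' \<cdot> (f \<otimes>\<^sub>a g) = (g \<otimes>\<^sub>a f) \<cdot> Sym C A B"
    and pentagon: "\<lbrakk>A \<in> Obj C; B \<in> Obj C; D \<in> Obj C; E \<in> Obj C\<rbrakk>
        \<Longrightarrow> Assoc C A B (D \<otimes> E) \<cdot> Assoc C (A \<otimes> B) D E
          = (Id C A \<otimes>\<^sub>a Assoc C B D E) \<cdot> Assoc C A (B \<otimes> D) E \<cdot> (Assoc C A B D \<otimes>\<^sub>a Id C E)"
    and triangle: "\<lbrakk>A \<in> Obj C; B \<in> Obj C\<rbrakk>
        \<Longrightarrow> (Id C A \<otimes>\<^sub>a LUnit C B) \<cdot> Assoc C A (Unit C) B = RUnit C A \<otimes>\<^sub>a Id C B"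
    and hexagon: "\<lbrakk>A \<in> Obj C; B \<in> Obj C; D \<in> Obj C\<rbrakk>
        \<Longrightarrow> Assoc C B D A \<cdot> Sym C A (B \<otimes> D) \<cdot> Assoc C A B D
          = (Id C B \<otimes>\<^sub>a Sym C A D) \<cdot> Assoc C B A D \<cdot> (Sym C A B \<otimes>\<^sub>a Id C D)"
    and Sym_Sym: "\<lbrakk>A \<in> Obj C; B \<in> Obj C\<rbrakk> \<Longrightarrow> Sym C B A \<cdot> Sym C A B = Id C (A \<otimes> B)"
    and RUnit_Sym: "A \<in> Obj C \<Longrightarrow> LUnit C A \<cdot> Sym C A (Unit C) = RUnit C A"

text \<open>
  The structure isomorphisms of a monoidal functor \<open>F\<close> are \<open>Phi F (A, B) : FA \<otimes> FB \<rightarrow> F (A \<otimes> B)\<close>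
  and \<open>PhiI F : I \<rightarrow> FI\<close>. All maps of the record are required to be \<^const>\<open>extensional\<close> on the
  source category, so that equality of records is equality of strong symmetric monoidal functors
  with the same source and target.
\<close>

record ('o, 'm, 'p, 'n) smf_data =
  OMap :: "'o \<Rightarrow> 'p"
  AMap :: "'m \<Rightarrow> 'n"
  Phi :: "'o \<times> 'o \<Rightarrow> 'n"
  PhiI :: "'n"

locale strong_symmetric_monoidal_functor =
  source: symmetric_monoidal_category C + target: symmetric_monoidal_category D +
  cat_functor C D "OMap F" "AMap F"
  for C :: "('o, 'm) smc_data" and D :: "('p, 'n) smc_data" and F :: "('o, 'm, 'p, 'n) smf_data" +
  assumes OMap_ext: "OMap F \<in> extensional (Obj C)"
    and AMap_ext: "AMap F \<in> extensional (Arr C)"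
    and Phi_ext: "Phi F \<in> extensional (Obj C \<times> Obj C)"
    and Phi_closed: "\<lbrakk>A \<in> Obj C; B \<in> Obj C\<rbrakk>
        \<Longrightarrow> Phi F (A, B) \<in> Hom D (OMap F A \<otimes>\<^bsub>D\<^esub> OMap F B) (OMap F (A \<otimes>\<^bsub>C\<^esub> B))"
    and Phi_iso: "\<lbrakk>A \<in> Obj C; B \<in> Obj C\<rbrakk> \<Longrightarrow> is_iso D (Phi F (A, B))"
    and Phi_natural: "\<lbrakk>f \<in> Hom C A A'; g \<in> Hom C B B'\<rbrakk>
        \<Longrightarrow> Phi F (A', B') \<cdot>\<^bsub>D\<^esub> (AMap F f \<otimes>\<^sub>a\<^bsub>D\<^esub> AMap F g) = AMap F (f \<otimes>\<^sub>a\<^bsub>C\<^esub> g) \<cdot>\<^bsub>D\<^esub> Phi F (A, B)"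
    and PhiI_closed: "PhiI F \<in> Hom D (Unit D) (OMap F (Unit C))"
    and PhiI_iso: "is_iso D (PhiI F)"
    and Phi_Assoc: "\<lbrakk>A \<in> Obj C; B \<in> Obj C; E \<in> Obj C\<rbrakk>
        \<Longrightarrow> AMap F (Assoc C A B E) \<cdot>\<^bsub>D\<^esub> Phi F (A \<otimes>\<^bsub>C\<^esub> B, E) \<cdot>\<^bsub>D\<^esub> (Phi F (A, B) \<otimes>\<^sub>a\<^bsub>D\<^esub> Id D (OMap F E))
          = Phi F (A, B \<otimes>\<^bsub>C\<^esub> E) \<cdot>\<^bsub>D\<^esub> (Id D (OMap F A) \<otimes>\<^sub>a\<^bsub>D\<^esub> Phi F (B, E))
              \<cdot>\<^bsub>D\<^esub> Assoc D (OMap F A) (OMap F B) (OMap F E)"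
    and Phi_LUnit: "A \<in> Obj C
        \<Longrightarrow> AMap F (LUnit C A) \<cdot>\<^bsub>D\<^esub> Phi F (Unit C, A) \<cdot>\<^bsub>D\<^esub> (PhiI F \<otimes>\<^sub>a\<^bsub>D\<^esub> Id D (OMap F A))
          = LUnit D (OMap F A)"
    and Phi_RUnit: "A \<in> Obj C
        \<Longrightarrow> AMap F (RUnit C A) \<cdot>\<^bsub>D\<^esub> Phi F (A, Unit C) \<cdot>\<^bsub>D\<^esub> (Id D (OMap F A) \<otimes>\<^sub>a\<^bsub>D\<^esub> PhiI F)
          = RUnit D (OMap F A)"
    and Phi_Sym: "\<lbrakk>A \<in> Obj C; B \<in> Obj C\<rbrakk>
        \<Longrightarrow> AMap F (Sym C A B) \<cdot>\<^bsub>D\<^esub> Phi F (A, B) = Phi F (B, A) \<cdot>\<^bsub>D\<^esub> Sym D (OMap F A) (OMap F B)"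

definition id_smf :: "('o, 'm) smc_data \<Rightarrow> ('o, 'm, 'o, 'm) smf_data" where
  "id_smf C =
    \<lparr> OMap = (\<lambda>A\<in>Obj C. A),
      AMap = (\<lambda>f\<in>Arr C. f),
      Phi = (\<lambda>(A, B)\<in>Obj C \<times> Obj C. Id C (A \<otimes>\<^bsub>C\<^esub> B)),
      PhiI = Id C (Unit C) \<rparr>"

text \<open>\<open>comp_smf C E G F\<close> is \<open>G\<close> after \<open>F\<close>, where \<open>C\<close> is the source of \<open>F\<close> and \<open>E\<close> the target of \<open>G\<close>.\<close>

definition comp_smf ::
  "('o, 'm) smc_data \<Rightarrow> ('q, 'k) smc_data \<Rightarrow> ('p, 'n, 'q, 'k) smf_data \<Rightarrow> ('o, 'm, 'p, 'n) smf_data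
    \<Rightarrow> ('o, 'm, 'q, 'k) smf_data" where
  "comp_smf C E G F =
    \<lparr> OMap = (\<lambda>A\<in>Obj C. OMap G (OMap F A)),
      AMap = (\<lambda>f\<in>Arr C. AMap G (AMap F f)),
      Phi = (\<lambda>(A, B)\<in>Obj C \<times> Obj C. AMap G (Phi F (A, B)) \<cdot>\<^bsub>E\<^esub> Phi G (OMap F A, OMap F B)),
      PhiI = AMap G (PhiI F) \<cdot>\<^bsub>E\<^esub> PhiI G \<rparr>"

text \<open>
  The category of symmetric monoidal categories with objects in \<^typ>\<open>'o\<close> and arrows in \<^typ>\<open>'m\<close>
  (the two types bound the size, as a universe would). An arrow is a functor tagged with its source
  and target.
\<close>

type_synonym ('o, 'm) smc_arrow =
  "('o, 'm) smc_data \<times> ('o, 'm) smc_data \<times> ('o, 'm, 'o, 'm) smf_data"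

definition SymmMonCat :: "(('o, 'm) smc_data, ('o, 'm) smc_arrow) cat_data" where
  "SymmMonCat =
    \<lparr> Obj = {C. symmetric_monoidal_category C},
      Arr = {(C, D, F). strong_symmetric_monoidal_functor C D F},
      Dom = (\<lambda>(C, D, F). C),
      Cod = (\<lambda>(C, D, F). D),
      Id = (\<lambda>C. (C, C, id_smf C)),
      Comp = (\<lambda>(D', E, G) (C, D, F). (C, E, comp_smf C E G F)) \<rparr>"


section \<open>Optics\<close>

text \<open>
  A representative \<open>(M, l, r)\<close> of an optic consists of the residual \<open>M\<close> and the two arrows.
\<close>

type_synonym ('o, 'm) optic_rep = "'o \<times> 'm \<times> 'm"

definition optic_reps ::
  "('o, 'm) smc_data \<Rightarrow> 'o \<times> 'o \<Rightarrow> 'o \<times> 'o \<Rightarrow> ('o, 'm) optic_rep set" where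
  "optic_reps C = (\<lambda>(S, S') (A, A').
    {(M, l, r). M \<in> Obj C \<and> l \<in> Hom C S (M \<otimes>\<^bsub>C\<^esub> A) \<and> r \<in> Hom C (M \<otimes>\<^bsub>C\<^esub> A') S'})"

inductive optic_step ::
  "('o, 'm) smc_data \<Rightarrow> 'o \<times> 'o \<Rightarrow> 'o \<times> 'o \<Rightarrow> ('o, 'm) optic_rep \<Rightarrow> ('o, 'm) optic_rep \<Rightarrow> bool"
  for C :: "('o, 'm) smc_data" where
  "\<lbrakk> A \<in> Obj C; A' \<in> Obj C; f \<in> Hom C M N;
     l \<in> Hom C S (M \<otimes>\<^bsub>C\<^esub> A); r \<in> Hom C (N \<otimes>\<^bsub>C\<^esub> A') S' \<rbrakk>
   \<Longrightarrow> optic_step C (S, S') (A, A')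
         (N, (f \<otimes>\<^sub>a\<^bsub>C\<^esub> Id C A) \<cdot>\<^bsub>C\<^esub> l, r)
         (M, l, r \<cdot>\<^bsub>C\<^esub> (f \<otimes>\<^sub>a\<^bsub>C\<^esub> Id C A'))"

definition optic_rel ::
  "('o, 'm) smc_data \<Rightarrow> 'o \<times> 'o \<Rightarrow> 'o \<times> 'o \<Rightarrow> ('o, 'm) optic_rep rel" where
  "optic_rel C P Q =
    {(x, y). x \<in> optic_reps C P Q \<and> y \<in> optic_reps C P Q \<and> equivclp (optic_step C P Q) x y}"

text \<open>
  An arrow of the category of optics is an equivalence class tagged with its source and target.
\<close>

type_synonym ('o, 'm) optic = "('o \<times> 'o) \<times> ('o \<times> 'o) \<times> ('o, 'm) optic_rep set"

definition optic_class ::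
  "('o, 'm) smc_data \<Rightarrow> 'o \<times> 'o \<Rightarrow> 'o \<times> 'o \<Rightarrow> ('o, 'm) optic_rep \<Rightarrow> ('o, 'm) optic_rep set" where
  "optic_class C P Q x = optic_rel C P Q `` {x}"

definition iota :: "('o, 'm) smc_data \<Rightarrow> 'm \<Rightarrow> 'm \<Rightarrow> ('o, 'm) optic" where
  "iota C f g =
    (let P = (Dom C f, Cod C g); Q = (Cod C f, Dom C g) in
      (P, Q, optic_class C P Q
        (Unit C, inv_arr C (LUnit C (Cod C f)) \<cdot>\<^bsub>C\<^esub> f, g \<cdot>\<^bsub>C\<^esub> LUnit C (Dom C g))))"

text \<open>
  The operations on classes below are unions over all representatives. Such a union is a single
  equivalence class only if the operation does not depend on the representatives, so the closure
  axioms of a category, of a tensor product and of a functor include well-definedness.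

  In the composite of \<open>\<langle>l' | r'\<rangle>\<close> (residual \<open>M\<close>) followed by \<open>\<langle>l | r\<rangle>\<close> (residual \<open>N\<close>), the residual
  is \<open>M \<otimes> N\<close> and the associators \<open>M \<otimes> (N \<otimes> A) \<rightarrow> (M \<otimes> N) \<otimes> A\<close> and
  \<open>(M \<otimes> N) \<otimes> A' \<rightarrow> M \<otimes> (N \<otimes> A')\<close> have to be inserted.
\<close>

definition optic_comp ::
  "('o, 'm) smc_data \<Rightarrow> ('o, 'm) optic \<Rightarrow> ('o, 'm) optic \<Rightarrow> ('o, 'm) optic" where
  "optic_comp C = (\<lambda>(_, (A, A'), Y) (P, _, X).
    (P, (A, A'),
      \<Union>(M, l', r')\<in>X. \<Union>(N, l, r)\<in>Y. optic_class C P (A, A')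
        (M \<otimes>\<^bsub>C\<^esub> N,
         inv_arr C (Assoc C M N A) \<cdot>\<^bsub>C\<^esub> (Id C M \<otimes>\<^sub>a\<^bsub>C\<^esub> l) \<cdot>\<^bsub>C\<^esub> l',
         r' \<cdot>\<^bsub>C\<^esub> (Id C M \<otimes>\<^sub>a\<^bsub>C\<^esub> r) \<cdot>\<^bsub>C\<^esub> Assoc C M N A')))"

text \<open>
  \<open>interchange C M A N B : (M \<otimes> A) \<otimes> (N \<otimes> B) \<rightarrow> (M \<otimes> N) \<otimes> (A \<otimes> B)\<close> is \<open>M \<otimes> s\<^bsub>A,N\<^esub> \<otimes> B\<close> with the
  associators inserted.
\<close>

definition interchange :: "('o, 'm) smc_data \<Rightarrow> 'o \<Rightarrow> 'o \<Rightarrow> 'o \<Rightarrow> 'o \<Rightarrow> 'm" where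
  "interchange C M A N B =
    inv_arr C (Assoc C M N (A \<otimes>\<^bsub>C\<^esub> B))
    \<cdot>\<^bsub>C\<^esub> (Id C M \<otimes>\<^sub>a\<^bsub>C\<^esub>
         (Assoc C N A B \<cdot>\<^bsub>C\<^esub> (Sym C A N \<otimes>\<^sub>a\<^bsub>C\<^esub> Id C B) \<cdot>\<^bsub>C\<^esub> inv_arr C (Assoc C A N B)))
    \<cdot>\<^bsub>C\<^esub> Assoc C M A (N \<otimes>\<^bsub>C\<^esub> B)"

definition optic_tensor_obj :: "('o, 'm) smc_data \<Rightarrow> 'o \<times> 'o \<Rightarrow> 'o \<times> 'o \<Rightarrow> 'o \<times> 'o" where
  "optic_tensor_obj C = (\<lambda>(S, S') (T, T'). (S \<otimes>\<^bsub>C\<^esub> T, S' \<otimes>\<^bsub>C\<^esub> T'))"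

definition optic_tensor ::
  "('o, 'm) smc_data \<Rightarrow> ('o, 'm) optic \<Rightarrow> ('o, 'm) optic \<Rightarrow> ('o, 'm) optic" where
  "optic_tensor C = (\<lambda>(P, (A, A'), X) (Q, (B, B'), Y).
    let U = optic_tensor_obj C P Q; V = optic_tensor_obj C (A, A') (B, B') in
    (U, V,
      \<Union>(M, l, r)\<in>X. \<Union>(N, l', r')\<in>Y. optic_class C U V
        (M \<otimes>\<^bsub>C\<^esub> N,
         interchange C M A N B \<cdot>\<^bsub>C\<^esub> (l \<otimes>\<^sub>a\<^bsub>C\<^esub> l'),
         (r \<otimes>\<^sub>a\<^bsub>C\<^esub> r') \<cdot>\<^bsub>C\<^esub> interchange C M N A' B')))"

definition Optic :: "('o, 'm) smc_data \<Rightarrow> ('o \<times> 'o, ('o, 'm) optic) smc_data" where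
  "Optic C =
    \<lparr> Obj = Obj C \<times> Obj C,
      Arr = {(P, Q, X). P \<in> Obj C \<times> Obj C \<and> Q \<in> Obj C \<times> Obj C \<and>
                        X \<in> optic_reps C P Q // optic_rel C P Q},
      Dom = (\<lambda>(P, Q, X). P),
      Cod = (\<lambda>(P, Q, X). Q),
      Id = (\<lambda>(S, S'). ((S, S'), (S, S'),
              optic_class C (S, S') (S, S') (Unit C, inv_arr C (LUnit C S), LUnit C S'))),
      Comp = optic_comp C,
      TensorO = optic_tensor_obj C,
      TensorA = optic_tensor C,
      Unit = (Unit C, Unit C),
      Assoc = (\<lambda>(R, R') (S, S') (T, T'). iota C (Assoc C R S T) (inv_arr C (Assoc C R' S' T'))),
      LUnit = (\<lambda>(S, S'). iota C (LUnit C S) (inv_arr C (LUnit C S'))),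
      RUnit = (\<lambda>(S, S'). iota C (RUnit C S) (inv_arr C (RUnit C S'))),
      Sym = (\<lambda>(S, S') (T, T'). iota C (Sym C S T) (Sym C T' S')) \<rparr>"

definition Optic_map ::
  "('o, 'm) smc_data \<Rightarrow> ('p, 'n) smc_data \<Rightarrow> ('o, 'm, 'p, 'n) smf_data
    \<Rightarrow> ('o \<times> 'o, ('o, 'm) optic, 'p \<times> 'p, ('p, 'n) optic) smf_data" where
  "Optic_map C D F =
    (let F2 = (\<lambda>(S, S'). (OMap F S, OMap F S')) in
    \<lparr> OMap = (\<lambda>P\<in>Obj (Optic C). F2 P),
      AMap = (\<lambda>(P, (A, A'), X)\<in>Arr (Optic C).
        (F2 P, F2 (A, A'),
          \<Union>(M, l, r)\<in>X. optic_class D (F2 P) (F2 (A, A'))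
            (OMap F M,
             inv_arr D (Phi F (M, A)) \<cdot>\<^bsub>D\<^esub> AMap F l,
             AMap F r \<cdot>\<^bsub>D\<^esub> Phi F (M, A')))),
      Phi = (\<lambda>((S, S'), (T, T'))\<in>Obj (Optic C) \<times> Obj (Optic C).
        iota D (Phi F (S, T)) (inv_arr D (Phi F (S', T')))),
      PhiI = iota D (PhiI F) (inv_arr D (PhiI F)) \<rparr>)"

end

theory Submission
  imports Defs
begin

text \<open>
  Two optics are shown to be equal by sliding a structure isomorphism (an associator, a unitor, a
  symmetry, an interchange or a \<open>\<phi>\<close>) between the residuals of representatives, which leaves two
  equations in the base category. These equations all reduce to one family of coherence facts: the
  interchange \<open>\<tau> : (M \<otimes> A) \<otimes> (N \<otimes> B) \<rightarrow> (M \<otimes> N) \<otimes> (A \<otimes> B)\<close> is natural, associative, unital and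
  symmetric, that is, \<open>\<otimes>\<close> is itself a symmetric monoidal functor; and a strong symmetric monoidal
  functor preserves \<open>\<tau>\<close> up to \<open>\<phi>\<close>. The pentagon, triangle and
  hexagon for optics need no sliding: the structure maps have the form \<open>\<iota>(f, g\<inverse>)\<close>, and
  \<open>(f, g) \<mapsto> \<iota>(f, g\<inverse>)\<close> respects composition and tensor.
\<close>

text \<open>The obstacle is that the associators suppressed on paper all have to be carried. No
  coherence theorem is invoked; every diagram is derived from the axioms. What keeps this finite is
  that the inverse of an interchange is again an interchange, with its two middle letters exchanged.
  The two halves of an optic use it in opposite directions, so a law for one half is often the
  inverse of a law for the other. Wherever two optics must be compared, a single slide suffices,
  because their residuals are related by a canonical arrow. Well-definedness is also a matter of
  single slides: an operation on classes is a union over representatives, and a family that is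
  constant along generating steps is constant on the whole class. Normal forms are composites
  bracketed to the right, with adjacent tensors merged. Diagram equations are therefore applied by
  regrouping: one step brackets the wanted subterm, the next rewrites it, and the simplifier checks
  that each regrouping has the same normal form.\<close>

section \<open>Categories\<close>

text \<open>Unfolding \<^const>\<open>Hom\<close> leaves side conditions without additional variables, so that the
  simplifier can discharge them.\<close>

lemma hom_iff [simp]: "f \<in> Hom C A B \<longleftrightarrow> f \<in> Arr C \<and> Dom C f = A \<and> Cod C f = B"
  by (simp add: Hom_def)

context category
begin

declare Dom_closed [simp] Cod_closed [simp]

section \<open>Typing, units and associativity as rewrite rules\<close>

lemma comp_simps [simp]:
  assumes "f \<in> Arr C" "g \<in> Arr C" "Dom C g = Cod C f"
  shows "g \<cdot> f \<in> Arr C" "Dom C (g \<cdot> f) = Dom C f" "Cod C (g \<cdot> f) = Cod C g"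
  using Comp_closed[of f "Dom C f" "Cod C f" g "Cod C g"] assms by auto

lemma id_simps [simp]:
  assumes "A \<in> Obj C"
  shows "Id C A \<in> Arr C" "Dom C (Id C A) = A" "Cod C (Id C A) = A"
  using Id_closed[OF assms] by auto

lemma comp_assoc [simp]:
  assumes "f \<in> Arr C" "g \<in> Arr C" "h \<in> Arr C" "Dom C g = Cod C f" "Dom C h = Cod C g"
  shows "(h \<cdot> g) \<cdot> f = h \<cdot> (g \<cdot> f)"
  using Comp_assoc[of f "Dom C f" "Cod C f" g "Cod C g" h "Cod C h"] assms by auto

lemma comp_id [simp]: "\<lbrakk>f \<in> Arr C; Dom C f = A\<rbrakk> \<Longrightarrow> f \<cdot> Id C A = f"
  and id_comp [simp]: "\<lbrakk>f \<in> Arr C; Cod C f = A\<rbrakk> \<Longrightarrow> Id C A \<cdot> f = f"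
  using Comp_Id Id_Comp by auto

text \<open>Since composites are bracketed to the right, the left side of an equation for
  \<open>g \<cdot> f\<close> is no longer a subterm once some \<open>k\<close> comes before it. This
  form restores the match.\<close>

lemma comp_extend:
  assumes "g \<cdot> f = h" "k \<in> Arr C" "f \<in> Arr C" "g \<in> Arr C" "Dom C f = Cod C k" "Dom C g = Cod C f"
  shows "g \<cdot> (f \<cdot> k) = h \<cdot> k"
  unfolding assms(1)[symmetric] using assms(2-) by (intro comp_assoc[symmetric])

text \<open>The same device for a commuting square; naturality laws are applied with it inside
  longer composites.\<close>

lemma comp_extend2:
  assumes "g \<cdot> f = h \<cdot> j" "k \<in> Arr C" "f \<in> Arr C" "g \<in> Arr C" "h \<in> Arr C" "j \<in> Arr C"
    "Dom C f = Cod C k" "Dom C g = Cod C f" "Dom C j = Cod C k" "Dom C h = Cod C j"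
  shows "g \<cdot> (f \<cdot> k) = h \<cdot> (j \<cdot> k)"
  using comp_assoc[of k f g, symmetric] comp_assoc[of k j h, symmetric] assms by (simp only:)

section \<open>Inverses and the calculus of isomorphisms\<close>

lemma inverse_arrows_unique:
  assumes "inverse_arrows C f g" "inverse_arrows C f h"
  shows "g = h"
proof -
  have "g = g \<cdot> (f \<cdot> h)" using assms by (simp add: inverse_arrows_def)
  also have "\<dots> = (g \<cdot> f) \<cdot> h"
    using assms by (intro comp_assoc[symmetric]) (auto simp: inverse_arrows_def)
  also have "\<dots> = h" using assms by (simp add: inverse_arrows_def)
  finally show ?thesis .
qed

text \<open>\<open>inv_arr\<close> is a definite description; with uniqueness at hand, it is
  computed by exhibiting any inverse.\<close>

lemma inv_arr_eqI: "inverse_arrows C f g \<Longrightarrow> inv_arr C f = g"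
  unfolding inv_arr_def by (rule the_equality) (auto intro: inverse_arrows_unique)

lemma inverse_arrows_inv_arr: "is_iso C f \<Longrightarrow> inverse_arrows C f (inv_arr C f)"
  unfolding is_iso_def using inv_arr_eqI by auto

lemma inverse_arrowsI:
  "\<lbrakk>f \<in> Arr C; g \<in> Arr C; Dom C g = Cod C f; Cod C g = Dom C f; g \<cdot> f = Id C (Dom C f); f \<cdot> g
      = Id C (Cod C f)\<rbrakk>
    \<Longrightarrow> inverse_arrows C f g"
  by (simp add: inverse_arrows_def)

lemma is_iso_arr: "is_iso C f \<Longrightarrow> f \<in> Arr C"
  by (auto simp: is_iso_def inverse_arrows_def)

lemma inv_arr_simps [simp]:
  assumes "is_iso C f"
  shows "inv_arr C f \<in> Arr C" "Dom C (inv_arr C f) = Cod C f" "Cod C (inv_arr C f) = Dom C f"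
    "inv_arr C f \<cdot> f = Id C (Dom C f)" "f \<cdot> inv_arr C f = Id C (Cod C f)"
  using inverse_arrows_inv_arr[OF assms] by (auto simp: inverse_arrows_def)

lemma inv_arr_cancel [simp]:
  assumes "is_iso C f" "k \<in> Arr C"
  shows "Cod C k = Dom C f \<Longrightarrow> inv_arr C f \<cdot> (f \<cdot> k) = k"
    "Cod C k = Cod C f \<Longrightarrow> f \<cdot> (inv_arr C f \<cdot> k) = k"
proof -
  have f: "f \<in> Arr C" by (rule is_iso_arr[OF assms(1)])
  show "inv_arr C f \<cdot> (f \<cdot> k) = k" if "Cod C k = Dom C f"
    by (subst comp_extend[OF inv_arr_simps(4)[OF assms(1)] assms(2) f]) (use f assms that in auto)
  show "f \<cdot> (inv_arr C f \<cdot> k) = k" if "Cod C k = Cod C f"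
    by (subst comp_extend[OF inv_arr_simps(5)[OF assms(1)] assms(2) _ f]) (use f assms that in auto)
qed

lemma inverse_arrows_is_iso: "inverse_arrows C f g \<Longrightarrow> is_iso C f"
  by (auto simp: is_iso_def)

lemma inverse_arrows_sym: "inverse_arrows C f g \<Longrightarrow> inverse_arrows C g f"
  by (auto simp: inverse_arrows_def)

lemma inv_arr_iso [simp]:
  assumes "is_iso C f"
  shows "is_iso C (inv_arr C f)" "inv_arr C (inv_arr C f) = f"
  using assms inverse_arrows_inv_arr inverse_arrows_sym inverse_arrows_is_iso inv_arr_eqI by blast+

lemma inverse_arrows_comp:
  assumes "is_iso C f" "is_iso C g" "Dom C g = Cod C f"
  shows "inverse_arrows C (g \<cdot> f) (inv_arr C f \<cdot> inv_arr C g)"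
proof (rule inverse_arrowsI)
  have f: "f \<in> Arr C" and g: "g \<in> Arr C" using assms is_iso_arr by auto
  show "(inv_arr C f \<cdot> inv_arr C g) \<cdot> g \<cdot> f = Id C (Dom C (g \<cdot> f))"
    using f g assms by (simp add: inv_arr_cancel[where f=g])
  show "(g \<cdot> f) \<cdot> inv_arr C f \<cdot> inv_arr C g = Id C (Cod C (g \<cdot> f))"
    using f g assms by simp
qed (use assms is_iso_arr in auto)

lemma iso_comp [simp]:
  assumes "is_iso C f" "is_iso C g" "Dom C g = Cod C f"
  shows "is_iso C (g \<cdot> f)" "inv_arr C (g \<cdot> f) = inv_arr C f \<cdot> inv_arr C g"
  using inverse_arrows_comp[OF assms] inverse_arrows_is_iso inv_arr_eqI by auto

lemma iso_id [simp]:
  assumes "A \<in> Obj C"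
  shows "is_iso C (Id C A)" "inv_arr C (Id C A) = Id C A"
proof -
  have "inverse_arrows C (Id C A) (Id C A)" using assms by (intro inverse_arrowsI) auto
  then show "is_iso C (Id C A)" "inv_arr C (Id C A) = Id C A"
    using inverse_arrows_is_iso inv_arr_eqI by auto
qed

text \<open>Isomorphisms are monic. Several coherence identities are accessible only after composing
  with an associator or a unitor, which is then cancelled.\<close>

lemma iso_cancel_left:
  assumes "h \<cdot> f = h \<cdot> g" "is_iso C h" "f \<in> Arr C" "g \<in> Arr C" "Cod C f = Dom C h" "Cod C g
      = Dom C h"
  shows "f = g"
proof -
  have "inv_arr C h \<cdot> (h \<cdot> f) = inv_arr C h \<cdot> (h \<cdot> g)" by (simp only: assms(1))
  then show ?thesis using assms(2-) by simp
qed

lemma iso_cancel_right: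
  assumes "f \<cdot> h = g \<cdot> h" "is_iso C h" "f \<in> Arr C" "g \<in> Arr C" "Dom C f = Cod C h" "Dom C g
      = Cod C h"
  shows "f = g"
proof -
  have h: "h \<in> Arr C" using assms is_iso_arr by auto
  have "(f \<cdot> h) \<cdot> inv_arr C h = (g \<cdot> h) \<cdot> inv_arr C h" by (simp only: assms(1))
  then show ?thesis using assms(2-) h by simp
qed

text \<open>The source of naturality for the inverses of the associator, the left unitor and \<phi>:
  cancelling the two invertible sides of a naturality square reverses them.\<close>

lemma inverse_square:
  assumes "g \<cdot> f = k \<cdot> h" "is_iso C f" "is_iso C k"
    "g \<in> Arr C" "h \<in> Arr C" "Dom C g = Cod C f" "Dom C k = Cod C h"
    "Cod C g = Cod C k" "Dom C h = Dom C f"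
  shows "inv_arr C k \<cdot> g = h \<cdot> inv_arr C f"
proof -
  have arr: "f \<in> Arr C" "k \<in> Arr C" using assms is_iso_arr by auto
  have "inv_arr C k \<cdot> g = inv_arr C k \<cdot> ((g \<cdot> f) \<cdot> inv_arr C f)"
    using assms(2-) arr by simp
  also have "\<dots> = inv_arr C k \<cdot> ((k \<cdot> h) \<cdot> inv_arr C f)" by (simp only: assms(1))
  also have "\<dots> = h \<cdot> inv_arr C f"
    using assms(2-) arr by simp
  finally show ?thesis .
qed

end

section \<open>Coherence\<close>

context symmetric_monoidal_category
begin

abbreviation I where "I \<equiv> Unit C"
abbreviation \<alpha> where "\<alpha> \<equiv> Assoc C"
abbreviation \<alpha>' where "\<alpha>' A B D \<equiv> inv_arr C (Assoc C A B D)"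
abbreviation \<l> where "\<l> \<equiv> LUnit C"
abbreviation \<l>' where "\<l>' A \<equiv> inv_arr C (LUnit C A)"
abbreviation \<r> where "\<r> \<equiv> RUnit C"
abbreviation \<gamma> where "\<gamma> \<equiv> Sym C"
abbreviation lwhisker (infix "\<rhd>" 75) where "A \<rhd> f \<equiv> Id C A \<otimes>\<^sub>a f"
abbreviation rwhisker (infix "\<lhd>" 75) where "f \<lhd> A \<equiv> f \<otimes>\<^sub>a Id C A"

declare Unit_closed [simp] TensorO_closed [simp] TensorA_Id [simp]
  Assoc_iso [simp] LUnit_iso [simp] RUnit_iso [simp] Sym_Sym [simp]

section \<open>Typing and rewrite rules for the tensor and the structure maps\<close>

lemma tensor_simps [simp]:
  assumes "f \<in> Arr C" "g \<in> Arr C"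
  shows "f \<otimes>\<^sub>a g \<in> Arr C" "Dom C (f \<otimes>\<^sub>a g) = Dom C f \<otimes> Dom C g" "Cod C (f \<otimes>\<^sub>a g)
      = Cod C f \<otimes> Cod C g"
  using TensorA_closed[of f "Dom C f" "Cod C f" g "Dom C g" "Cod C g"] assms by auto

lemma structure_simps [simp]:
  "\<lbrakk>A \<in> Obj C; B \<in> Obj C; D \<in> Obj C\<rbrakk> \<Longrightarrow> \<alpha> A B D \<in> Arr C"
  "\<lbrakk>A \<in> Obj C; B \<in> Obj C; D \<in> Obj C\<rbrakk> \<Longrightarrow> Dom C (\<alpha> A B D) = (A \<otimes> B) \<otimes> D"
  "\<lbrakk>A \<in> Obj C; B \<in> Obj C; D \<in> Obj C\<rbrakk> \<Longrightarrow> Cod C (\<alpha> A B D) = A \<otimes> (B \<otimes> D)"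
  "A \<in> Obj C \<Longrightarrow> \<l> A \<in> Arr C"
  "A \<in> Obj C \<Longrightarrow> Dom C (\<l> A) = I \<otimes> A"
  "A \<in> Obj C \<Longrightarrow> Cod C (\<l> A) = A"
  "A \<in> Obj C \<Longrightarrow> \<r> A \<in> Arr C"
  "A \<in> Obj C \<Longrightarrow> Dom C (\<r> A) = A \<otimes> I"
  "A \<in> Obj C \<Longrightarrow> Cod C (\<r> A) = A"
  "\<lbrakk>A \<in> Obj C; B \<in> Obj C\<rbrakk> \<Longrightarrow> \<gamma> A B \<in> Arr C"
  "\<lbrakk>A \<in> Obj C; B \<in> Obj C\<rbrakk> \<Longrightarrow> Dom C (\<gamma> A B) = A \<otimes> B"
  "\<lbrakk>A \<in> Obj C; B \<in> Obj C\<rbrakk> \<Longrightarrow> Cod C (\<gamma> A B) = B \<otimes> A"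
  using Assoc_closed[of A B D] LUnit_closed[of A] RUnit_closed[of A] Sym_closed[of A B] by auto

text \<open>Oriented towards fewer tensors. Later proofs split a tensor of composites by hand, and
  the simplifier verifies the split by merging it again.\<close>

lemma tensor_comp [simp]:
  assumes "f \<in> Arr C" "f' \<in> Arr C" "g \<in> Arr C" "g' \<in> Arr C" "Dom C f' = Cod C f" "Dom C g'
      = Cod C g"
  shows "(f' \<otimes>\<^sub>a g') \<cdot> (f \<otimes>\<^sub>a g) = (f' \<cdot> f) \<otimes>\<^sub>a (g' \<cdot> g)"
  using TensorA_Comp[of f "Dom C f" "Cod C f" f' "Cod C f'" g "Dom C g" "Cod C g" g'
      "Cod C g'"] assms by simp

lemma tensor_comp_extend [simp]:
  assumes "f \<in> Arr C" "f' \<in> Arr C" "g \<in> Arr C" "g' \<in> Arr C" "Dom C f' = Cod C f" "Dom C g'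
      = Cod C g"
    "k \<in> Arr C" "Cod C k = Dom C f \<otimes> Dom C g"
  shows "(f' \<otimes>\<^sub>a g') \<cdot> ((f \<otimes>\<^sub>a g) \<cdot> k) = ((f' \<cdot> f) \<otimes>\<^sub>a (g' \<cdot> g)) \<cdot> k"
  by (rule comp_extend) (use assms in simp_all)

lemma iso_Sym [simp]:
  assumes "A \<in> Obj C" "B \<in> Obj C"
  shows "is_iso C (\<gamma> A B)" "inv_arr C (\<gamma> A B) = \<gamma> B A"
proof -
  have "inverse_arrows C (\<gamma> A B) (\<gamma> B A)" using assms by (intro inverse_arrowsI) auto
  then show "is_iso C (\<gamma> A B)" "inv_arr C (\<gamma> A B) = \<gamma> B A"
    using inverse_arrows_is_iso inv_arr_eqI by auto
qed

lemma iso_tensor [simp]: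
  assumes "is_iso C f" "is_iso C g"
  shows "is_iso C (f \<otimes>\<^sub>a g)" "inv_arr C (f \<otimes>\<^sub>a g) = inv_arr C f \<otimes>\<^sub>a inv_arr C g"
proof -
  have "inverse_arrows C (f \<otimes>\<^sub>a g) (inv_arr C f \<otimes>\<^sub>a inv_arr C g)"
    using assms is_iso_arr[OF assms(1)] is_iso_arr[OF assms(2)] by (intro inverse_arrowsI) simp_all
  then show "is_iso C (f \<otimes>\<^sub>a g)" "inv_arr C (f \<otimes>\<^sub>a g) = inv_arr C f \<otimes>\<^sub>a inv_arr C g"
    using inverse_arrows_is_iso inv_arr_eqI by auto
qed

text \<open>The source indices are written \<open>Dom C f\<close> and so on, so that every variable
  of the right side occurs on the left. The law can then serve as a rewrite rule, with the target
  indices fixed by the typing hypotheses.\<close>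

lemma assoc_naturality:
  assumes "f \<in> Arr C" "g \<in> Arr C" "h \<in> Arr C" "Cod C f = A" "Cod C g = B" "Cod C h = D"
  shows "\<alpha> A B D \<cdot> ((f \<otimes>\<^sub>a g) \<otimes>\<^sub>a h) = (f \<otimes>\<^sub>a (g \<otimes>\<^sub>a h)) \<cdot> \<alpha> (Dom C f) (Dom C g) (Dom C h)"
  using Assoc_natural[of f "Dom C f" A g "Dom C g" B h "Dom C h" D] assms by simp

lemma assoc_inv_naturality:
  assumes "f \<in> Arr C" "g \<in> Arr C" "h \<in> Arr C" "Cod C f = A" "Cod C g = B" "Cod C h = D"
  shows "\<alpha>' A B D \<cdot> (f \<otimes>\<^sub>a (g \<otimes>\<^sub>a h)) = ((f \<otimes>\<^sub>a g) \<otimes>\<^sub>a h) \<cdot> \<alpha>' (Dom C f) (Dom C g) (Dom C h)"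
  by (rule inverse_square[OF assoc_naturality[symmetric, OF assms]]) (use assms in auto)

lemma lunit_naturality:
  "\<lbrakk>f \<in> Arr C; Cod C f = A\<rbrakk> \<Longrightarrow> \<l> A \<cdot> (I \<rhd> f) = f \<cdot> \<l> (Dom C f)"
  using LUnit_natural[of f "Dom C f" A] by simp

lemma lunit_inv_naturality:
  assumes "f \<in> Arr C" "Cod C f = A"
  shows "\<l>' A \<cdot> f = (I \<rhd> f) \<cdot> \<l>' (Dom C f)"
  by (rule inverse_square[OF lunit_naturality[symmetric, OF assms]]) (use assms in auto)

lemma sym_naturality:
  "\<lbrakk>f \<in> Arr C; g \<in> Arr C; Cod C f = A; Cod C g = B\<rbrakk>
    \<Longrightarrow> \<gamma> A B \<cdot> (f \<otimes>\<^sub>a g) = (g \<otimes>\<^sub>a f) \<cdot> \<gamma> (Dom C f) (Dom C g)"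
  using Sym_natural[of f "Dom C f" A g "Dom C g" B] by simp

text \<open>Naturality of the left unitor at the arrow \<open>\<l> A\<close> itself gives the
  equation followed by \<open>\<l> A\<close>, which is cancelled.\<close>

lemma lunit_tensor_unit:
  assumes "A \<in> Obj C"
  shows "\<l> (I \<otimes> A) = I \<rhd> \<l> A"
  by (rule iso_cancel_left[of "\<l> A"]) (use lunit_naturality[of "\<l> A" A] assms in auto)

text \<open>Naturality recovers \<open>f\<close> from \<open>I \<rhd> f\<close> by conjugating with
  left unitors, so whiskering with the unit loses nothing.\<close>

lemma lunit_faithful:
  assumes "I \<rhd> f = I \<rhd> g" "f \<in> Arr C" "g \<in> Arr C" "Dom C f = Dom C g" "Cod C f = Cod C g"
  shows "f = g"
proof (rule iso_cancel_right[of _ "\<l> (Dom C g)"])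
  show "f \<cdot> \<l> (Dom C g) = g \<cdot> \<l> (Dom C g)"
    using lunit_naturality[of f "Cod C g"] lunit_naturality[of g "Cod C g"] assms by simp
qed (use assms in auto)

text \<open>Kelly's derivation of the left unit law for \<open>A \<otimes> B\<close>; after whiskering with \<open>I\<close> it follows
  from the pentagon and the triangle.\<close>

lemma lunit_tensor:
  assumes [simp]: "A \<in> Obj C" "B \<in> Obj C"
  shows "\<l> (A \<otimes> B) \<cdot> \<alpha> I A B = \<l> A \<lhd> B"
proof (rule lunit_faithful)
  \<comment> \<open>\<open>?k\<close> is the tail of the pentagon at \<open>I\<close>,
    \<open>I\<close>, \<open>A\<close>, \<open>B\<close>. Composing with it makes the pentagon and
    the triangle applicable, and it cancels because it is invertible.\<close>
  let ?k = "\<alpha> I (I \<otimes> A) B \<cdot> (\<alpha> I I A \<lhd> B)"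
  show "I \<rhd> (\<l> (A \<otimes> B) \<cdot> \<alpha> I A B) = I \<rhd> (\<l> A \<lhd> B)"
  proof (rule iso_cancel_right[of _ ?k])
    have "(I \<rhd> (\<l> (A \<otimes> B) \<cdot> \<alpha> I A B)) \<cdot> ?k = (I \<rhd> \<l> (A \<otimes> B)) \<cdot> ((I \<rhd> \<alpha> I A B) \<cdot> ?k)"
      by simp
    also have "\<dots> = (I \<rhd> \<l> (A \<otimes> B)) \<cdot> (\<alpha> I I (A \<otimes> B) \<cdot> \<alpha> (I \<otimes> I) A B)"
      by (simp only: pentagon[OF Unit_closed Unit_closed assms])
    also have "\<dots> = (\<r> I \<lhd> (A \<otimes> B)) \<cdot> \<alpha> (I \<otimes> I) A B"
      by (rule comp_extend) (use triangle[of I "A \<otimes> B"] in auto)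
    also have "\<dots> = \<alpha> I A B \<cdot> ((\<r> I \<lhd> A) \<lhd> B)"
      using assoc_naturality[of "\<r> I" "Id C A" "Id C B" I A B] by simp
    also have "\<dots> = \<alpha> I A B \<cdot> (((I \<rhd> \<l> A) \<cdot> \<alpha> I I A) \<lhd> B)"
      using triangle[of I A] by simp
    also have "\<dots> = (\<alpha> I A B \<cdot> ((I \<rhd> \<l> A) \<lhd> B)) \<cdot> (\<alpha> I I A \<lhd> B)"
      by simp
    also have "\<dots> = (I \<rhd> (\<l> A \<lhd> B)) \<cdot> ?k"
      using assoc_naturality[of "Id C I" "\<l> A" "Id C B" I A B] by simp
    finally show "(I \<rhd> (\<l> (A \<otimes> B) \<cdot> \<alpha> I A B)) \<cdot> ?k = (I \<rhd> (\<l> A \<lhd> B)) \<cdot> ?k" .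
  qed auto
qed auto

text \<open>\<open>\<sigma> A B Z : A \<otimes> (B \<otimes> Z) \<rightarrow> B \<otimes> (A \<otimes> Z)\<close> transposes the first two letters of a right-bracketed
  word. Rewriting in terms of \<open>\<sigma>\<close> is what keeps the associators under control below.\<close>

definition \<sigma> where "\<sigma> A B Z = \<alpha> B A Z \<cdot> (\<gamma> A B \<lhd> Z) \<cdot> \<alpha>' A B Z"

lemma \<sigma>_simps [simp]:
  assumes "A \<in> Obj C" "B \<in> Obj C" "Z \<in> Obj C"
  shows "\<sigma> A B Z \<in> Arr C" "Dom C (\<sigma> A B Z) = A \<otimes> (B \<otimes> Z)" "Cod C (\<sigma> A B Z) = B \<otimes> (A \<otimes> Z)"
    "is_iso C (\<sigma> A B Z)" "inv_arr C (\<sigma> A B Z) = \<sigma> B A Z"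
  using assms by (auto simp: \<sigma>_def)

lemma \<sigma>_naturality:
  assumes [simp]: "f \<in> Arr C" "g \<in> Arr C" "h \<in> Arr C" and [simp]: "Cod C f = A" "Cod C g = B"
      "Cod C h = Z"
  shows "\<sigma> A B Z \<cdot> (f \<otimes>\<^sub>a (g \<otimes>\<^sub>a h)) = (g \<otimes>\<^sub>a (f \<otimes>\<^sub>a h)) \<cdot> \<sigma> (Dom C f) (Dom C g) (Dom C h)"
proof -
  have [simp]: "A \<in> Obj C" "B \<in> Obj C" "Z \<in> Obj C" using assms Cod_closed by blast+
  have "\<sigma> A B Z \<cdot> (f \<otimes>\<^sub>a (g \<otimes>\<^sub>a h)) = \<alpha> B A Z \<cdot> (\<gamma> A B \<lhd> Z) \<cdot> ((f \<otimes>\<^sub>a g) \<otimes>\<^sub>a h)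
      \<cdot> \<alpha>' (Dom C f) (Dom C g) (Dom C h)"
    using assoc_inv_naturality[of f g h A B Z] by (simp add: \<sigma>_def del: tensor_comp
        tensor_comp_extend)
  also have "\<dots> = (\<alpha> B A Z \<cdot> ((g \<otimes>\<^sub>a f) \<otimes>\<^sub>a h)) \<cdot> (\<gamma> (Dom C f) (Dom C g) \<lhd> Dom C h)
      \<cdot> \<alpha>' (Dom C f) (Dom C g) (Dom C h)"
    using sym_naturality[of f g A B] by simp
  also have "\<dots> = (g \<otimes>\<^sub>a (f \<otimes>\<^sub>a h)) \<cdot> \<sigma> (Dom C f) (Dom C g) (Dom C h)"
    using assoc_naturality[of g f h B A Z] by (simp add: \<sigma>_def)
  finally show ?thesis .
qed

text \<open>The pentagon solved for the terms around \<open>\<alpha>' A B Z \<lhd> W\<close>. Such a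
  factor appears as soon as \<sigma> or \<tau> is whiskered on the right.\<close>

lemma pentagon_shift:
  assumes [simp]: "A \<in> Obj C" "B \<in> Obj C" "Z \<in> Obj C" "W \<in> Obj C"
  shows "\<alpha> (A \<otimes> B) Z W \<cdot> (\<alpha>' A B Z \<lhd> W) = \<alpha>' A B (Z \<otimes> W) \<cdot> (A \<rhd> \<alpha> B Z W) \<cdot> \<alpha> A (B \<otimes> Z) W"
    "(A \<rhd> \<alpha> B Z W) \<cdot> \<alpha> A (B \<otimes> Z) W = \<alpha> A B (Z \<otimes> W) \<cdot> \<alpha> (A \<otimes> B) Z W \<cdot> (\<alpha>' A B Z \<lhd> W)"
proof -
  have "(\<alpha> A B (Z \<otimes> W) \<cdot> \<alpha> (A \<otimes> B) Z W) \<cdot> (\<alpha>' A B Z \<lhd> W)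
      = ((A \<rhd> \<alpha> B Z W) \<cdot> \<alpha> A (B \<otimes> Z) W \<cdot> (\<alpha> A B Z \<lhd> W)) \<cdot> (\<alpha>' A B Z \<lhd> W)"
    by (simp only: pentagon[OF assms])
  then show *: "(A \<rhd> \<alpha> B Z W) \<cdot> \<alpha> A (B \<otimes> Z) W = \<alpha> A B (Z \<otimes> W) \<cdot> \<alpha> (A \<otimes> B) Z W \<cdot> (\<alpha>' A B Z \<lhd> W)"
    by simp
  show "\<alpha> (A \<otimes> B) Z W \<cdot> (\<alpha>' A B Z \<lhd> W) = \<alpha>' A B (Z \<otimes> W) \<cdot> (A \<rhd> \<alpha> B Z W) \<cdot> \<alpha> A (B \<otimes> Z) W"
    by (simp add: *)
qed

text \<open>Whiskering by \<open>W\<close> only lengthens the spectator \<open>Z\<close> to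
  \<open>Z \<otimes> W\<close>. The outer associator crosses the last factor of \<sigma> by the
  pentagon, \<gamma> by naturality, and the first factor by the shifted pentagon. The pentagon needs
  \<open>B \<rhd> \<alpha> A Z W\<close> in front; it is cancelled at the end.\<close>

lemma \<sigma>_whisker:
  assumes [simp]: "A \<in> Obj C" "B \<in> Obj C" "Z \<in> Obj C" "W \<in> Obj C"
  shows "\<alpha> B (A \<otimes> Z) W \<cdot> (\<sigma> A B Z \<lhd> W)
    = (B \<rhd> \<alpha>' A Z W) \<cdot> \<sigma> A B (Z \<otimes> W) \<cdot> (A \<rhd> \<alpha> B Z W) \<cdot> \<alpha> A (B \<otimes> Z) W"
proof -
  have "(B \<rhd> \<alpha> A Z W) \<cdot> \<alpha> B (A \<otimes> Z) W \<cdot> (\<sigma> A B Z \<lhd> W)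
    = ((B \<rhd> \<alpha> A Z W) \<cdot> \<alpha> B (A \<otimes> Z) W \<cdot> (\<alpha> B A Z \<lhd> W)) \<cdot> ((\<gamma> A B \<lhd> Z) \<lhd> W) \<cdot> (\<alpha>' A B Z \<lhd> W)"
    by (simp add: \<sigma>_def)
  also have "\<dots> = (\<alpha> B A (Z \<otimes> W) \<cdot> \<alpha> (B \<otimes> A) Z W) \<cdot> ((\<gamma> A B \<lhd> Z) \<lhd> W) \<cdot> (\<alpha>' A B Z \<lhd> W)"
    by (simp only: pentagon[OF assms(2,1,3,4)])
  also have "\<dots> = \<alpha> B A (Z \<otimes> W) \<cdot> (\<alpha> (B \<otimes> A) Z W \<cdot> ((\<gamma> A B \<lhd> Z) \<lhd> W)) \<cdot> (\<alpha>' A B Z \<lhd> W)"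
    by simp
  also have "\<dots> = \<alpha> B A (Z \<otimes> W) \<cdot> (\<gamma> A B \<lhd> (Z \<otimes> W)) \<cdot> (\<alpha> (A \<otimes> B) Z W \<cdot> (\<alpha>' A B Z \<lhd> W))"
    using assoc_naturality[of "\<gamma> A B" "Id C Z" "Id C W" "B \<otimes> A" Z W] by simp
  also have "\<dots> = \<sigma> A B (Z \<otimes> W) \<cdot> (A \<rhd> \<alpha> B Z W) \<cdot> \<alpha> A (B \<otimes> Z) W"
    by (simp add: \<sigma>_def pentagon_shift(1))
  finally show ?thesis
    by - (rule iso_cancel_left[of "B \<rhd> \<alpha> A Z W"], simp_all)
qed

text \<open>The hexagon with its first associator brought to the other side, where it completes a
  \<sigma>.\<close>

lemma sym_tensor_right:
  assumes [simp]: "A \<in> Obj C" "B \<in> Obj C" "D \<in> Obj C"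
  shows "\<alpha> B D A \<cdot> \<gamma> A (B \<otimes> D) = (B \<rhd> \<gamma> A D) \<cdot> \<sigma> A B D"
proof -
  have "(\<alpha> B D A \<cdot> \<gamma> A (B \<otimes> D) \<cdot> \<alpha> A B D) \<cdot> \<alpha>' A B D
    = ((B \<rhd> \<gamma> A D) \<cdot> \<alpha> B A D \<cdot> (\<gamma> A B \<lhd> D)) \<cdot> \<alpha>' A B D"
    by (simp only: hexagon[OF assms(1-3)])
  then show ?thesis by (simp add: \<sigma>_def)
qed

text \<open>The hexagon in the presence of a spectator: to carry \<open>A\<close> past
  \<open>B \<otimes> D\<close> is to carry it past \<open>B\<close> and then past \<open>D\<close>.
  \<open>\<sigma>_whisker\<close> disposes of \<open>Z\<close>.\<close>

lemma \<sigma>_tensor_right: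
  assumes [simp]: "A \<in> Obj C" "B \<in> Obj C" "D \<in> Obj C" "Z \<in> Obj C"
  shows "\<alpha> B D (A \<otimes> Z) \<cdot> \<sigma> A (B \<otimes> D) Z = (B \<rhd> \<sigma> A D Z) \<cdot> \<sigma> A B (D \<otimes> Z) \<cdot> (A \<rhd> \<alpha> B D Z)"
proof -
  have "\<alpha> B D (A \<otimes> Z) \<cdot> \<sigma> A (B \<otimes> D) Z
    = (\<alpha> B D (A \<otimes> Z) \<cdot> \<alpha> (B \<otimes> D) A Z) \<cdot> (\<gamma> A (B \<otimes> D) \<lhd> Z) \<cdot> \<alpha>' A (B \<otimes> D) Z"
    by (simp add: \<sigma>_def)
  also have "\<dots> = ((B \<rhd> \<alpha> D A Z) \<cdot> \<alpha> B (D \<otimes> A) Z \<cdot> (\<alpha> B D A \<lhd> Z)) \<cdot> (\<gamma> A (B \<otimes> D) \<lhd> Z)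
      \<cdot> \<alpha>' A (B \<otimes> D) Z"
    by (simp only: pentagon[OF assms(2,3,1,4)])
  also have "\<dots> = (B \<rhd> \<alpha> D A Z) \<cdot> (\<alpha> B (D \<otimes> A) Z \<cdot> ((B \<rhd> \<gamma> A D) \<lhd> Z)) \<cdot> (\<sigma> A B D \<lhd> Z)
      \<cdot> \<alpha>' A (B \<otimes> D) Z"
    by (simp add: sym_tensor_right)
  also have "\<dots> = (B \<rhd> (\<alpha> D A Z \<cdot> (\<gamma> A D \<lhd> Z))) \<cdot> (\<alpha> B (A \<otimes> D) Z \<cdot> (\<sigma> A B D \<lhd> Z)) \<cdot> \<alpha>' A (B \<otimes> D) Z"
    using assoc_naturality[of "Id C B" "\<gamma> A D" "Id C Z" B "D \<otimes> A" Z] by simp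
  also have "\<dots> = (B \<rhd> \<sigma> A D Z) \<cdot> \<sigma> A B (D \<otimes> Z) \<cdot> (A \<rhd> \<alpha> B D Z)"
    by (simp add: \<sigma>_whisker) (simp add: \<sigma>_def)
  finally show ?thesis .
qed

text \<open>Inverting the previous law reverses every transposition, and a reversed \<sigma> is
  again a \<sigma>. This gives the law for a compound moving letter without a second hexagon
  axiom.\<close>

lemma \<sigma>_tensor_left:
  assumes [simp]: "A \<in> Obj C" "B \<in> Obj C" "D \<in> Obj C" "Z \<in> Obj C"
  shows "(D \<rhd> \<alpha> A B Z) \<cdot> \<sigma> (A \<otimes> B) D Z = \<sigma> A D (B \<otimes> Z) \<cdot> (A \<rhd> \<sigma> B D Z) \<cdot> \<alpha> A B (D \<otimes> Z)"
proof -
  have "inv_arr C (\<alpha> A B (D \<otimes> Z) \<cdot> \<sigma> D (A \<otimes> B) Z)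
    = inv_arr C ((A \<rhd> \<sigma> D B Z) \<cdot> \<sigma> D A (B \<otimes> Z) \<cdot> (D \<rhd> \<alpha> A B Z))"
    by (simp only: \<sigma>_tensor_right[OF assms(3,1,2,4)])
  then have "\<sigma> (A \<otimes> B) D Z \<cdot> \<alpha>' A B (D \<otimes> Z) = (D \<rhd> \<alpha>' A B Z) \<cdot> \<sigma> A D (B \<otimes> Z) \<cdot> (A \<rhd> \<sigma> B D Z)"
    by simp
  from comp_extend[OF this, of "\<alpha> A B (D \<otimes> Z)"] show ?thesis by simp
qed

text \<open>The other hexagon, obtained by inverting \<open>sym_tensor_right\<close>.\<close>

lemma sym_tensor_left:
  assumes [simp]: "A \<in> Obj C" "B \<in> Obj C" "D \<in> Obj C"
  shows "\<gamma> (A \<otimes> B) D = \<sigma> A D B \<cdot> (A \<rhd> \<gamma> B D) \<cdot> \<alpha> A B D"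
proof -
  have "inv_arr C (\<alpha> A B D \<cdot> \<gamma> D (A \<otimes> B)) = inv_arr C ((A \<rhd> \<gamma> D B) \<cdot> \<sigma> D A B)"
    by (simp only: sym_tensor_right[OF assms(3,1,2)])
  then have "\<gamma> (A \<otimes> B) D \<cdot> \<alpha>' A B D = \<sigma> A D B \<cdot> (A \<rhd> \<gamma> B D)" by simp
  from comp_extend[OF this, of "\<alpha> A B D"] show ?thesis by simp
qed

text \<open>A transposition with the unit is invisible to the left unitor. The first law combines
  the unit law for \<open>A \<otimes> B\<close>, the unit axiom of the symmetry and the triangle;
  the second is the first composed with the reverse transposition.\<close>

lemma lunit_\<sigma>:
  assumes [simp]: "A \<in> Obj C" "B \<in> Obj C"
  shows "\<l> (A \<otimes> B) \<cdot> \<sigma> A I B = A \<rhd> \<l> B" "(A \<rhd> \<l> B) \<cdot> \<sigma> I A B = \<l> (A \<otimes> B)"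
proof -
  have "\<l> (A \<otimes> B) \<cdot> \<sigma> A I B = (\<l> (A \<otimes> B) \<cdot> \<alpha> I A B) \<cdot> (\<gamma> A I \<lhd> B) \<cdot> \<alpha>' A I B"
    by (simp add: \<sigma>_def)
  also have "\<dots> = (\<r> A \<lhd> B) \<cdot> \<alpha>' A I B"
    by (simp add: lunit_tensor RUnit_Sym)
  also have "\<dots> = A \<rhd> \<l> B"
    by (simp add: triangle[symmetric])
  finally show *: "\<l> (A \<otimes> B) \<cdot> \<sigma> A I B = A \<rhd> \<l> B" .
  show "(A \<rhd> \<l> B) \<cdot> \<sigma> I A B = \<l> (A \<otimes> B)"
    using inv_arr_simps(5)[of "\<sigma> A I B"] unfolding *[symmetric] by simp
qed

section \<open>The interchange of middle factors\<close>

abbreviation \<tau> where "\<tau> \<equiv> interchange C"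

text \<open>The middle factor of the interchange is a transposition in front of the spectator
  \<open>B\<close>, so the calculus of \<sigma> applies.\<close>

lemma \<tau>_\<sigma>:
  assumes "M \<in> Obj C" "A \<in> Obj C" "N \<in> Obj C" "B \<in> Obj C"
  shows "\<tau> M A N B = \<alpha>' M N (A \<otimes> B) \<cdot> (M \<rhd> \<sigma> A N B) \<cdot> \<alpha> M A (N \<otimes> B)"
  using assms by (simp add: interchange_def \<sigma>_def)

text \<open>Exchanging the middle letters twice restores them, so the inverse is an interchange too.
  The right half of a tensor of optics is built with this inverse.\<close>

lemma \<tau>_simps [simp]:
  assumes "M \<in> Obj C" "A \<in> Obj C" "N \<in> Obj C" "B \<in> Obj C"
  shows "\<tau> M A N B \<in> Arr C" "Dom C (\<tau> M A N B) = (M \<otimes> A) \<otimes> (N \<otimes> B)"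
    "Cod C (\<tau> M A N B) = (M \<otimes> N) \<otimes> (A \<otimes> B)"
    "is_iso C (\<tau> M A N B)" "inv_arr C (\<tau> M A N B) = \<tau> M N A B"
  using assms by (auto simp: \<tau>_\<sigma>)

lemma \<tau>_naturality:
  assumes [simp]: "f \<in> Arr C" "g \<in> Arr C" "h \<in> Arr C" "k \<in> Arr C"
    and [simp]: "Cod C f = M" "Cod C g = A" "Cod C h = N" "Cod C k = B"
  shows "\<tau> M A N B \<cdot> ((f \<otimes>\<^sub>a g) \<otimes>\<^sub>a (h \<otimes>\<^sub>a k))
    = ((f \<otimes>\<^sub>a h) \<otimes>\<^sub>a (g \<otimes>\<^sub>a k)) \<cdot> \<tau> (Dom C f) (Dom C g) (Dom C h) (Dom C k)"
proof -
  have [simp]: "M \<in> Obj C" "A \<in> Obj C" "N \<in> Obj C" "B \<in> Obj C" using assms Cod_closed by blast+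
  have "\<tau> M A N B \<cdot> ((f \<otimes>\<^sub>a g) \<otimes>\<^sub>a (h \<otimes>\<^sub>a k))
    = \<alpha>' M N (A \<otimes> B) \<cdot> (f \<otimes>\<^sub>a (\<sigma> A N B \<cdot> (g \<otimes>\<^sub>a (h \<otimes>\<^sub>a k))))
        \<cdot> \<alpha> (Dom C f) (Dom C g) (Dom C h \<otimes> Dom C k)"
    using assoc_naturality[of f g "h \<otimes>\<^sub>a k" M A "N \<otimes> B"] by (simp add: \<tau>_\<sigma>)
  also have "\<dots> = (\<alpha>' M N (A \<otimes> B) \<cdot> (f \<otimes>\<^sub>a (h \<otimes>\<^sub>a (g \<otimes>\<^sub>a k))))
      \<cdot> (Dom C f \<rhd> \<sigma> (Dom C g) (Dom C h) (Dom C k)) \<cdot> \<alpha> (Dom C f) (Dom C g) (Dom C h \<otimes> Dom C k)"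
    using \<sigma>_naturality[of g h k A N B] by simp
  also have "\<dots> = ((f \<otimes>\<^sub>a h) \<otimes>\<^sub>a (g \<otimes>\<^sub>a k)) \<cdot> \<tau> (Dom C f) (Dom C g) (Dom C h) (Dom C k)"
    using assoc_inv_naturality[of f h "g \<otimes>\<^sub>a k" M N "A \<otimes> B"] by (simp add: \<tau>_\<sigma>)
  finally show ?thesis .
qed

text \<open>On the word \<open>M A N B P D\<close> both sides move \<open>N\<close> past \<open>A\<close> and \<open>P\<close> past \<open>A\<close> and
  \<open>B\<close>; they differ only in the order of the transpositions of \<open>A, N\<close> and of \<open>B, P\<close>, which commute. The same identity, read
  with different letters, gives both the interchange law for the tensor of optics and the
  naturality of the associator.\<close>

lemma \<tau>_assoc:
  assumes [simp]: "M \<in> Obj C" "A \<in> Obj C" "N \<in> Obj C" "B \<in> Obj C" "P \<in> Obj C" "D \<in> Obj C"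
  shows "(\<alpha> M N P \<otimes>\<^sub>a \<alpha> A B D) \<cdot> \<tau> (M \<otimes> N) (A \<otimes> B) P D \<cdot> (\<tau> M A N B \<lhd> (P \<otimes> D))
    = \<tau> M A (N \<otimes> P) (B \<otimes> D) \<cdot> ((M \<otimes> A) \<rhd> \<tau> N B P D) \<cdot> \<alpha> (M \<otimes> A) (N \<otimes> B) (P \<otimes> D)"
    (is "?L = ?R")
proof (rule iso_cancel_left[of "\<alpha> M (N \<otimes> P) (A \<otimes> (B \<otimes> D))"])
  let ?X = "A \<otimes> (B \<otimes> D)" and ?W = "P \<otimes> D"
  let ?s = "\<sigma> A P (B \<otimes> D) \<cdot> (A \<rhd> \<sigma> B P D)"
  \<comment> \<open>The outer factors: the pentagon trades \<open>\<alpha> M N P\<close> for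
    associators around \<open>?X\<close>, and \<open>\<sigma>_tensor_left\<close> splits the passage
    of \<open>A \<otimes> B\<close> past \<open>P\<close> into the two transpositions collected in
    \<open>?s\<close>.\<close>
  have left: "\<alpha> M (N \<otimes> P) ?X \<cdot> (\<alpha> M N P \<otimes>\<^sub>a \<alpha> A B D) \<cdot> \<tau> (M \<otimes> N) (A \<otimes> B) P D
    = (M \<rhd> (\<alpha>' N P ?X \<cdot> (N \<rhd> (?s \<cdot> \<alpha> A B ?W)))) \<cdot> \<alpha> M N ((A \<otimes> B) \<otimes> ?W) \<cdot> \<alpha> (M \<otimes> N) (A \<otimes> B) ?W"
  proof -
    have pent: "\<alpha> M (N \<otimes> P) ?X \<cdot> (\<alpha> M N P \<lhd> ?X) = (M \<rhd> \<alpha>' N P ?X) \<cdot> \<alpha> M N (P \<otimes> ?X) \<cdot> \<alpha> (M \<otimes> N) P ?X"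
      using pentagon[of M N P ?X] by simp
    have "\<alpha> M (N \<otimes> P) ?X \<cdot> (\<alpha> M N P \<otimes>\<^sub>a \<alpha> A B D) \<cdot> \<tau> (M \<otimes> N) (A \<otimes> B) P D
      = (\<alpha> M (N \<otimes> P) ?X \<cdot> (\<alpha> M N P \<lhd> ?X)) \<cdot> (((M \<otimes> N) \<otimes> P) \<rhd> \<alpha> A B D)
        \<cdot> \<alpha>' (M \<otimes> N) P ((A \<otimes> B) \<otimes> D) \<cdot> ((M \<otimes> N) \<rhd> \<sigma> (A \<otimes> B) P D) \<cdot> \<alpha> (M \<otimes> N) (A \<otimes> B) ?W"
      by (simp add: \<tau>_\<sigma>)
    also have "\<dots> = (M \<rhd> \<alpha>' N P ?X) \<cdot> \<alpha> M N (P \<otimes> ?X) \<cdot> (\<alpha> (M \<otimes> N) P ?X \<cdot> (((M \<otimes> N) \<otimes> P) \<rhd> \<alpha> A B D))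
        \<cdot> \<alpha>' (M \<otimes> N) P ((A \<otimes> B) \<otimes> D) \<cdot> ((M \<otimes> N) \<rhd> \<sigma> (A \<otimes> B) P D) \<cdot> \<alpha> (M \<otimes> N) (A \<otimes> B) ?W"
      by (simp add: pent)
    also have "\<dots> = (M \<rhd> \<alpha>' N P ?X) \<cdot> \<alpha> M N (P \<otimes> ?X)
        \<cdot> ((M \<otimes> N) \<rhd> ((P \<rhd> \<alpha> A B D) \<cdot> \<sigma> (A \<otimes> B) P D)) \<cdot> \<alpha> (M \<otimes> N) (A \<otimes> B) ?W"
      using assoc_naturality[of "Id C (M \<otimes> N)" "Id C P" "\<alpha> A B D" "M \<otimes> N" P ?X] by simp
    also have "\<dots> = (M \<rhd> \<alpha>' N P ?X) \<cdot> (\<alpha> M N (P \<otimes> ?X) \<cdot> ((M \<otimes> N) \<rhd> (?s \<cdot> \<alpha> A B ?W)))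
        \<cdot> \<alpha> (M \<otimes> N) (A \<otimes> B) ?W"
      by (simp add: \<sigma>_tensor_left)
    also have "\<dots> = (M \<rhd> (\<alpha>' N P ?X \<cdot> (N \<rhd> (?s \<cdot> \<alpha> A B ?W)))) \<cdot> \<alpha> M N ((A \<otimes> B) \<otimes> ?W)
        \<cdot> \<alpha> (M \<otimes> N) (A \<otimes> B) ?W"
      using assoc_naturality[of "Id C M" "Id C N" "?s \<cdot> \<alpha> A B ?W" M N "P \<otimes> ?X"] by simp
    finally show ?thesis .
  qed
  \<comment> \<open>The first interchange, whiskered by \<open>?W\<close>: the shifted pentagon
    absorbs its last associator, and \<open>\<sigma>_whisker\<close> absorbs \<open>?W\<close> into
    the spectator.\<close>
  have right: "\<alpha> M N ((A \<otimes> B) \<otimes> ?W) \<cdot> \<alpha> (M \<otimes> N) (A \<otimes> B) ?W \<cdot> (\<tau> M A N B \<lhd> ?W)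
    = (M \<rhd> ((N \<rhd> \<alpha>' A B ?W) \<cdot> \<sigma> A N (B \<otimes> ?W) \<cdot> (A \<rhd> \<alpha> N B ?W) \<cdot> \<alpha> A (N \<otimes> B) ?W))
      \<cdot> \<alpha> M (A \<otimes> (N \<otimes> B)) ?W \<cdot> (\<alpha> M A (N \<otimes> B) \<lhd> ?W)"
  proof -
    have "\<alpha> M N ((A \<otimes> B) \<otimes> ?W) \<cdot> \<alpha> (M \<otimes> N) (A \<otimes> B) ?W \<cdot> (\<tau> M A N B \<lhd> ?W)
      = (\<alpha> M N ((A \<otimes> B) \<otimes> ?W) \<cdot> \<alpha> (M \<otimes> N) (A \<otimes> B) ?W \<cdot> (\<alpha>' M N (A \<otimes> B) \<lhd> ?W))
        \<cdot> ((M \<rhd> \<sigma> A N B) \<lhd> ?W) \<cdot> (\<alpha> M A (N \<otimes> B) \<lhd> ?W)"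
      by (simp add: \<tau>_\<sigma>)
    also have "\<dots> = ((M \<rhd> \<alpha> N (A \<otimes> B) ?W) \<cdot> \<alpha> M (N \<otimes> (A \<otimes> B)) ?W)
        \<cdot> ((M \<rhd> \<sigma> A N B) \<lhd> ?W) \<cdot> (\<alpha> M A (N \<otimes> B) \<lhd> ?W)"
      by (simp only: pentagon_shift(2) assms TensorO_closed)
    also have "\<dots> = (M \<rhd> \<alpha> N (A \<otimes> B) ?W) \<cdot> (\<alpha> M (N \<otimes> (A \<otimes> B)) ?W
        \<cdot> ((M \<rhd> \<sigma> A N B) \<lhd> ?W)) \<cdot> (\<alpha> M A (N \<otimes> B) \<lhd> ?W)"
      by simp
    also have "\<dots> = (M \<rhd> (\<alpha> N (A \<otimes> B) ?W \<cdot> (\<sigma> A N B \<lhd> ?W))) \<cdot> \<alpha> M (A \<otimes> (N \<otimes> B)) ?W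
        \<cdot> (\<alpha> M A (N \<otimes> B) \<lhd> ?W)"
      using assoc_naturality[of "Id C M" "\<sigma> A N B" "Id C ?W" M "N \<otimes> (A \<otimes> B)" ?W] by simp
    finally show ?thesis by (simp add: \<sigma>_whisker)
  qed
  \<comment> \<open>The only place where two transpositions pass each other: \<sigma> of
    \<open>A\<close> and \<open>N\<close> is natural in its spectator, so \<sigma> of
    \<open>B\<close> and \<open>P\<close> moves through it. Then
    \<open>\<sigma>_tensor_right\<close> fuses the passages of \<open>A\<close> past
    \<open>N\<close> and past \<open>P\<close>.\<close>
  have middle: "\<alpha>' N P ?X \<cdot> (N \<rhd> ?s) \<cdot> \<sigma> A N (B \<otimes> ?W) \<cdot> (A \<rhd> \<alpha> N B ?W)
    = \<sigma> A (N \<otimes> P) (B \<otimes> D) \<cdot> (A \<rhd> \<tau> N B P D)"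
  proof -
    have "\<alpha>' N P ?X \<cdot> (N \<rhd> ?s) \<cdot> \<sigma> A N (B \<otimes> ?W) \<cdot> (A \<rhd> \<alpha> N B ?W)
      = \<alpha>' N P ?X \<cdot> (N \<rhd> \<sigma> A P (B \<otimes> D)) \<cdot> ((N \<rhd> (A \<rhd> \<sigma> B P D)) \<cdot> \<sigma> A N (B \<otimes> ?W)) \<cdot> (A \<rhd> \<alpha> N B ?W)"
      by simp
    also have "\<dots> = \<alpha>' N P ?X \<cdot> (N \<rhd> \<sigma> A P (B \<otimes> D)) \<cdot> (\<sigma> A N (P \<otimes> (B \<otimes> D)) \<cdot> (A \<rhd> (N \<rhd> \<sigma> B P D)))
        \<cdot> (A \<rhd> \<alpha> N B ?W)"
      using \<sigma>_naturality[of "Id C A" "Id C N" "\<sigma> B P D" A N "P \<otimes> (B \<otimes> D)"] by simp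
    also have "\<dots> = \<alpha>' N P ?X \<cdot> ((N \<rhd> \<sigma> A P (B \<otimes> D)) \<cdot> \<sigma> A N (P \<otimes> (B \<otimes> D)) \<cdot> (A \<rhd> \<alpha> N P (B \<otimes> D)))
        \<cdot> (A \<rhd> \<tau> N B P D)"
      by (simp add: \<tau>_\<sigma>)
    also have "\<dots> = \<sigma> A (N \<otimes> P) (B \<otimes> D) \<cdot> (A \<rhd> \<tau> N B P D)"
      by (simp add: \<sigma>_tensor_right[symmetric])
    finally show ?thesis .
  qed
  have "\<alpha> M (N \<otimes> P) ?X \<cdot> ?L
    = (\<alpha> M (N \<otimes> P) ?X \<cdot> (\<alpha> M N P \<otimes>\<^sub>a \<alpha> A B D) \<cdot> \<tau> (M \<otimes> N) (A \<otimes> B) P D) \<cdot> (\<tau> M A N B \<lhd> ?W)"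
    by simp
  also have "\<dots> = (M \<rhd> (\<alpha>' N P ?X \<cdot> (N \<rhd> (?s \<cdot> \<alpha> A B ?W))))
      \<cdot> (\<alpha> M N ((A \<otimes> B) \<otimes> ?W) \<cdot> \<alpha> (M \<otimes> N) (A \<otimes> B) ?W \<cdot> (\<tau> M A N B \<lhd> ?W))"
    unfolding left by simp
  also have "\<dots> = (M \<rhd> (\<alpha>' N P ?X \<cdot> (N \<rhd> ?s) \<cdot> \<sigma> A N (B \<otimes> ?W) \<cdot> (A \<rhd> \<alpha> N B ?W)))
      \<cdot> (M \<rhd> \<alpha> A (N \<otimes> B) ?W) \<cdot> \<alpha> M (A \<otimes> (N \<otimes> B)) ?W \<cdot> (\<alpha> M A (N \<otimes> B) \<lhd> ?W)"
    unfolding right by simp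
  also have "\<dots> = (M \<rhd> \<sigma> A (N \<otimes> P) (B \<otimes> D)) \<cdot> (M \<rhd> (A \<rhd> \<tau> N B P D))
      \<cdot> (\<alpha> M A ((N \<otimes> B) \<otimes> ?W) \<cdot> \<alpha> (M \<otimes> A) (N \<otimes> B) ?W)"
    unfolding middle pentagon[OF assms(1,2) TensorO_closed[OF assms(3,4)] TensorO_closed[OF
        assms(5,6)]] by simp
  also have "\<dots> = (M \<rhd> \<sigma> A (N \<otimes> P) (B \<otimes> D)) \<cdot> ((M \<rhd> (A \<rhd> \<tau> N B P D))
      \<cdot> \<alpha> M A ((N \<otimes> B) \<otimes> ?W)) \<cdot> \<alpha> (M \<otimes> A) (N \<otimes> B) ?W"
    by simp
  also have "(M \<rhd> (A \<rhd> \<tau> N B P D)) \<cdot> \<alpha> M A ((N \<otimes> B) \<otimes> ?W)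
      = \<alpha> M A ((N \<otimes> P) \<otimes> (B \<otimes> D)) \<cdot> ((M \<otimes> A) \<rhd> \<tau> N B P D)"
    using assoc_naturality[of "Id C M" "Id C A" "\<tau> N B P D" M A "(N \<otimes> P) \<otimes> (B \<otimes> D)"] by simp
  also have "(M \<rhd> \<sigma> A (N \<otimes> P) (B \<otimes> D)) \<cdot> (\<alpha> M A ((N \<otimes> P) \<otimes> (B \<otimes> D)) \<cdot> ((M \<otimes> A) \<rhd> \<tau> N B P D))
      \<cdot> \<alpha> (M \<otimes> A) (N \<otimes> B) ?W = \<alpha> M (N \<otimes> P) ?X \<cdot> ?R"
    by (simp add: \<tau>_\<sigma>[of M A "N \<otimes> P" "B \<otimes> D"])
  finally show "\<alpha> M (N \<otimes> P) ?X \<cdot> ?L = \<alpha> M (N \<otimes> P) ?X \<cdot> ?R" .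
qed simp_all

text \<open>The hexagon laws split both compound letters of the outer symmetry. The resulting
  transposition of \<open>M\<close> with \<open>B\<close> cancels the one inside the interchange;
  that of \<open>M\<close> with \<open>N\<close> is \<gamma> on the residuals, conjugated by
  associators.\<close>

lemma \<tau>_sym:
  assumes [simp]: "M \<in> Obj C" "A \<in> Obj C" "N \<in> Obj C" "B \<in> Obj C"
  shows "\<tau> N B M A \<cdot> \<gamma> (M \<otimes> A) (N \<otimes> B) = (\<gamma> M N \<otimes>\<^sub>a \<gamma> A B) \<cdot> \<tau> M A N B"
proof -
  have \<sigma>1: "\<sigma> (M \<otimes> A) N B = (N \<rhd> \<alpha>' M A B) \<cdot> \<sigma> M N (A \<otimes> B) \<cdot> (M \<rhd> \<sigma> A N B) \<cdot> \<alpha> M A (N \<otimes> B)"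
    by (rule iso_cancel_left[of "N \<rhd> \<alpha> M A B"]) (simp_all add: \<sigma>_tensor_left)
  have "\<alpha> N B (M \<otimes> A) \<cdot> \<gamma> (M \<otimes> A) (N \<otimes> B) = (N \<rhd> \<gamma> (M \<otimes> A) B) \<cdot> \<sigma> (M \<otimes> A) N B"
    by (rule sym_tensor_right) simp_all
  also have "\<dots> = (N \<rhd> \<sigma> M B A) \<cdot> ((N \<rhd> (M \<rhd> \<gamma> A B)) \<cdot> \<sigma> M N (A \<otimes> B)) \<cdot> (M \<rhd> \<sigma> A N B)
      \<cdot> \<alpha> M A (N \<otimes> B)"
    unfolding \<sigma>1 sym_tensor_left[OF assms(1,2,4)] by simp
  also have "(N \<rhd> (M \<rhd> \<gamma> A B)) \<cdot> \<sigma> M N (A \<otimes> B) = \<sigma> M N (B \<otimes> A) \<cdot> (M \<rhd> (N \<rhd> \<gamma> A B))"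
    using \<sigma>_naturality[of "Id C M" "Id C N" "\<gamma> A B" M N "B \<otimes> A"] by simp
  finally have *: "\<alpha> N B (M \<otimes> A) \<cdot> \<gamma> (M \<otimes> A) (N \<otimes> B)
    = (N \<rhd> \<sigma> M B A) \<cdot> (\<sigma> M N (B \<otimes> A) \<cdot> (M \<rhd> (N \<rhd> \<gamma> A B))) \<cdot> (M \<rhd> \<sigma> A N B) \<cdot> \<alpha> M A (N \<otimes> B)" .
  have "\<tau> N B M A \<cdot> \<gamma> (M \<otimes> A) (N \<otimes> B)
    = \<alpha>' N M (B \<otimes> A) \<cdot> (N \<rhd> \<sigma> B M A) \<cdot> (\<alpha> N B (M \<otimes> A) \<cdot> \<gamma> (M \<otimes> A) (N \<otimes> B))"
    by (simp add: \<tau>_\<sigma>)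
  also have "\<dots> = \<alpha>' N M (B \<otimes> A) \<cdot> \<sigma> M N (B \<otimes> A) \<cdot> (M \<rhd> (N \<rhd> \<gamma> A B)) \<cdot> (M \<rhd> \<sigma> A N B) \<cdot> \<alpha> M A (N \<otimes> B)"
    unfolding * using inv_arr_simps(4)[of "\<sigma> M B A"] by simp
  also have "\<dots> = (\<gamma> M N \<lhd> (B \<otimes> A)) \<cdot> (\<alpha>' M N (B \<otimes> A) \<cdot> (M \<rhd> (N \<rhd> \<gamma> A B))) \<cdot> (M \<rhd> \<sigma> A N B)
      \<cdot> \<alpha> M A (N \<otimes> B)"
    by (simp add: \<sigma>_def[of M N])
  also have "\<alpha>' M N (B \<otimes> A) \<cdot> (M \<rhd> (N \<rhd> \<gamma> A B)) = ((M \<otimes> N) \<rhd> \<gamma> A B) \<cdot> \<alpha>' M N (A \<otimes> B)"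
    using assoc_inv_naturality[of "Id C M" "Id C N" "\<gamma> A B" M N "B \<otimes> A"] by simp
  finally show ?thesis by (simp add: \<tau>_\<sigma>[of M A])
qed

text \<open>The unit law of \<tau> in its first pair. The unitor on \<open>M\<close> becomes a
  unitor on a longer word, passes \<sigma> by naturality, and then \<open>lunit_\<sigma>\<close>
  absorbs the transposition.\<close>

lemma \<tau>_lunit:
  assumes [simp]: "M \<in> Obj C" "A \<in> Obj C"
  shows "(\<l> M \<otimes>\<^sub>a \<l> A) \<cdot> \<tau> I I M A = \<l> (M \<otimes> A) \<cdot> (\<l> I \<lhd> (M \<otimes> A))"
proof -
  have "(\<l> M \<otimes>\<^sub>a \<l> A) \<cdot> \<tau> I I M A
    = (M \<rhd> \<l> A) \<cdot> ((\<l> M \<lhd> (I \<otimes> A)) \<cdot> \<alpha>' I M (I \<otimes> A)) \<cdot> (I \<rhd> \<sigma> I M A) \<cdot> \<alpha> I I (M \<otimes> A)"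
    by (simp add: \<tau>_\<sigma>)
  also have "\<dots> = (M \<rhd> \<l> A) \<cdot> (\<l> (M \<otimes> (I \<otimes> A)) \<cdot> (I \<rhd> \<sigma> I M A)) \<cdot> \<alpha> I I (M \<otimes> A)"
    unfolding lunit_tensor[OF assms(1) TensorO_closed[OF Unit_closed assms(2)], symmetric] by simp
  also have "\<dots> = ((M \<rhd> \<l> A) \<cdot> \<sigma> I M A) \<cdot> \<l> (I \<otimes> (M \<otimes> A)) \<cdot> \<alpha> I I (M \<otimes> A)"
    using lunit_naturality[of "\<sigma> I M A" "M \<otimes> (I \<otimes> A)"] by simp
  also have "\<dots> = \<l> (M \<otimes> A) \<cdot> (\<l> I \<lhd> (M \<otimes> A))"
    by (simp only: lunit_\<sigma>(2)[OF assms] lunit_tensor[OF Unit_closed TensorO_closed[OF assms]])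
  finally show ?thesis .
qed

text \<open>The companion in which both residuals, the first and the third letter, are the unit. It
  serves to compute the tensor of two optics with trivial residual, where \<open>\<l> I\<close>
  collapses the product of the residuals.\<close>

lemma \<tau>_lunit_residual:
  assumes [simp]: "A \<in> Obj C" "B \<in> Obj C"
  shows "\<l> (A \<otimes> B) \<cdot> (\<l> I \<lhd> (A \<otimes> B)) \<cdot> \<tau> I A I B = \<l> A \<otimes>\<^sub>a \<l> B"
proof -
  have tri: "(\<l> I \<lhd> (A \<otimes> B)) \<cdot> \<alpha>' I I (A \<otimes> B) = \<l> (I \<otimes> (A \<otimes> B))"
    by (simp add: lunit_tensor[symmetric])
  have "\<l> (A \<otimes> B) \<cdot> (\<l> I \<lhd> (A \<otimes> B)) \<cdot> \<tau> I A I B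
    = \<l> (A \<otimes> B) \<cdot> ((\<l> I \<lhd> (A \<otimes> B)) \<cdot> \<alpha>' I I (A \<otimes> B)) \<cdot> (I \<rhd> \<sigma> A I B) \<cdot> \<alpha> I A (I \<otimes> B)"
    by (simp add: \<tau>_\<sigma>)
  also have "\<dots> = \<l> (A \<otimes> B) \<cdot> (I \<rhd> (\<l> (A \<otimes> B) \<cdot> \<sigma> A I B)) \<cdot> \<alpha> I A (I \<otimes> B)"
    unfolding tri by (simp add: lunit_tensor_unit)
  also have "\<dots> = (\<l> (A \<otimes> B) \<cdot> (I \<rhd> (A \<rhd> \<l> B))) \<cdot> \<alpha> I A (I \<otimes> B)"
    by (simp add: lunit_\<sigma>)
  also have "\<dots> = (A \<rhd> \<l> B) \<cdot> (\<l> (A \<otimes> (I \<otimes> B)) \<cdot> \<alpha> I A (I \<otimes> B))"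
    using lunit_naturality[of "A \<rhd> \<l> B" "A \<otimes> B"] by simp
  also have "\<dots> = \<l> A \<otimes>\<^sub>a \<l> B" by (simp add: lunit_tensor)
  finally show ?thesis .
qed

end

section \<open>Optics and their representatives\<close>

lemma mem_optic_reps [simp]:
  "(M, l, r) \<in> optic_reps C (S, S') (A, A')
    \<longleftrightarrow> M \<in> Obj C \<and> l \<in> Hom C S (M \<otimes>\<^bsub>C\<^esub> A) \<and> r \<in> Hom C (M \<otimes>\<^bsub>C\<^esub> A') S'"
  by (simp add: optic_reps_def)

text \<open>Equality is symmetric and transitive, so an invariant of the generating steps is an
  invariant of the equivalence they generate.\<close>

lemma optic_step_invariant:
  assumes "equivclp (optic_step C P Q) x y" "\<And>y z. optic_step C P Q y z \<Longrightarrow> h y = h z"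
  shows "h x = h y"
  using assms(1) by (induction rule: equivclp_induct) (auto dest: assms(2))

lemma optic_class_self: "x \<in> optic_reps C P Q \<Longrightarrow> x \<in> optic_class C P Q x"
  by (auto simp: optic_class_def optic_rel_def)

text \<open>All members of the family are equal, and the index set is nonempty because it contains
  \<open>x\<close>. The union can thus be evaluated at a chosen representative, and well-definedness
  becomes a check on one slide.\<close>

lemma UN_optic_class:
  assumes "x \<in> optic_reps C P Q" "\<And>y z. optic_step C P Q y z \<Longrightarrow> h y = h z"
  shows "(\<Union>y\<in>optic_class C P Q x. h y) = h x"
proof -
  have "h y = h x" if "y \<in> optic_class C P Q x" for y
    using that optic_step_invariant[of C P Q x y h] assms(2) by (auto simp: optic_class_def
        optic_rel_def)
  then show ?thesis using optic_class_self[OF assms(1)] by blast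
qed

text \<open>The inner union is evaluated first, for each representative in the first class. Hence
  invariance in the second argument is required at every first representative, invariance in the
  first only at the given \<open>y\<close>.\<close>

lemma UN_optic_class2:
  assumes "x \<in> optic_reps C P Q" "y \<in> optic_reps C P' Q'"
    "\<And>w z. optic_step C P Q w z \<Longrightarrow> h w y = h z y"
    "\<And>x w z. \<lbrakk>x \<in> optic_reps C P Q; optic_step C P' Q' w z\<rbrakk> \<Longrightarrow> h x w = h x z"
  shows "(\<Union>x\<in>optic_class C P Q x. \<Union>y\<in>optic_class C P' Q' y. h x y) = h x y"
proof -
  have "(\<Union>x\<in>optic_class C P Q x. \<Union>y\<in>optic_class C P' Q' y. h x y) = (\<Union>x\<in>optic_class C P Q x. h x y)"
    by (intro SUP_cong refl UN_optic_class assms(2) assms(4)) (auto simp: optic_class_def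
        optic_rel_def)
  also have "\<dots> = h x y" by (rule UN_optic_class[OF assms(1,3)])
  finally show ?thesis .
qed

section \<open>Arrows of the category of optics\<close>

definition optic_of ::
    "('o, 'm) smc_data \<Rightarrow> 'o \<times> 'o \<Rightarrow> 'o \<times> 'o \<Rightarrow> ('o, 'm) optic_rep \<Rightarrow> ('o, 'm) optic" where
  "optic_of C P Q x = (P, Q, optic_class C P Q x)"

lemma Optic_simps [simp]:
  "Obj (Optic C) = Obj C \<times> Obj C"
  "Unit (Optic C) = (Unit C, Unit C)"
  "(S, S') \<otimes>\<^bsub>Optic C\<^esub> (T, T') = (S \<otimes>\<^bsub>C\<^esub> T, S' \<otimes>\<^bsub>C\<^esub> T')"
  "Dom (Optic C) (optic_of C P Q x) = P"
  "Cod (Optic C) (optic_of C P Q x) = Q"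
  by (simp_all add: Optic_def optic_of_def optic_tensor_obj_def)

lemma equiv_optic_rel: "equiv (optic_reps C P Q) (optic_rel C P Q)"
  by (rule equivI) (auto simp: optic_rel_def refl_on_def sym_def trans_def intro: equivclp_sym
      equivclp_trans)

text \<open>Elements of a quotient are classes of representatives, so every arrow can be presented
  by one. \<open>arr_OpticE\<close> hands it over unpacked into residual and two arrows.\<close>

lemma arr_Optic_iff:
  "u \<in> Arr (Optic C) \<longleftrightarrow> (\<exists>P Q x. P \<in> Obj C \<times> Obj C \<and> Q \<in> Obj C \<times> Obj C
     \<and> x \<in> optic_reps C P Q \<and> u = optic_of C P Q x)"
proof -
  obtain P Q X where u: "u = (P, Q, X)" by (cases u) auto
  have "u \<in> Arr (Optic C) \<longleftrightarrow> P \<in> Obj C \<times> Obj C \<and> Q \<in> Obj C \<times> Obj C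
      \<and> X \<in> optic_reps C P Q // optic_rel C P Q"
    by (simp add: Optic_def u)
  then show ?thesis
    unfolding u optic_of_def optic_class_def quotient_def by blast
qed

lemma arr_OpticE:
  assumes "u \<in> Arr (Optic C)"
  obtains S S' A A' M l r where "u = optic_of C (S, S') (A, A') (M, l, r)"
    "S \<in> Obj C" "S' \<in> Obj C" "A \<in> Obj C" "A' \<in> Obj C" "M \<in> Obj C"
    "l \<in> Arr C" "Dom C l = S" "Cod C l = M \<otimes>\<^bsub>C\<^esub> A"
    "r \<in> Arr C" "Dom C r = M \<otimes>\<^bsub>C\<^esub> A'" "Cod C r = S'"
  using assms unfolding arr_Optic_iff by auto

lemma arr_optic_of [simp]:
  assumes "S \<in> Obj C" "S' \<in> Obj C" "A \<in> Obj C" "A' \<in> Obj C" "M \<in> Obj C"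
    "l \<in> Arr C" "Dom C l = S" "Cod C l = M \<otimes>\<^bsub>C\<^esub> A"
    "r \<in> Arr C" "Dom C r = M \<otimes>\<^bsub>C\<^esub> A'" "Cod C r = S'"
  shows "optic_of C (S, S') (A, A') (M, l, r) \<in> Arr (Optic C)"
  unfolding arr_Optic_iff
  by (intro exI[of _ "(S, S')"] exI[of _ "(A, A')"] exI[of _ "(M, l, r)"]) (use assms in auto)

text \<open>Lets \<open>slide\<close>, an equation between tagged optics, prove equations between
  bare classes.\<close>

lemma optic_class_snd: "optic_class C P Q x = snd (snd (optic_of C P Q x))"
  by (simp add: optic_of_def)

lemma optic_of_eqI:
  assumes "x \<in> optic_reps C P Q" "y \<in> optic_reps C P Q" "optic_step C P Q x y"
  shows "optic_of C P Q x = optic_of C P Q y"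
proof -
  have "(x, y) \<in> optic_rel C P Q" using assms by (auto simp: optic_rel_def)
  then show ?thesis
    unfolding optic_of_def optic_class_def using equiv_class_eq[OF equiv_optic_rel] by simp
qed

section \<open>Sliding, composition and tensor on representatives\<close>

context symmetric_monoidal_category
begin

text \<open>The generating relation with its two composites replaced by variables and side
  equations. Goals in any normal form then match, and what remains is one equation for each half of
  the optic.\<close>

lemma slide:
  assumes [simp]: "A \<in> Obj C" "A' \<in> Obj C" "f \<in> Arr C" "Dom C f = M" "Cod C f = N"
    and [simp]: "l \<in> Arr C" "Dom C l = S" "Cod C l = M \<otimes> A" "r' \<in> Arr C" "Dom C r' = N \<otimes> A'"
        "Cod C r' = S'"
    and "(f \<lhd> A) \<cdot> l = l'" "r' \<cdot> (f \<lhd> A') = r"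
  shows "optic_of C (S, S') (A, A') (M, l, r) = optic_of C (S, S') (A, A') (N, l', r')"
proof -
  have [simp]: "M \<in> Obj C" "N \<in> Obj C" using assms Dom_closed Cod_closed by blast+
  have "optic_step C (S, S') (A, A') (N, (f \<lhd> A) \<cdot> l, r') (M, l, r' \<cdot> (f \<lhd> A'))"
    by (rule optic_step.intros) auto
  then show ?thesis
    unfolding assms(12,13)[symmetric] by (intro optic_of_eqI[symmetric]) auto
qed

lemma optic_step_elim:
  assumes "optic_step C (S, S') (A, A') x y"
  obtains f M N l r where "x = (N, (f \<lhd> A) \<cdot> l, r)" "y = (M, l, r \<cdot> (f \<lhd> A'))"
    "A \<in> Obj C" "A' \<in> Obj C" "f \<in> Arr C" "Dom C f = M" "Cod C f = N" "M \<in> Obj C" "N \<in> Obj C"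
    "l \<in> Arr C" "Dom C l = S" "Cod C l = M \<otimes> A" "r \<in> Arr C" "Dom C r = N \<otimes> A'" "Cod C r = S'"
    "S \<in> Obj C" "S' \<in> Obj C"
  using assms by (cases rule: optic_step.cases) auto

abbreviation opt where "opt S S' A A' M l r \<equiv> optic_of C (S, S') (A, A') (M, l, r)"

text \<open>A change \<open>f\<close> of the first residual slides \<open>f \<lhd> N\<close>, and a
  change of the second slides \<open>M \<rhd> f\<close>. Naturality of the associator carries either
  through the inserted associators.\<close>

lemma comp_optic:
  assumes l': "l' \<in> Arr C" "Dom C l' = R" "Cod C l' = M \<otimes> S" and r': "r' \<in> Arr C" "Dom C r'
      = M \<otimes> S'" "Cod C r' = R'"
    and l: "l \<in> Arr C" "Dom C l = S" "Cod C l = N \<otimes> A" and r: "r \<in> Arr C" "Dom C r = N \<otimes> A'"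
        "Cod C r = S'"
    and [simp]: "M \<in> Obj C" "N \<in> Obj C" "A \<in> Obj C" "A' \<in> Obj C"
  shows "opt S S' A A' N l r \<cdot>\<^bsub>Optic C\<^esub> opt R R' S S' M l' r'
    = opt R R' A A' (M \<otimes> N) (\<alpha>' M N A \<cdot> (M \<rhd> l) \<cdot> l') (r' \<cdot> (M \<rhd> r) \<cdot> \<alpha> M N A')"
proof -
  \<comment> \<open>Projections replace the tuple patterns of \<open>optic_comp\<close>, so that the
    double union has the shape of \<open>UN_optic_class2\<close>.\<close>
  have *: "(\<Union>x\<in>optic_class C (R, R') (S, S') (M, l', r'). \<Union>y\<in>optic_class C (S, S') (A, A') (N, l,
      r).
      optic_class C (R, R') (A, A') (fst x \<otimes> fst y, \<alpha>' (fst x) (fst y) A \<cdot> (fst x \<rhd> fst (snd y))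
          \<cdot> fst (snd x),
        snd (snd x) \<cdot> (fst x \<rhd> snd (snd y)) \<cdot> \<alpha> (fst x) (fst y) A'))
      = optic_class C (R, R') (A, A') (M \<otimes> N, \<alpha>' M N A \<cdot> (M \<rhd> l) \<cdot> l', r' \<cdot> (M \<rhd> r) \<cdot> \<alpha> M N A')"
  proof (subst UN_optic_class2, goal_cases)
    case 1 show ?case using l' r' by auto
  next
    case 2 show ?case using l r by auto
  next
    case (3 w z)
    then obtain f m n l1 r1 where w: "w = (n, (f \<lhd> S) \<cdot> l1, r1)" "z = (m, l1, r1 \<cdot> (f \<lhd> S'))"
      and [simp]: "f \<in> Arr C" "Dom C f = m" "Cod C f = n" "m \<in> Obj C" "n \<in> Obj C"
        "l1 \<in> Arr C" "Dom C l1 = R" "Cod C l1 = m \<otimes> S" "r1 \<in> Arr C" "Dom C r1 = n \<otimes> S'" "Cod C r1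
            = R'"
        "S \<in> Obj C" "S' \<in> Obj C"
      by (elim optic_step_elim) auto
    have e1: "((f \<lhd> N) \<lhd> A) \<cdot> \<alpha>' m N A = \<alpha>' n N A \<cdot> (f \<lhd> (N \<otimes> A))"
      using assoc_inv_naturality[of f "Id C N" "Id C A" n N A] by simp
    have e2: "\<alpha> n N A' \<cdot> ((f \<lhd> N) \<lhd> A') = (f \<lhd> (N \<otimes> A')) \<cdot> \<alpha> m N A'"
      using assoc_naturality[of f "Id C N" "Id C A'" n N A'] by simp
    show ?case
      unfolding w optic_class_snd
      by (rule arg_cong[where f="\<lambda>u. snd (snd u)"], rule slide[of _ _ "f \<lhd> N", symmetric])
        (use l r in \<open>simp_all add: comp_extend2[OF e1] e2\<close>)
  next
    case (4 x w z)
    then obtain f m n l1 r1 where w: "w = (n, (f \<lhd> A) \<cdot> l1, r1)" "z = (m, l1, r1 \<cdot> (f \<lhd> A'))"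
      and [simp]: "f \<in> Arr C" "Dom C f = m" "Cod C f = n" "m \<in> Obj C" "n \<in> Obj C"
        "l1 \<in> Arr C" "Dom C l1 = S" "Cod C l1 = m \<otimes> A" "r1 \<in> Arr C" "Dom C r1 = n \<otimes> A'" "Cod C r1
            = S'"
        "S \<in> Obj C" "S' \<in> Obj C"
      by (elim optic_step_elim) auto
    obtain M1 l2 r2 where x: "x = (M1, l2, r2)" by (cases x)
    with 4 have [simp]: "M1 \<in> Obj C" "l2 \<in> Arr C" "Dom C l2 = R" "Cod C l2 = M1 \<otimes> S" "r2 \<in> Arr C"
        "Dom C r2 = M1 \<otimes> S'" "Cod C r2 = R'"
      by auto
    have e1: "((M1 \<rhd> f) \<lhd> A) \<cdot> \<alpha>' M1 m A = \<alpha>' M1 n A \<cdot> (M1 \<rhd> (f \<lhd> A))"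
      using assoc_inv_naturality[of "Id C M1" f "Id C A" M1 n A] by simp
    have e2: "\<alpha> M1 n A' \<cdot> ((M1 \<rhd> f) \<lhd> A') = (M1 \<rhd> (f \<lhd> A')) \<cdot> \<alpha> M1 m A'"
      using assoc_naturality[of "Id C M1" f "Id C A'" M1 n A'] by simp
    show ?case
      unfolding w x optic_class_snd
      by (rule arg_cong[where f="\<lambda>u. snd (snd u)"], rule slide[of _ _ "M1 \<rhd> f", symmetric])
        (simp_all add: comp_extend2[OF e1] e2)
  qed simp
  then show ?thesis
    by (simp add: Optic_def optic_comp_def optic_of_def split_def)
qed

text \<open>As for composition, with the interchange as the inserted map: its naturality lets the
  change of residual through.\<close>

lemma tensor_optic:
  assumes l: "l \<in> Arr C" "Dom C l = S" "Cod C l = M \<otimes> A" and r: "r \<in> Arr C" "Dom C r = M \<otimes> A'"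
      "Cod C r = S'"
    and l': "l' \<in> Arr C" "Dom C l' = T" "Cod C l' = N \<otimes> B" and r': "r' \<in> Arr C" "Dom C r'
        = N \<otimes> B'" "Cod C r' = T'"
    and [simp]: "M \<in> Obj C" "N \<in> Obj C" "A \<in> Obj C" "A' \<in> Obj C" "B \<in> Obj C" "B' \<in> Obj C"
  shows "opt S S' A A' M l r \<otimes>\<^sub>a\<^bsub>Optic C\<^esub> opt T T' B B' N l' r'
    = opt (S \<otimes> T) (S' \<otimes> T') (A \<otimes> B) (A' \<otimes> B') (M \<otimes> N)
        (\<tau> M A N B \<cdot> (l \<otimes>\<^sub>a l')) ((r \<otimes>\<^sub>a r') \<cdot> \<tau> M N A' B')"
proof -
  have *: "(\<Union>x\<in>optic_class C (S, S') (A, A') (M, l, r). \<Union>y\<in>optic_class C (T, T') (B, B') (N, l',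
      r').
      optic_class C (S \<otimes> T, S' \<otimes> T') (A \<otimes> B, A' \<otimes> B') (fst x \<otimes> fst y,
        \<tau> (fst x) A (fst y) B \<cdot> (fst (snd x) \<otimes>\<^sub>a fst (snd y)),
        (snd (snd x) \<otimes>\<^sub>a snd (snd y)) \<cdot> \<tau> (fst x) (fst y) A' B'))
      = optic_class C (S \<otimes> T, S' \<otimes> T') (A \<otimes> B, A' \<otimes> B') (M \<otimes> N,
        \<tau> M A N B \<cdot> (l \<otimes>\<^sub>a l'), (r \<otimes>\<^sub>a r') \<cdot> \<tau> M N A' B')"
  proof (subst UN_optic_class2, goal_cases)
    case 1 show ?case using l r by auto
  next
    case 2 show ?case using l' r' by auto
  next
    case (3 w z)
    then obtain f m n l1 r1 where w: "w = (n, (f \<lhd> A) \<cdot> l1, r1)" "z = (m, l1, r1 \<cdot> (f \<lhd> A'))"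
      and [simp]: "f \<in> Arr C" "Dom C f = m" "Cod C f = n" "m \<in> Obj C" "n \<in> Obj C"
        "l1 \<in> Arr C" "Dom C l1 = S" "Cod C l1 = m \<otimes> A" "r1 \<in> Arr C" "Dom C r1 = n \<otimes> A'" "Cod C r1
            = S'"
      by (elim optic_step_elim) auto
    have e1: "((f \<lhd> N) \<lhd> (A \<otimes> B)) \<cdot> \<tau> m A N B = \<tau> n A N B \<cdot> ((f \<lhd> A) \<lhd> (N \<otimes> B))"
      using \<tau>_naturality[of f "Id C A" "Id C N" "Id C B" n A N B] by simp
    have e2: "\<tau> n N A' B' \<cdot> ((f \<lhd> N) \<lhd> (A' \<otimes> B')) = ((f \<lhd> A') \<lhd> (N \<otimes> B')) \<cdot> \<tau> m N A' B'"
      using \<tau>_naturality[of f "Id C N" "Id C A'" "Id C B'" n N A' B'] by simp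
    show ?case
      unfolding w optic_class_snd
      by (rule arg_cong[where f="\<lambda>u. snd (snd u)"], rule slide[of _ _ "f \<lhd> N", symmetric])
        (use l' r' in \<open>simp_all add: comp_extend2[OF e1] e2\<close>)
  next
    case (4 x w z)
    then obtain f m n l1 r1 where w: "w = (n, (f \<lhd> B) \<cdot> l1, r1)" "z = (m, l1, r1 \<cdot> (f \<lhd> B'))"
      and [simp]: "f \<in> Arr C" "Dom C f = m" "Cod C f = n" "m \<in> Obj C" "n \<in> Obj C"
        "l1 \<in> Arr C" "Dom C l1 = T" "Cod C l1 = m \<otimes> B" "r1 \<in> Arr C" "Dom C r1 = n \<otimes> B'" "Cod C r1
            = T'"
      by (elim optic_step_elim) auto
    obtain M1 l2 r2 where x: "x = (M1, l2, r2)" by (cases x)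
    with 4 have [simp]: "M1 \<in> Obj C" "l2 \<in> Arr C" "Dom C l2 = S" "Cod C l2 = M1 \<otimes> A" "r2 \<in> Arr C"
        "Dom C r2 = M1 \<otimes> A'" "Cod C r2 = S'"
      by auto
    have e1: "((M1 \<rhd> f) \<lhd> (A \<otimes> B)) \<cdot> \<tau> M1 A m B = \<tau> M1 A n B \<cdot> ((M1 \<otimes> A) \<rhd> (f \<lhd> B))"
      using \<tau>_naturality[of "Id C M1" "Id C A" f "Id C B" M1 A n B] by simp
    have e2: "\<tau> M1 n A' B' \<cdot> ((M1 \<rhd> f) \<lhd> (A' \<otimes> B')) = ((M1 \<otimes> A') \<rhd> (f \<lhd> B')) \<cdot> \<tau> M1 m A' B'"
      using \<tau>_naturality[of "Id C M1" f "Id C A'" "Id C B'" M1 n A' B'] by simp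
    show ?case
      unfolding w x optic_class_snd
      by (rule arg_cong[where f="\<lambda>u. snd (snd u)"], rule slide[of _ _ "M1 \<rhd> f", symmetric])
        (simp_all add: comp_extend2[OF e1] e2)
  qed simp
  then show ?thesis
    by (simp add: Optic_def optic_tensor_def optic_tensor_obj_def optic_of_def split_def Let_def)
qed

section \<open>The symmetric monoidal category of optics\<close>

text \<open>For places where inverse associators occur: the left half of the interchange law and the
  right half of naturality of the associator.\<close>

lemma \<tau>_assoc_inv:
  assumes [simp]: "M \<in> Obj C" "A \<in> Obj C" "N \<in> Obj C" "B \<in> Obj C" "P \<in> Obj C" "D \<in> Obj C"
  shows "(\<tau> M N A B \<lhd> (P \<otimes> D)) \<cdot> \<tau> (M \<otimes> N) P (A \<otimes> B) D \<cdot> (\<alpha>' M N P \<otimes>\<^sub>a \<alpha>' A B D)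
    = \<alpha>' (M \<otimes> A) (N \<otimes> B) (P \<otimes> D) \<cdot> ((M \<otimes> A) \<rhd> \<tau> N P B D) \<cdot> \<tau> M (N \<otimes> P) A (B \<otimes> D)"
  using arg_cong[where f="inv_arr C", OF \<tau>_assoc[OF assms]] by simp

section \<open>The functor \<open>iota\<close> and its compatibility with the tensor\<close>

lemma iota_eq:
  assumes "f \<in> Arr C" "g \<in> Arr C" "Dom C f = S" "Cod C f = A" "Dom C g = A'" "Cod C g = S'"
  shows "iota C f g = opt S S' A A' I (\<l>' A \<cdot> f) (g \<cdot> \<l> A')"
  unfolding iota_def Let_def optic_of_def using assms by simp

lemma iota_simps [simp]:
  assumes "f \<in> Arr C" "g \<in> Arr C"
  shows "iota C f g \<in> Arr (Optic C)" "Dom (Optic C) (iota C f g) = (Dom C f, Cod C g)"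
    "Cod (Optic C) (iota C f g) = (Cod C f, Dom C g)"
  using assms by (auto simp: iota_eq[OF assms refl refl refl refl] intro!: arr_optic_of)

text \<open>The composite has residual \<open>I \<otimes> M\<close>. Sliding along
  \<open>\<l> M\<close> removes the unit, and \<open>lunit_tensor\<close> clears the
  associator.\<close>

lemma comp_iota:
  assumes [simp]: "f \<in> Arr C" "g \<in> Arr C" "Dom C f = R" "Cod C f = S" "Dom C g = S'" "Cod C g = R'"
    and [simp]: "l \<in> Arr C" "Dom C l = S" "Cod C l = M \<otimes> A" "r \<in> Arr C" "Dom C r = M \<otimes> A'"
        "Cod C r = S'"
    and [simp]: "M \<in> Obj C" "A \<in> Obj C" "A' \<in> Obj C"
  shows "opt S S' A A' M l r \<cdot>\<^bsub>Optic C\<^esub> iota C f g = opt R R' A A' M (l \<cdot> f) (g \<cdot> r)"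
proof -
  have [simp]: "R \<in> Obj C" "S \<in> Obj C" "S' \<in> Obj C" "R' \<in> Obj C"
    using assms(1-6) Dom_closed Cod_closed by blast+
  have e1: "(\<l> M \<lhd> A) \<cdot> \<alpha>' I M A = \<l> (M \<otimes> A)"
    by (simp add: lunit_tensor[symmetric])
  have e2: "\<l> (M \<otimes> A) \<cdot> (I \<rhd> l) = l \<cdot> \<l> S" and e3: "\<l> S' \<cdot> (I \<rhd> r) = r \<cdot> \<l> (M \<otimes> A')"
    using lunit_naturality[of l "M \<otimes> A"] lunit_naturality[of r S'] by simp_all
  show ?thesis
    unfolding iota_eq[OF assms(1-6)]
    by (subst comp_optic)
      (simp_all, rule slide[of _ _ "\<l> M"],
       simp_all add: comp_extend[OF e1] comp_extend2[OF e2] comp_extend2[OF e3] lunit_tensor)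
qed

text \<open>Here the residual is \<open>M \<otimes> I\<close>, reduced along \<open>\<r> M\<close>;
  the triangle clears the associator and the unitor together.\<close>

lemma iota_comp_optic:
  assumes [simp]: "f \<in> Arr C" "g \<in> Arr C" "Dom C f = A" "Cod C f = B" "Dom C g = B'" "Cod C g = A'"
    and [simp]: "l \<in> Arr C" "Dom C l = S" "Cod C l = M \<otimes> A" "r \<in> Arr C" "Dom C r = M \<otimes> A'"
        "Cod C r = S'"
    and [simp]: "M \<in> Obj C"
  shows "iota C f g \<cdot>\<^bsub>Optic C\<^esub> opt S S' A A' M l r = opt S S' B B' M ((M \<rhd> f) \<cdot> l) (r \<cdot> (M \<rhd> g))"
proof -
  have [simp]: "A \<in> Obj C" "B \<in> Obj C" "A' \<in> Obj C" "B' \<in> Obj C"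
    using assms(1-6) Dom_closed Cod_closed by blast+
  have e1: "(\<r> M \<lhd> B) \<cdot> \<alpha>' M I B = M \<rhd> \<l> B"
    by (simp add: triangle[symmetric])
  show ?thesis
    unfolding iota_eq[OF assms(1-6)]
    by (subst comp_optic)
      (simp_all, rule slide[of _ _ "\<r> M"], simp_all add: comp_extend[OF e1] triangle[symmetric])
qed

lemma iota_comp_iota:
  assumes "f \<in> Arr C" "g \<in> Arr C" "f' \<in> Arr C" "g' \<in> Arr C" "Dom C f' = Cod C f" "Dom C g
      = Cod C g'"
  shows "iota C f' g' \<cdot>\<^bsub>Optic C\<^esub> iota C f g = iota C (f' \<cdot> f) (g \<cdot> g')"
  using assms
  by (simp add: comp_iota iota_eq[of f' g', OF _ _ refl refl refl refl] iota_eq[of "f' \<cdot> f" "g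
      \<cdot> g'", OF _ _ refl refl refl refl])

text \<open>The product has residual \<open>I \<otimes> I\<close>, collapsed along
  \<open>\<l> I\<close>. The left half is \<open>\<tau>_lunit_residual\<close> solved for the
  inverse unitors, the right half \<open>\<tau>_lunit\<close>.\<close>

lemma iota_tensor_iota:
  assumes [simp]: "f \<in> Arr C" "g \<in> Arr C" "f' \<in> Arr C" "g' \<in> Arr C"
  shows "iota C f g \<otimes>\<^sub>a\<^bsub>Optic C\<^esub> iota C f' g' = iota C (f \<otimes>\<^sub>a f') (g \<otimes>\<^sub>a g')"
proof -
  let ?A = "Cod C f" and ?B = "Cod C f'" and ?A' = "Dom C g" and ?B' = "Dom C g'"
  have e1: "\<l> (?A \<otimes> ?B) \<cdot> (\<l> I \<lhd> (?A \<otimes> ?B)) \<cdot> \<tau> I ?A I ?B = \<l> ?A \<otimes>\<^sub>a \<l> ?B"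
    by (rule \<tau>_lunit_residual) simp_all
  have "\<l>' (?A \<otimes> ?B) \<cdot> (\<l> (?A \<otimes> ?B) \<cdot> (\<l> I \<lhd> (?A \<otimes> ?B)) \<cdot> \<tau> I ?A I ?B) \<cdot> (\<l>' ?A \<otimes>\<^sub>a \<l>' ?B)
    = \<l>' (?A \<otimes> ?B)"
    unfolding e1 by simp
  then have e2: "(\<l> I \<lhd> (?A \<otimes> ?B)) \<cdot> \<tau> I ?A I ?B \<cdot> (\<l>' ?A \<otimes>\<^sub>a \<l>' ?B) = \<l>' (?A \<otimes> ?B)"
    by simp
  have "(\<l> I \<lhd> (?A \<otimes> ?B)) \<cdot> \<tau> I ?A I ?B \<cdot> ((\<l>' ?A \<cdot> f) \<otimes>\<^sub>a (\<l>' ?B \<cdot> f'))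
    = ((\<l> I \<lhd> (?A \<otimes> ?B)) \<cdot> \<tau> I ?A I ?B \<cdot> (\<l>' ?A \<otimes>\<^sub>a \<l>' ?B)) \<cdot> (f \<otimes>\<^sub>a f')"
    by simp
  then have e3: "(\<l> I \<lhd> (?A \<otimes> ?B)) \<cdot> \<tau> I ?A I ?B \<cdot> ((\<l>' ?A \<cdot> f) \<otimes>\<^sub>a (\<l>' ?B \<cdot> f'))
    = \<l>' (?A \<otimes> ?B) \<cdot> (f \<otimes>\<^sub>a f')" unfolding e2 .
  have "((g \<cdot> \<l> ?A') \<otimes>\<^sub>a (g' \<cdot> \<l> ?B')) \<cdot> \<tau> I I ?A' ?B' = (g \<otimes>\<^sub>a g') \<cdot> ((\<l> ?A' \<otimes>\<^sub>a \<l> ?B')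
      \<cdot> \<tau> I I ?A' ?B')"
    by simp
  also have "\<dots> = (g \<otimes>\<^sub>a g') \<cdot> \<l> (?A' \<otimes> ?B') \<cdot> (\<l> I \<lhd> (?A' \<otimes> ?B'))"
    by (subst \<tau>_lunit) simp_all
  finally have e4: "((g \<cdot> \<l> ?A') \<otimes>\<^sub>a (g' \<cdot> \<l> ?B')) \<cdot> \<tau> I I ?A' ?B'
    = (g \<otimes>\<^sub>a g') \<cdot> \<l> (?A' \<otimes> ?B') \<cdot> (\<l> I \<lhd> (?A' \<otimes> ?B'))" .
  show ?thesis
    unfolding iota_eq[OF assms(1,2) refl refl refl refl] iota_eq[OF assms(3,4) refl refl refl refl]
    by (subst tensor_optic, simp_all, subst iota_eq, simp_all, rule slide[of _ _ "\<l> I"])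
      (simp_all add: e3 e4)
qed

section \<open>The category axioms for optics\<close>

lemma Id_Optic: "\<lbrakk>S \<in> Obj C; S' \<in> Obj C\<rbrakk> \<Longrightarrow> Id (Optic C) (S, S') = iota C (Id C S) (Id C S')"
  by (simp add: iota_eq[OF _ _ refl refl refl refl]) (simp add: Optic_def optic_of_def)

text \<open>The residuals are \<open>M \<otimes> (N \<otimes> P)\<close> and
  \<open>(M \<otimes> N) \<otimes> P\<close>, so the slide is along \<open>\<alpha> M N P\<close>.
  Both halves come down to the pentagon, inverted in the left half.\<close>

lemma comp_optic_assoc:
  assumes [simp]: "l1 \<in> Arr C" "Dom C l1 = R" "Cod C l1 = M \<otimes> S" "r1 \<in> Arr C" "Dom C r1 = M \<otimes> S'"
      "Cod C r1 = R'"
    and [simp]: "l2 \<in> Arr C" "Dom C l2 = S" "Cod C l2 = N \<otimes> A" "r2 \<in> Arr C" "Dom C r2 = N \<otimes> A'"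
        "Cod C r2 = S'"
    and [simp]: "l3 \<in> Arr C" "Dom C l3 = A" "Cod C l3 = P \<otimes> B" "r3 \<in> Arr C" "Dom C r3 = P \<otimes> B'"
        "Cod C r3 = A'"
    and [simp]: "M \<in> Obj C" "N \<in> Obj C" "P \<in> Obj C" "B \<in> Obj C" "B' \<in> Obj C"
  shows "(opt A A' B B' P l3 r3 \<cdot>\<^bsub>Optic C\<^esub> opt S S' A A' N l2 r2) \<cdot>\<^bsub>Optic C\<^esub> opt R R' S S' M l1 r1
    = opt A A' B B' P l3 r3 \<cdot>\<^bsub>Optic C\<^esub> (opt S S' A A' N l2 r2 \<cdot>\<^bsub>Optic C\<^esub> opt R R' S S' M l1 r1)"
proof -
  have [simp]: "A \<in> Obj C" "A' \<in> Obj C"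
    using Dom_closed[of l3] Cod_closed[of r3] by simp_all
  have p1: "(\<alpha> M N P \<lhd> B) \<cdot> \<alpha>' (M \<otimes> N) P B \<cdot> \<alpha>' M N (P \<otimes> B) = \<alpha>' M (N \<otimes> P) B \<cdot> (M \<rhd> \<alpha>' N P B)"
  proof -
    have "inv_arr C (\<alpha> M N (P \<otimes> B) \<cdot> \<alpha> (M \<otimes> N) P B \<cdot> (\<alpha>' M N P \<lhd> B))
      = inv_arr C ((M \<rhd> \<alpha> N P B) \<cdot> \<alpha> M (N \<otimes> P) B)"
      by (subst pentagon_shift(2)) simp_all
    then show ?thesis by simp
  qed
  have n1: "((M \<otimes> N) \<rhd> l3) \<cdot> \<alpha>' M N A = \<alpha>' M N (P \<otimes> B) \<cdot> (M \<rhd> (N \<rhd> l3))"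
    using assoc_inv_naturality[of "Id C M" "Id C N" l3 M N "P \<otimes> B"] by simp
  have n2: "\<alpha> M N A' \<cdot> ((M \<otimes> N) \<rhd> r3) = (M \<rhd> (N \<rhd> r3)) \<cdot> \<alpha> M N (P \<otimes> B')"
    using assoc_naturality[of "Id C M" "Id C N" r3 M N A'] by simp
  have p2: "(M \<rhd> \<alpha> N P B') \<cdot> \<alpha> M (N \<otimes> P) B' \<cdot> (\<alpha> M N P \<lhd> B') = \<alpha> M N (P \<otimes> B') \<cdot> \<alpha> (M \<otimes> N) P B'"
    using pentagon[of M N P B'] by simp
  have L: "(\<alpha> M N P \<lhd> B) \<cdot> \<alpha>' (M \<otimes> N) P B \<cdot> ((M \<otimes> N) \<rhd> l3) \<cdot> \<alpha>' M N A \<cdot> (M \<rhd> l2) \<cdot> l1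
    = \<alpha>' M (N \<otimes> P) B \<cdot> (M \<rhd> (\<alpha>' N P B \<cdot> (N \<rhd> l3) \<cdot> l2)) \<cdot> l1"
  proof -
    have "(\<alpha> M N P \<lhd> B) \<cdot> \<alpha>' (M \<otimes> N) P B \<cdot> ((M \<otimes> N) \<rhd> l3) \<cdot> \<alpha>' M N A \<cdot> (M \<rhd> l2) \<cdot> l1
      = ((\<alpha> M N P \<lhd> B) \<cdot> \<alpha>' (M \<otimes> N) P B \<cdot> \<alpha>' M N (P \<otimes> B)) \<cdot> (M \<rhd> (N \<rhd> l3)) \<cdot> (M \<rhd> l2) \<cdot> l1"
      by (simp add: comp_extend2[OF n1])
    then show ?thesis unfolding p1 by simp
  qed
  have R: "r1 \<cdot> (M \<rhd> (r2 \<cdot> (N \<rhd> r3) \<cdot> \<alpha> N P B')) \<cdot> \<alpha> M (N \<otimes> P) B' \<cdot> (\<alpha> M N P \<lhd> B')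
    = r1 \<cdot> (M \<rhd> r2) \<cdot> \<alpha> M N A' \<cdot> ((M \<otimes> N) \<rhd> r3) \<cdot> \<alpha> (M \<otimes> N) P B'"
  proof -
    have "r1 \<cdot> (M \<rhd> (r2 \<cdot> (N \<rhd> r3) \<cdot> \<alpha> N P B')) \<cdot> \<alpha> M (N \<otimes> P) B' \<cdot> (\<alpha> M N P \<lhd> B')
      = r1 \<cdot> (M \<rhd> (r2 \<cdot> (N \<rhd> r3))) \<cdot> ((M \<rhd> \<alpha> N P B') \<cdot> \<alpha> M (N \<otimes> P) B' \<cdot> (\<alpha> M N P \<lhd> B'))"
      by simp
    then show ?thesis unfolding p2 by (simp add: comp_extend2[OF n2])
  qed
  show ?thesis
    by (simp add: comp_optic, rule slide[of _ _ "\<alpha> M N P", symmetric]) (simp_all add: L R)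
qed

lemma comp_in_Optic:
  assumes "u \<in> Arr (Optic C)" "v \<in> Arr (Optic C)" "Dom (Optic C) v = Cod (Optic C) u"
  shows "v \<cdot>\<^bsub>Optic C\<^esub> u \<in> Arr (Optic C)" "Dom (Optic C) (v \<cdot>\<^bsub>Optic C\<^esub> u) = Dom (Optic C) u"
    "Cod (Optic C) (v \<cdot>\<^bsub>Optic C\<^esub> u) = Cod (Optic C) v"
  using assms by (auto elim!: arr_OpticE simp: comp_optic intro!: arr_optic_of)

lemma category_Optic: "category (Optic C)"
proof
  fix u v w P Q R E
  show "Dom (Optic C) u \<in> Obj (Optic C)" "Cod (Optic C) u \<in> Obj (Optic C)" if "u \<in> Arr (Optic C)"
    using that by (auto elim!: arr_OpticE)
  show "Id (Optic C) P \<in> Hom (Optic C) P P" if "P \<in> Obj (Optic C)"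
    using that by (auto simp: Id_Optic)
  show "v \<cdot>\<^bsub>Optic C\<^esub> u \<in> Hom (Optic C) P R" if "u \<in> Hom (Optic C) P Q" "v \<in> Hom (Optic C) Q R"
    using that comp_in_Optic by auto
  \<comment> \<open>An identity optic is \<open>iota\<close> of identities, so the unit laws are
    instances of \<open>comp_iota\<close> and \<open>iota_comp_optic\<close>.\<close>
  show "u \<cdot>\<^bsub>Optic C\<^esub> Id (Optic C) P = u" if "u \<in> Hom (Optic C) P Q"
    using that by (auto elim!: arr_OpticE simp: Id_Optic comp_iota)
  show "Id (Optic C) Q \<cdot>\<^bsub>Optic C\<^esub> u = u" if "u \<in> Hom (Optic C) P Q"
    using that by (auto elim!: arr_OpticE simp: Id_Optic iota_comp_optic)
  show "(w \<cdot>\<^bsub>Optic C\<^esub> v) \<cdot>\<^bsub>Optic C\<^esub> u = w \<cdot>\<^bsub>Optic C\<^esub> v \<cdot>\<^bsub>Optic C\<^esub> u"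
    if "u \<in> Hom (Optic C) P Q" "v \<in> Hom (Optic C) Q R" "w \<in> Hom (Optic C) R E"
    using that by (auto elim!: arr_OpticE simp: comp_optic_assoc)
qed

interpretation Opt: category "Optic C" by (rule category_Optic)

section \<open>Functoriality of the tensor of optics\<close>

lemma tensor_in_Optic:
  assumes "u \<in> Arr (Optic C)" "v \<in> Arr (Optic C)"
  shows "u \<otimes>\<^sub>a\<^bsub>Optic C\<^esub> v \<in> Arr (Optic C)"
    "Dom (Optic C) (u \<otimes>\<^sub>a\<^bsub>Optic C\<^esub> v) = Dom (Optic C) u \<otimes>\<^bsub>Optic C\<^esub> Dom (Optic C) v"
    "Cod (Optic C) (u \<otimes>\<^sub>a\<^bsub>Optic C\<^esub> v) = Cod (Optic C) u \<otimes>\<^bsub>Optic C\<^esub> Cod (Optic C) v"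
  using assms by (auto elim!: arr_OpticE simp: tensor_optic intro!: arr_optic_of)

text \<open>The residuals \<open>(M \<otimes> N) \<otimes> (P \<otimes> Q)\<close> and
  \<open>(M \<otimes> P) \<otimes> (N \<otimes> Q)\<close> are compared along their
  interchange.\<close>

lemma tensor_comp_optic:
  assumes [simp]: "l1 \<in> Arr C" "Dom C l1 = R" "Cod C l1 = M \<otimes> S" "r1 \<in> Arr C" "Dom C r1 = M \<otimes> S'"
      "Cod C r1 = R'"
    and [simp]: "l2 \<in> Arr C" "Dom C l2 = S" "Cod C l2 = N \<otimes> A" "r2 \<in> Arr C" "Dom C r2 = N \<otimes> A'"
        "Cod C r2 = S'"
    and [simp]: "k1 \<in> Arr C" "Dom C k1 = U" "Cod C k1 = P \<otimes> V" "t1 \<in> Arr C" "Dom C t1 = P \<otimes> V'"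
        "Cod C t1 = U'"
    and [simp]: "k2 \<in> Arr C" "Dom C k2 = V" "Cod C k2 = Q \<otimes> B" "t2 \<in> Arr C" "Dom C t2 = Q \<otimes> B'"
        "Cod C t2 = V'"
    and [simp]: "M \<in> Obj C" "N \<in> Obj C" "P \<in> Obj C" "Q \<in> Obj C" "A \<in> Obj C" "A' \<in> Obj C"
        "B \<in> Obj C" "B' \<in> Obj C"
  shows "(opt S S' A A' N l2 r2 \<cdot>\<^bsub>Optic C\<^esub> opt R R' S S' M l1 r1)
      \<otimes>\<^sub>a\<^bsub>Optic C\<^esub> (opt V V' B B' Q k2 t2 \<cdot>\<^bsub>Optic C\<^esub> opt U U' V V' P k1 t1)
    = (opt S S' A A' N l2 r2 \<otimes>\<^sub>a\<^bsub>Optic C\<^esub> opt V V' B B' Q k2 t2)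
      \<cdot>\<^bsub>Optic C\<^esub> (opt R R' S S' M l1 r1 \<otimes>\<^sub>a\<^bsub>Optic C\<^esub> opt U U' V V' P k1 t1)"
proof -
  have [simp]: "S \<in> Obj C" "S' \<in> Obj C" "V \<in> Obj C" "V' \<in> Obj C"
    using Dom_closed[of l2] Cod_closed[of r2] Dom_closed[of k2] Cod_closed[of t2] by simp_all
  have n1: "\<tau> M (N \<otimes> A) P (Q \<otimes> B) \<cdot> ((M \<rhd> l2) \<otimes>\<^sub>a (P \<rhd> k2)) = ((M \<otimes> P) \<rhd> (l2 \<otimes>\<^sub>a k2)) \<cdot> \<tau> M S P V"
    using \<tau>_naturality[of "Id C M" l2 "Id C P" k2 M "N \<otimes> A" P "Q \<otimes> B"] by simp
  \<comment> \<open>\<open>\<tau>_assoc_inv\<close> reorganises the inverse associators; naturality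
    of \<tau> then brings \<open>l2\<close> and \<open>k2\<close> to the other side of the
    interchange for the first pair of optics.\<close>
  have L: "(\<tau> M N P Q \<lhd> (A \<otimes> B)) \<cdot> \<tau> (M \<otimes> N) A (P \<otimes> Q) B
      \<cdot> ((\<alpha>' M N A \<cdot> (M \<rhd> l2) \<cdot> l1) \<otimes>\<^sub>a (\<alpha>' P Q B \<cdot> (P \<rhd> k2) \<cdot> k1))
    = \<alpha>' (M \<otimes> P) (N \<otimes> Q) (A \<otimes> B) \<cdot> ((M \<otimes> P) \<rhd> (\<tau> N A Q B \<cdot> (l2 \<otimes>\<^sub>a k2))) \<cdot> \<tau> M S P V \<cdot> (l1 \<otimes>\<^sub>a k1)"
  proof -
    have "(\<tau> M N P Q \<lhd> (A \<otimes> B)) \<cdot> \<tau> (M \<otimes> N) A (P \<otimes> Q) B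
      \<cdot> ((\<alpha>' M N A \<cdot> (M \<rhd> l2) \<cdot> l1) \<otimes>\<^sub>a (\<alpha>' P Q B \<cdot> (P \<rhd> k2) \<cdot> k1))
      = ((\<tau> M N P Q \<lhd> (A \<otimes> B)) \<cdot> \<tau> (M \<otimes> N) A (P \<otimes> Q) B \<cdot> (\<alpha>' M N A \<otimes>\<^sub>a \<alpha>' P Q B))
        \<cdot> ((M \<rhd> l2) \<otimes>\<^sub>a (P \<rhd> k2)) \<cdot> (l1 \<otimes>\<^sub>a k1)"
      by simp
    also have "\<dots> = \<alpha>' (M \<otimes> P) (N \<otimes> Q) (A \<otimes> B) \<cdot> ((M \<otimes> P) \<rhd> \<tau> N A Q B)
        \<cdot> (\<tau> M (N \<otimes> A) P (Q \<otimes> B) \<cdot> ((M \<rhd> l2) \<otimes>\<^sub>a (P \<rhd> k2))) \<cdot> (l1 \<otimes>\<^sub>a k1)"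
      by (subst \<tau>_assoc_inv) simp_all
    also have "\<dots> = \<alpha>' (M \<otimes> P) (N \<otimes> Q) (A \<otimes> B) \<cdot> ((M \<otimes> P) \<rhd> (\<tau> N A Q B \<cdot> (l2 \<otimes>\<^sub>a k2))) \<cdot> \<tau> M S P V
        \<cdot> (l1 \<otimes>\<^sub>a k1)"
      unfolding n1 by simp
    finally show ?thesis .
  qed
  have n2: "\<tau> M P S' V' \<cdot> ((M \<otimes> P) \<rhd> (r2 \<otimes>\<^sub>a t2)) = ((M \<rhd> r2) \<otimes>\<^sub>a (P \<rhd> t2))
      \<cdot> \<tau> M P (N \<otimes> A') (Q \<otimes> B')"
    using \<tau>_naturality[of "Id C M" "Id C P" r2 t2 M P S' V'] by simp
  \<comment> \<open>\<open>\<tau>_assoc\<close> read in the letters \<open>M\<close>,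
    \<open>P\<close>, \<open>N\<close>, \<open>Q\<close>, \<open>A'\<close>, \<open>B'\<close>. It
    leaves an interchange of residuals, which the interchange contributed by the slide
    undoes.\<close>
  have H: "\<tau> M P (N \<otimes> A') (Q \<otimes> B') \<cdot> ((M \<otimes> P) \<rhd> \<tau> N Q A' B') \<cdot> \<alpha> (M \<otimes> P) (N \<otimes> Q) (A' \<otimes> B')
      \<cdot> (\<tau> M N P Q \<lhd> (A' \<otimes> B'))
    = (\<alpha> M N A' \<otimes>\<^sub>a \<alpha> P Q B') \<cdot> \<tau> (M \<otimes> N) (P \<otimes> Q) A' B'"
  proof -
    have "\<tau> M P (N \<otimes> A') (Q \<otimes> B') \<cdot> ((M \<otimes> P) \<rhd> \<tau> N Q A' B') \<cdot> \<alpha> (M \<otimes> P) (N \<otimes> Q) (A' \<otimes> B')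
        \<cdot> (\<tau> M N P Q \<lhd> (A' \<otimes> B'))
      = (\<tau> M P (N \<otimes> A') (Q \<otimes> B') \<cdot> ((M \<otimes> P) \<rhd> \<tau> N Q A' B') \<cdot> \<alpha> (M \<otimes> P) (N \<otimes> Q) (A' \<otimes> B'))
          \<cdot> (\<tau> M N P Q \<lhd> (A' \<otimes> B'))"
      by simp
    also have "\<dots> = (\<alpha> M N A' \<otimes>\<^sub>a \<alpha> P Q B') \<cdot> \<tau> (M \<otimes> N) (P \<otimes> Q) A' B' \<cdot> ((\<tau> M P N Q
        \<cdot> \<tau> M N P Q) \<lhd> (A' \<otimes> B'))"
      by (subst \<tau>_assoc[symmetric]) simp_all
    also have "\<tau> M P N Q \<cdot> \<tau> M N P Q = Id C ((M \<otimes> N) \<otimes> (P \<otimes> Q))"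
      using inv_arr_simps(4)[of "\<tau> M N P Q"] by simp
    finally show ?thesis by simp
  qed
  have R: "(r1 \<otimes>\<^sub>a t1) \<cdot> \<tau> M P S' V' \<cdot> ((M \<otimes> P) \<rhd> ((r2 \<otimes>\<^sub>a t2) \<cdot> \<tau> N Q A' B'))
      \<cdot> \<alpha> (M \<otimes> P) (N \<otimes> Q) (A' \<otimes> B') \<cdot> (\<tau> M N P Q \<lhd> (A' \<otimes> B'))
    = ((r1 \<cdot> (M \<rhd> r2) \<cdot> \<alpha> M N A') \<otimes>\<^sub>a (t1 \<cdot> (P \<rhd> t2) \<cdot> \<alpha> P Q B')) \<cdot> \<tau> (M \<otimes> N) (P \<otimes> Q) A' B'"
  proof -
    have "(r1 \<otimes>\<^sub>a t1) \<cdot> \<tau> M P S' V' \<cdot> ((M \<otimes> P) \<rhd> ((r2 \<otimes>\<^sub>a t2) \<cdot> \<tau> N Q A' B'))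
        \<cdot> \<alpha> (M \<otimes> P) (N \<otimes> Q) (A' \<otimes> B') \<cdot> (\<tau> M N P Q \<lhd> (A' \<otimes> B'))
      = (r1 \<otimes>\<^sub>a t1) \<cdot> (\<tau> M P S' V' \<cdot> ((M \<otimes> P) \<rhd> (r2 \<otimes>\<^sub>a t2))) \<cdot> ((M \<otimes> P) \<rhd> \<tau> N Q A' B')
          \<cdot> \<alpha> (M \<otimes> P) (N \<otimes> Q) (A' \<otimes> B') \<cdot> (\<tau> M N P Q \<lhd> (A' \<otimes> B'))"
      by simp
    also have "\<dots> = (r1 \<otimes>\<^sub>a t1) \<cdot> ((M \<rhd> r2) \<otimes>\<^sub>a (P \<rhd> t2)) \<cdot> (\<tau> M P (N \<otimes> A') (Q \<otimes> B')
        \<cdot> ((M \<otimes> P) \<rhd> \<tau> N Q A' B') \<cdot> \<alpha> (M \<otimes> P) (N \<otimes> Q) (A' \<otimes> B') \<cdot> (\<tau> M N P Q \<lhd> (A' \<otimes> B')))"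
      unfolding n2 by simp
    finally show ?thesis unfolding H by simp
  qed
  show ?thesis
    by (simp add: comp_optic tensor_optic, rule slide[of _ _ "\<tau> M N P Q"])
      (simp_all add: L R)
qed

text \<open>\<^const>\<open>iota\<close> is contravariant in its second argument. Inverting that argument makes both
  components covariant, so that coherence can be checked componentwise.\<close>

definition iso_optic where "iso_optic f g = iota C f (inv_arr C g)"

lemma iso_optic_simps [simp]:
  assumes "f \<in> Arr C" "is_iso C g"
  shows "iso_optic f g \<in> Arr (Optic C)" "Dom (Optic C) (iso_optic f g) = (Dom C f, Dom C g)"
    "Cod (Optic C) (iso_optic f g) = (Cod C f, Cod C g)"
  using assms by (simp_all add: iso_optic_def)

lemma iso_optic_comp [simp]:
  assumes "f \<in> Arr C" "f' \<in> Arr C" "Dom C f' = Cod C f" "is_iso C g" "is_iso C g'" "Dom C g'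
      = Cod C g"
  shows "iso_optic f' g' \<cdot>\<^bsub>Optic C\<^esub> iso_optic f g = iso_optic (f' \<cdot> f) (g' \<cdot> g)"
  using assms by (simp add: iso_optic_def iota_comp_iota)

lemma iso_optic_tensor [simp]:
  assumes "f \<in> Arr C" "f' \<in> Arr C" "is_iso C g" "is_iso C g'"
  shows "iso_optic f g \<otimes>\<^sub>a\<^bsub>Optic C\<^esub> iso_optic f' g' = iso_optic (f \<otimes>\<^sub>a f') (g \<otimes>\<^sub>a g')"
  using assms by (simp add: iso_optic_def iota_tensor_iota)

lemma Id_Optic_iso:
  assumes "S \<in> Obj C" "S' \<in> Obj C"
  shows "Id (Optic C) (S, S') = iso_optic (Id C S) (Id C S')"
  using assms by (simp add: iso_optic_def Id_Optic)

text \<open>Inverses are taken componentwise, which settles the invertibility of all structure maps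
  of \<open>Optic C\<close>.\<close>

lemma is_iso_iso_optic [simp]:
  assumes "is_iso C f" "is_iso C g"
  shows "is_iso (Optic C) (iso_optic f g)" "inv_arr (Optic C) (iso_optic f g)
      = iso_optic (inv_arr C f) (inv_arr C g)"
proof -
  have [simp]: "f \<in> Arr C" "g \<in> Arr C" using assms is_iso_arr by auto
  have "inverse_arrows (Optic C) (iso_optic f g) (iso_optic (inv_arr C f) (inv_arr C g))"
    using assms by (intro Opt.inverse_arrowsI) (simp_all add: Id_Optic_iso)
  then show "is_iso (Optic C) (iso_optic f g)" "inv_arr (Optic C) (iso_optic f g)
      = iso_optic (inv_arr C f) (inv_arr C g)"
    using Opt.inverse_arrows_is_iso Opt.inv_arr_eqI by auto
qed

section \<open>Structure maps of \<open>Optic C\<close> and their naturality\<close>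

lemma structure_Optic:
  "Assoc (Optic C) (R, R') (S, S') (T, T') = iso_optic (\<alpha> R S T) (\<alpha> R' S' T')"
  "LUnit (Optic C) (S, S') = iso_optic (\<l> S) (\<l> S')"
  "RUnit (Optic C) (S, S') = iso_optic (\<r> S) (\<r> S')"
  "\<lbrakk>S' \<in> Obj C; T' \<in> Obj C\<rbrakk> \<Longrightarrow> Sym (Optic C) (S, S') (T, T') = iso_optic (\<gamma> S T) (\<gamma> S' T')"
  \<comment> \<open>The symmetry of optics is defined with \<open>\<gamma> T' S'\<close> in place of
    an inverse; on objects the two agree by \<open>iso_Sym\<close>.\<close>
  by (simp_all add: Optic_def iso_optic_def)

text \<open>The slide is along \<open>\<alpha> M N P\<close>. The left half is
  \<open>\<tau>_assoc\<close> with naturality of the associator, the right half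
  \<open>\<tau>_assoc_inv\<close> with naturality of its inverse.\<close>

lemma assoc_optic_natural:
  assumes [simp]: "l \<in> Arr C" "Dom C l = R" "Cod C l = M \<otimes> A" "r \<in> Arr C" "Dom C r = M \<otimes> A'"
      "Cod C r = R'"
    and [simp]: "l' \<in> Arr C" "Dom C l' = S" "Cod C l' = N \<otimes> B" "r' \<in> Arr C" "Dom C r' = N \<otimes> B'"
        "Cod C r' = S'"
    and [simp]: "l'' \<in> Arr C" "Dom C l'' = T" "Cod C l'' = P \<otimes> D" "r'' \<in> Arr C" "Dom C r''
        = P \<otimes> D'" "Cod C r'' = T'"
    and [simp]: "M \<in> Obj C" "N \<in> Obj C" "P \<in> Obj C" "A \<in> Obj C" "A' \<in> Obj C" "B \<in> Obj C"
        "B' \<in> Obj C" "D \<in> Obj C" "D' \<in> Obj C"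
  shows "iso_optic (\<alpha> A B D) (\<alpha> A' B' D') \<cdot>\<^bsub>Optic C\<^esub>
      ((opt R R' A A' M l r \<otimes>\<^sub>a\<^bsub>Optic C\<^esub> opt S S' B B' N l' r') \<otimes>\<^sub>a\<^bsub>Optic C\<^esub> opt T T' D D' P l''
          r'')
    = (opt R R' A A' M l r \<otimes>\<^sub>a\<^bsub>Optic C\<^esub> (opt S S' B B' N l' r' \<otimes>\<^sub>a\<^bsub>Optic C\<^esub> opt T T' D D' P l''
        r''))
      \<cdot>\<^bsub>Optic C\<^esub> iso_optic (\<alpha> R S T) (\<alpha> R' S' T')"
proof -
  have [simp]: "R \<in> Obj C" "R' \<in> Obj C" "S \<in> Obj C" "S' \<in> Obj C" "T \<in> Obj C" "T' \<in> Obj C"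
    using Dom_closed[of l] Cod_closed[of r] Dom_closed[of l'] Cod_closed[of r'] Dom_closed[of l'']
        Cod_closed[of r''] by simp_all
  have L: "(\<alpha> M N P \<otimes>\<^sub>a \<alpha> A B D) \<cdot> \<tau> (M \<otimes> N) (A \<otimes> B) P D \<cdot> ((\<tau> M A N B \<cdot> (l \<otimes>\<^sub>a l')) \<otimes>\<^sub>a l'')
    = \<tau> M A (N \<otimes> P) (B \<otimes> D) \<cdot> (l \<otimes>\<^sub>a (\<tau> N B P D \<cdot> (l' \<otimes>\<^sub>a l''))) \<cdot> \<alpha> R S T"
  proof -
    have "(\<alpha> M N P \<otimes>\<^sub>a \<alpha> A B D) \<cdot> \<tau> (M \<otimes> N) (A \<otimes> B) P D \<cdot> ((\<tau> M A N B \<cdot> (l \<otimes>\<^sub>a l')) \<otimes>\<^sub>a l'')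
      = ((\<alpha> M N P \<otimes>\<^sub>a \<alpha> A B D) \<cdot> \<tau> (M \<otimes> N) (A \<otimes> B) P D \<cdot> (\<tau> M A N B \<lhd> (P \<otimes> D)))
          \<cdot> ((l \<otimes>\<^sub>a l') \<otimes>\<^sub>a l'')"
      by simp
    also have "\<dots> = \<tau> M A (N \<otimes> P) (B \<otimes> D) \<cdot> ((M \<otimes> A) \<rhd> \<tau> N B P D) \<cdot> (\<alpha> (M \<otimes> A) (N \<otimes> B) (P \<otimes> D)
        \<cdot> ((l \<otimes>\<^sub>a l') \<otimes>\<^sub>a l''))"
      by (subst \<tau>_assoc) simp_all
    also have "\<alpha> (M \<otimes> A) (N \<otimes> B) (P \<otimes> D) \<cdot> ((l \<otimes>\<^sub>a l') \<otimes>\<^sub>a l'') = (l \<otimes>\<^sub>a (l' \<otimes>\<^sub>a l'')) \<cdot> \<alpha> R S T"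
      by (simp add: assoc_naturality)
    finally show ?thesis by simp
  qed
  have R: "((((r \<otimes>\<^sub>a r') \<cdot> \<tau> M N A' B') \<otimes>\<^sub>a r'') \<cdot> \<tau> (M \<otimes> N) P (A' \<otimes> B') D')
      \<cdot> (((M \<otimes> N) \<otimes> P) \<rhd> \<alpha>' A' B' D')
    = \<alpha>' R' S' T' \<cdot> (r \<otimes>\<^sub>a ((r' \<otimes>\<^sub>a r'') \<cdot> \<tau> N P B' D')) \<cdot> \<tau> M (N \<otimes> P) A' (B' \<otimes> D')
        \<cdot> (\<alpha> M N P \<lhd> (A' \<otimes> (B' \<otimes> D')))"
  proof -
    \<comment> \<open>The identity on the residuals is written as \<open>\<alpha> M N P\<close>
      followed by its inverse, which completes the left side of
      \<open>\<tau>_assoc_inv\<close>.\<close>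
    have "((((r \<otimes>\<^sub>a r') \<cdot> \<tau> M N A' B') \<otimes>\<^sub>a r'') \<cdot> \<tau> (M \<otimes> N) P (A' \<otimes> B') D')
        \<cdot> (((M \<otimes> N) \<otimes> P) \<rhd> \<alpha>' A' B' D')
      = ((r \<otimes>\<^sub>a r') \<otimes>\<^sub>a r'') \<cdot> ((\<tau> M N A' B' \<lhd> (P \<otimes> D')) \<cdot> \<tau> (M \<otimes> N) P (A' \<otimes> B') D'
          \<cdot> (\<alpha>' M N P \<otimes>\<^sub>a \<alpha>' A' B' D'))
        \<cdot> (\<alpha> M N P \<lhd> (A' \<otimes> (B' \<otimes> D')))"
      by simp
    also have "\<dots> = (((r \<otimes>\<^sub>a r') \<otimes>\<^sub>a r'') \<cdot> \<alpha>' (M \<otimes> A') (N \<otimes> B') (P \<otimes> D')) \<cdot> ((M \<otimes> A') \<rhd> \<tau> N P B' D')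
        \<cdot> \<tau> M (N \<otimes> P) A' (B' \<otimes> D') \<cdot> (\<alpha> M N P \<lhd> (A' \<otimes> (B' \<otimes> D')))"
      by (subst \<tau>_assoc_inv) simp_all
    also have "((r \<otimes>\<^sub>a r') \<otimes>\<^sub>a r'') \<cdot> \<alpha>' (M \<otimes> A') (N \<otimes> B') (P \<otimes> D') = \<alpha>' R' S' T'
        \<cdot> (r \<otimes>\<^sub>a (r' \<otimes>\<^sub>a r''))"
      by (simp add: assoc_inv_naturality)
    finally show ?thesis by simp
  qed
  show ?thesis unfolding iso_optic_def
    by (simp add: tensor_optic iota_comp_optic comp_iota, rule slide[of _ _ "\<alpha> M N P"])
      (use L R in simp_all)
qed

text \<open>The tensor with the identity of the unit has residual \<open>I \<otimes> M\<close>, so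
  the slide is along \<open>\<l> M\<close>. \<open>\<tau>_lunit\<close> settles the left half, its
  inverse the right.\<close>

lemma lunit_optic_natural:
  assumes [simp]: "l \<in> Arr C" "Dom C l = S" "Cod C l = M \<otimes> A" "r \<in> Arr C" "Dom C r = M \<otimes> A'"
      "Cod C r = S'"
    and [simp]: "M \<in> Obj C" "A \<in> Obj C" "A' \<in> Obj C"
  shows "iso_optic (\<l> A) (\<l> A')
      \<cdot>\<^bsub>Optic C\<^esub> (iso_optic (Id C I) (Id C I) \<otimes>\<^sub>a\<^bsub>Optic C\<^esub> opt S S' A A' M l r)
    = opt S S' A A' M l r \<cdot>\<^bsub>Optic C\<^esub> iso_optic (\<l> S) (\<l> S')"
proof -
  have [simp]: "S \<in> Obj C" "S' \<in> Obj C" using Dom_closed[of l] Cod_closed[of r] by simp_all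
  have i: "iso_optic (Id C I) (Id C I) = opt I I I I I (\<l>' I) (\<l> I)"
    by (simp add: iso_optic_def iota_eq[OF _ _ refl refl refl refl])
  have L: "(\<l> M \<otimes>\<^sub>a \<l> A) \<cdot> \<tau> I I M A \<cdot> (\<l>' I \<otimes>\<^sub>a l) = l \<cdot> \<l> S"
  proof -
    have "(\<l> M \<otimes>\<^sub>a \<l> A) \<cdot> \<tau> I I M A \<cdot> (\<l>' I \<otimes>\<^sub>a l) = ((\<l> M \<otimes>\<^sub>a \<l> A) \<cdot> \<tau> I I M A)
        \<cdot> (\<l>' I \<otimes>\<^sub>a l)" by simp
    also have "\<dots> = \<l> (M \<otimes> A) \<cdot> (I \<rhd> l)" by (subst \<tau>_lunit) simp_all
    finally show ?thesis by (simp add: lunit_naturality)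
  qed
  have R: "(\<l> I \<otimes>\<^sub>a r) \<cdot> \<tau> I M I A' \<cdot> ((I \<otimes> M) \<rhd> \<l>' A') = \<l>' S' \<cdot> r \<cdot> (\<l> M \<lhd> A')"
  proof -
    have *: "\<tau> I M I A' \<cdot> (\<l>' M \<otimes>\<^sub>a \<l>' A') = (\<l>' I \<lhd> (M \<otimes> A')) \<cdot> \<l>' (M \<otimes> A')"
      using arg_cong[where f="inv_arr C", OF \<tau>_lunit[of M A']] by simp
    have "(\<l> I \<otimes>\<^sub>a r) \<cdot> \<tau> I M I A' \<cdot> ((I \<otimes> M) \<rhd> \<l>' A')
      = (\<l> I \<otimes>\<^sub>a r) \<cdot> (\<tau> I M I A' \<cdot> (\<l>' M \<otimes>\<^sub>a \<l>' A')) \<cdot> (\<l> M \<lhd> A')" by simp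
    also have "\<dots> = ((I \<rhd> r) \<cdot> \<l>' (M \<otimes> A')) \<cdot> (\<l> M \<lhd> A')"
      unfolding * by simp
    also have "(I \<rhd> r) \<cdot> \<l>' (M \<otimes> A') = \<l>' S' \<cdot> r" by (simp add: lunit_inv_naturality)
    finally show ?thesis by simp
  qed
  show ?thesis unfolding i unfolding iso_optic_def
    by (simp add: tensor_optic iota_comp_optic comp_iota, rule slide[of _ _ "\<l> M"])
      (use L R in simp_all)
qed

text \<open>The residuals \<open>M \<otimes> N\<close> and \<open>N \<otimes> M\<close> are compared
  along \<open>\<gamma> M N\<close>. Both halves are \<open>\<tau>_sym\<close>, inverted in the
  right one.\<close>

lemma sym_optic_natural:
  assumes [simp]: "l \<in> Arr C" "Dom C l = S" "Cod C l = M \<otimes> A" "r \<in> Arr C" "Dom C r = M \<otimes> A'"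
      "Cod C r = S'"
    and [simp]: "l' \<in> Arr C" "Dom C l' = T" "Cod C l' = N \<otimes> B" "r' \<in> Arr C" "Dom C r' = N \<otimes> B'"
        "Cod C r' = T'"
    and [simp]: "M \<in> Obj C" "N \<in> Obj C" "A \<in> Obj C" "A' \<in> Obj C" "B \<in> Obj C" "B' \<in> Obj C"
  shows "iso_optic (\<gamma> A B) (\<gamma> A' B')
      \<cdot>\<^bsub>Optic C\<^esub> (opt S S' A A' M l r \<otimes>\<^sub>a\<^bsub>Optic C\<^esub> opt T T' B B' N l' r')
    = (opt T T' B B' N l' r' \<otimes>\<^sub>a\<^bsub>Optic C\<^esub> opt S S' A A' M l r)
        \<cdot>\<^bsub>Optic C\<^esub> iso_optic (\<gamma> S T) (\<gamma> S' T')"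
proof -
  have [simp]: "S \<in> Obj C" "S' \<in> Obj C" "T \<in> Obj C" "T' \<in> Obj C"
    using Dom_closed[of l] Cod_closed[of r] Dom_closed[of l'] Cod_closed[of r'] by simp_all
  have L: "(\<gamma> M N \<otimes>\<^sub>a \<gamma> A B) \<cdot> \<tau> M A N B \<cdot> (l \<otimes>\<^sub>a l') = \<tau> N B M A \<cdot> (l' \<otimes>\<^sub>a l) \<cdot> \<gamma> S T"
  proof -
    have "(\<gamma> M N \<otimes>\<^sub>a \<gamma> A B) \<cdot> \<tau> M A N B \<cdot> (l \<otimes>\<^sub>a l') = ((\<gamma> M N \<otimes>\<^sub>a \<gamma> A B) \<cdot> \<tau> M A N B)
        \<cdot> (l \<otimes>\<^sub>a l')" by simp
    also have "\<dots> = \<tau> N B M A \<cdot> (\<gamma> (M \<otimes> A) (N \<otimes> B)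
        \<cdot> (l \<otimes>\<^sub>a l'))" by (subst \<tau>_sym[symmetric]) simp_all
    finally show ?thesis by (simp add: sym_naturality)
  qed
  have R: "(r \<otimes>\<^sub>a r') \<cdot> \<tau> M N A' B' \<cdot> ((M \<otimes> N) \<rhd> \<gamma> B' A')
    = \<gamma> T' S' \<cdot> (r' \<otimes>\<^sub>a r) \<cdot> \<tau> N M B' A' \<cdot> (\<gamma> M N \<lhd> (B' \<otimes> A'))"
  proof -
    have *: "\<gamma> (N \<otimes> B') (M \<otimes> A') \<cdot> \<tau> N M B' A' = \<tau> M N A' B' \<cdot> (\<gamma> N M \<otimes>\<^sub>a \<gamma> B' A')"
      using arg_cong[where f="inv_arr C", OF \<tau>_sym[of M A' N B']] by simp
    have "\<gamma> T' S' \<cdot> (r' \<otimes>\<^sub>a r) \<cdot> \<tau> N M B' A' \<cdot> (\<gamma> M N \<lhd> (B' \<otimes> A'))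
      = (\<gamma> T' S' \<cdot> (r' \<otimes>\<^sub>a r)) \<cdot> \<tau> N M B' A' \<cdot> (\<gamma> M N \<lhd> (B' \<otimes> A'))" by simp
    also have "\<dots> = (r \<otimes>\<^sub>a r') \<cdot> (\<gamma> (N \<otimes> B') (M \<otimes> A') \<cdot> \<tau> N M B' A') \<cdot> (\<gamma> M N \<lhd> (B' \<otimes> A'))"
      by (simp add: sym_naturality)
    also have "\<dots> = (r \<otimes>\<^sub>a r') \<cdot> \<tau> M N A' B' \<cdot> ((M \<otimes> N) \<rhd> \<gamma> B' A')"
      unfolding * by simp
    finally show ?thesis by simp
  qed
  show ?thesis unfolding iso_optic_def
    by (simp add: tensor_optic iota_comp_optic comp_iota, rule slide[of _ _ "\<gamma> M N"])
      (use L R in simp_all)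
qed

lemma symmetric_monoidal_category_Optic: "symmetric_monoidal_category (Optic C)"
proof (intro symmetric_monoidal_category.intro symmetric_monoidal_category_axioms.intro
    category_Optic)
  note [simp] = structure_Optic Id_Optic_iso
  let ?O = "Optic C"
  show "Unit ?O \<in> Obj ?O" by simp
  fix P Q R E P' Q' R' P'' Q'' f g h f' g'
  show "P \<otimes>\<^bsub>?O\<^esub> Q \<in> Obj ?O" if "P \<in> Obj ?O" "Q \<in> Obj ?O"
    using that by auto
  show "f \<otimes>\<^sub>a\<^bsub>?O\<^esub> g \<in> Hom ?O (P \<otimes>\<^bsub>?O\<^esub> Q) (P' \<otimes>\<^bsub>?O\<^esub> Q')" if "f \<in> Hom ?O P P'" "g \<in> Hom ?O Q Q'"
    using that tensor_in_Optic by auto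
  show "Id ?O P \<otimes>\<^sub>a\<^bsub>?O\<^esub> Id ?O Q = Id ?O (P \<otimes>\<^bsub>?O\<^esub> Q)" if "P \<in> Obj ?O" "Q \<in> Obj ?O"
    using that by auto
  show "(f' \<cdot>\<^bsub>?O\<^esub> f) \<otimes>\<^sub>a\<^bsub>?O\<^esub> (g' \<cdot>\<^bsub>?O\<^esub> g) = (f' \<otimes>\<^sub>a\<^bsub>?O\<^esub> g') \<cdot>\<^bsub>?O\<^esub> (f \<otimes>\<^sub>a\<^bsub>?O\<^esub> g)"
    if "f \<in> Hom ?O P P'" "f' \<in> Hom ?O P' P''" "g \<in> Hom ?O Q Q'" "g' \<in> Hom ?O Q' Q''"
    using that by (auto elim!: arr_OpticE intro!: tensor_comp_optic)
  show "Assoc ?O P Q R \<in> Hom ?O ((P \<otimes>\<^bsub>?O\<^esub> Q) \<otimes>\<^bsub>?O\<^esub> R) (P \<otimes>\<^bsub>?O\<^esub> (Q \<otimes>\<^bsub>?O\<^esub> R))"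
    "is_iso ?O (Assoc ?O P Q R)" if "P \<in> Obj ?O" "Q \<in> Obj ?O" "R \<in> Obj ?O"
    using that by auto
  show "Assoc ?O P' Q' R' \<cdot>\<^bsub>?O\<^esub> ((f \<otimes>\<^sub>a\<^bsub>?O\<^esub> g) \<otimes>\<^sub>a\<^bsub>?O\<^esub> h) = (f \<otimes>\<^sub>a\<^bsub>?O\<^esub> (g \<otimes>\<^sub>a\<^bsub>?O\<^esub> h))
      \<cdot>\<^bsub>?O\<^esub> Assoc ?O P Q R"
    if "f \<in> Hom ?O P P'" "g \<in> Hom ?O Q Q'" "h \<in> Hom ?O R R'"
    using that by (auto elim!: arr_OpticE simp: assoc_optic_natural)
  show "LUnit ?O P \<in> Hom ?O (Unit ?O \<otimes>\<^bsub>?O\<^esub> P) P" "is_iso ?O (LUnit ?O P)"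
    "RUnit ?O P \<in> Hom ?O (P \<otimes>\<^bsub>?O\<^esub> Unit ?O) P" "is_iso ?O (RUnit ?O P)"
    if "P \<in> Obj ?O"
    using that by auto
  \<comment> \<open>This fact and \<open>sym\<close>, \<open>sym_nat\<close> and
    \<open>runit\<close> are stated for all arguments, since the right unitor is treated by means of
    them.\<close>
  show lunit: "LUnit ?O Q \<cdot>\<^bsub>?O\<^esub> (Id ?O (Unit ?O) \<otimes>\<^sub>a\<^bsub>?O\<^esub> f) = f \<cdot>\<^bsub>?O\<^esub> LUnit ?O P" if
      "f \<in> Hom ?O P Q" for f P Q
    using that by (auto elim!: arr_OpticE simp: lunit_optic_natural)
  show sym: "Sym ?O P Q \<in> Hom ?O (P \<otimes>\<^bsub>?O\<^esub> Q) (Q \<otimes>\<^bsub>?O\<^esub> P)" if "P \<in> Obj ?O" "Q \<in> Obj ?O" for P Q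
    using that by auto
  show sym_nat: "Sym ?O P' Q' \<cdot>\<^bsub>?O\<^esub> (f \<otimes>\<^sub>a\<^bsub>?O\<^esub> g) = (g \<otimes>\<^sub>a\<^bsub>?O\<^esub> f) \<cdot>\<^bsub>?O\<^esub> Sym ?O P Q"
    if "f \<in> Hom ?O P P'" "g \<in> Hom ?O Q Q'" for f g P P' Q Q'
    using that by (auto elim!: arr_OpticE simp: sym_optic_natural)
  show runit: "LUnit ?O P \<cdot>\<^bsub>?O\<^esub> Sym ?O P (Unit ?O) = RUnit ?O P" if "P \<in> Obj ?O" for P
    using that by (auto simp: RUnit_Sym)
  \<comment> \<open>No slide is made here: the right unitor is the left unitor after a symmetry, and
    both of these are already natural.\<close>
  show "RUnit ?O Q \<cdot>\<^bsub>?O\<^esub> (f \<otimes>\<^sub>a\<^bsub>?O\<^esub> Id ?O (Unit ?O)) = f \<cdot>\<^bsub>?O\<^esub> RUnit ?O P" if f: "f \<in> Hom ?O P Q"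
  proof -
    let ?U = "Unit ?O" and ?i = "Id ?O (Unit ?O)"
    have U: "?U \<in> Obj ?O" by simp
    have [simp]: "f \<in> Arr ?O" "Dom ?O f = P" "Cod ?O f = Q" using f by auto
    have P: "P \<in> Obj ?O" and Q: "Q \<in> Obj ?O" using Opt.Dom_closed[of f] Opt.Cod_closed[of f] by auto
    have i: "?i \<in> Hom ?O ?U ?U" by simp
    have [simp]: "?i \<in> Arr ?O" "Dom ?O ?i = ?U" "Cod ?O ?i = ?U" using i by auto
    have LU: "LUnit ?O A \<in> Hom ?O (?U \<otimes>\<^bsub>?O\<^esub> A) A" if "A \<in> Obj ?O" for A
      using that by auto
    have tensor: "?i \<otimes>\<^sub>a\<^bsub>?O\<^esub> f \<in> Hom ?O (?U \<otimes>\<^bsub>?O\<^esub> P) (?U \<otimes>\<^bsub>?O\<^esub> Q)"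
      "f \<otimes>\<^sub>a\<^bsub>?O\<^esub> ?i \<in> Hom ?O (P \<otimes>\<^bsub>?O\<^esub> ?U) (Q \<otimes>\<^bsub>?O\<^esub> ?U)"
      using tensor_in_Optic[of ?i f] tensor_in_Optic[of f ?i] by (simp_all del: Optic_simps
          Id_Optic_iso)
    have "RUnit ?O Q \<cdot>\<^bsub>?O\<^esub> (f \<otimes>\<^sub>a\<^bsub>?O\<^esub> ?i) = LUnit ?O Q \<cdot>\<^bsub>?O\<^esub> (Sym ?O Q ?U \<cdot>\<^bsub>?O\<^esub> (f \<otimes>\<^sub>a\<^bsub>?O\<^esub> ?i))"
      unfolding runit[OF Q, symmetric] by (rule Opt.Comp_assoc[OF tensor(2) sym[OF Q U] LU[OF Q]])
    also have "\<dots> = (LUnit ?O Q \<cdot>\<^bsub>?O\<^esub> (?i \<otimes>\<^sub>a\<^bsub>?O\<^esub> f)) \<cdot>\<^bsub>?O\<^esub> Sym ?O P ?U"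
      unfolding sym_nat[OF f i] by (rule Opt.Comp_assoc[OF sym[OF P U] tensor(1) LU[OF Q],
          symmetric])
    also have "\<dots> = f \<cdot>\<^bsub>?O\<^esub> RUnit ?O P"
      unfolding lunit[OF f] runit[OF P, symmetric] by (rule Opt.Comp_assoc[OF sym[OF P U] LU[OF P]
          f])
    finally show ?thesis .
  qed
  show "Assoc ?O P Q (R \<otimes>\<^bsub>?O\<^esub> E) \<cdot>\<^bsub>?O\<^esub> Assoc ?O (P \<otimes>\<^bsub>?O\<^esub> Q) R E
      = (Id ?O P \<otimes>\<^sub>a\<^bsub>?O\<^esub> Assoc ?O Q R E) \<cdot>\<^bsub>?O\<^esub> Assoc ?O P (Q \<otimes>\<^bsub>?O\<^esub> R) E
          \<cdot>\<^bsub>?O\<^esub> (Assoc ?O P Q R \<otimes>\<^sub>a\<^bsub>?O\<^esub> Id ?O E)"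
    if "P \<in> Obj ?O" "Q \<in> Obj ?O" "R \<in> Obj ?O" "E \<in> Obj ?O"
    using that by (auto simp: pentagon)
  show "(Id ?O P \<otimes>\<^sub>a\<^bsub>?O\<^esub> LUnit ?O Q) \<cdot>\<^bsub>?O\<^esub> Assoc ?O P (Unit ?O) Q = RUnit ?O P \<otimes>\<^sub>a\<^bsub>?O\<^esub> Id ?O Q"
    if "P \<in> Obj ?O" "Q \<in> Obj ?O"
    using that by (auto simp: triangle)
  show "Assoc ?O Q R P \<cdot>\<^bsub>?O\<^esub> Sym ?O P (Q \<otimes>\<^bsub>?O\<^esub> R) \<cdot>\<^bsub>?O\<^esub> Assoc ?O P Q R
      = (Id ?O Q \<otimes>\<^sub>a\<^bsub>?O\<^esub> Sym ?O P R) \<cdot>\<^bsub>?O\<^esub> Assoc ?O Q P R \<cdot>\<^bsub>?O\<^esub> (Sym ?O P Q \<otimes>\<^sub>a\<^bsub>?O\<^esub> Id ?O R)"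
    if "P \<in> Obj ?O" "Q \<in> Obj ?O" "R \<in> Obj ?O"
    using that by (auto simp: hexagon)
  show "Sym ?O Q P \<cdot>\<^bsub>?O\<^esub> Sym ?O P Q = Id ?O (P \<otimes>\<^bsub>?O\<^esub> Q)" if "P \<in> Obj ?O" "Q \<in> Obj ?O"
    using that by auto
qed

end

section \<open>The action on strong symmetric monoidal functors\<close>

context strong_symmetric_monoidal_functor
begin

abbreviation compC (infixr "\<cdot>\<^sub>C" 60) where "g \<cdot>\<^sub>C f \<equiv> Comp C g f"
abbreviation compD (infixr "\<cdot>\<^sub>D" 60) where "g \<cdot>\<^sub>D f \<equiv> Comp D g f"
abbreviation tensorC (infix "\<otimes>\<^sub>C" 70) where "A \<otimes>\<^sub>C B \<equiv> TensorO C A B"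
abbreviation tensorD (infix "\<otimes>\<^sub>D" 70) where "A \<otimes>\<^sub>D B \<equiv> TensorO D A B"
abbreviation atensorC (infix "\<boxtimes>\<^sub>C" 70) where "f \<boxtimes>\<^sub>C g \<equiv> TensorA C f g"
abbreviation atensorD (infix "\<boxtimes>\<^sub>D" 70) where "f \<boxtimes>\<^sub>D g \<equiv> TensorA D f g"
abbreviation lwhiskerC (infix "\<rhd>\<^sub>C" 75) where "A \<rhd>\<^sub>C f \<equiv> Id C A \<boxtimes>\<^sub>C f"
abbreviation lwhiskerD (infix "\<rhd>\<^sub>D" 75) where "A \<rhd>\<^sub>D f \<equiv> Id D A \<boxtimes>\<^sub>D f"
abbreviation rwhiskerC (infix "\<lhd>\<^sub>C" 75) where "f \<lhd>\<^sub>C A \<equiv> f \<boxtimes>\<^sub>C Id C A"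
abbreviation rwhiskerD (infix "\<lhd>\<^sub>D" 75) where "f \<lhd>\<^sub>D A \<equiv> f \<boxtimes>\<^sub>D Id D A"
abbreviation Fo where "Fo \<equiv> OMap F"
abbreviation Fa where "Fa \<equiv> AMap F"
abbreviation \<phi> where "\<phi> A B \<equiv> Phi F (A, B)"
abbreviation \<phi>' where "\<phi>' A B \<equiv> inv_arr D (Phi F (A, B))"

declare FO_closed [simp] Phi_iso [simp] PhiI_iso [simp] FA_Id [simp]

lemma FA_simps [simp]:
  assumes "f \<in> Arr C"
  shows "Fa f \<in> Arr D" "Dom D (Fa f) = Fo (Dom C f)" "Cod D (Fa f) = Fo (Cod C f)"
  using FA_closed[of f "Dom C f" "Cod C f"] assms by auto

lemma FA_comp [simp]:
  "\<lbrakk>f \<in> Arr C; g \<in> Arr C; Dom C g = Cod C f\<rbrakk> \<Longrightarrow> Fa (g \<cdot>\<^sub>C f) = Fa g \<cdot>\<^sub>D Fa f"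
  using FA_Comp[of f "Dom C f" "Cod C f" g "Cod C g"] by auto

lemma Phi_simps [simp]:
  assumes "A \<in> Obj C" "B \<in> Obj C"
  shows "\<phi> A B \<in> Arr D" "Dom D (\<phi> A B) = Fo A \<otimes>\<^sub>D Fo B" "Cod D (\<phi> A B) = Fo (A \<otimes>\<^sub>C B)"
  using Phi_closed[OF assms] by auto

lemma PhiI_simps [simp]:
  "PhiI F \<in> Arr D" "Dom D (PhiI F) = Unit D" "Cod D (PhiI F) = Fo (Unit C)"
  using PhiI_closed by auto

text \<open>Functors preserve inverses. As a rewrite rule this moves \<open>inv_arr\<close> inside
  \<open>Fa\<close>, where it can meet the arrow it cancels.\<close>

lemma FA_iso [simp]:
  assumes "is_iso C f"
  shows "is_iso D (Fa f)" "inv_arr D (Fa f) = Fa (inv_arr C f)"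
proof -
  have [simp]: "f \<in> Arr C" by (rule source.is_iso_arr[OF assms])
  have "inverse_arrows D (Fa f) (Fa (inv_arr C f))"
    using assms by (intro target.inverse_arrowsI) (simp_all add: FA_comp[symmetric] del: FA_comp)
  then show "is_iso D (Fa f)" "inv_arr D (Fa f) = Fa (inv_arr C f)"
    using target.inverse_arrows_is_iso target.inv_arr_eqI by auto
qed

section \<open>Compatibility of \<phi> with associators, transpositions and interchange\<close>

lemma Phi_naturality:
  "\<lbrakk>f \<in> Arr C; g \<in> Arr C; Cod C f = A; Cod C g = B\<rbrakk>
    \<Longrightarrow> Fa (f \<boxtimes>\<^sub>C g) \<cdot>\<^sub>D \<phi> (Dom C f) (Dom C g) = \<phi> A B \<cdot>\<^sub>D (Fa f \<boxtimes>\<^sub>D Fa g)"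
  using Phi_natural[of f "Dom C f" A g "Dom C g" B] by auto

lemma Phi_inv_naturality:
  assumes "f \<in> Arr C" "g \<in> Arr C" "Cod C f = A" "Cod C g = B"
  shows "\<phi>' A B \<cdot>\<^sub>D Fa (f \<boxtimes>\<^sub>C g) = (Fa f \<boxtimes>\<^sub>D Fa g) \<cdot>\<^sub>D \<phi>' (Dom C f) (Dom C g)"
  by (rule target.inverse_square[OF Phi_naturality[OF assms]]) (use assms in auto)

text \<open>\<open>Phi_Assoc\<close> with the inverse associator composed on both ends: under
  \<open>Fa\<close> on the left and in \<open>D\<close> on the right.\<close>

lemma Phi_Assoc_inv:
  assumes [simp]: "A \<in> Obj C" "B \<in> Obj C" "E \<in> Obj C"
  shows "Fa (source.\<alpha>' A B E) \<cdot>\<^sub>D \<phi> A (B \<otimes>\<^sub>C E) \<cdot>\<^sub>D (Fo A \<rhd>\<^sub>D \<phi> B E)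
    = \<phi> (A \<otimes>\<^sub>C B) E \<cdot>\<^sub>D (\<phi> A B \<lhd>\<^sub>D Fo E) \<cdot>\<^sub>D target.\<alpha>' (Fo A) (Fo B) (Fo E)"
proof -
  have "Fa (source.\<alpha>' A B E) \<cdot>\<^sub>D (\<phi> A (B \<otimes>\<^sub>C E) \<cdot>\<^sub>D (Fo A \<rhd>\<^sub>D \<phi> B E)
      \<cdot>\<^sub>D Assoc D (Fo A) (Fo B) (Fo E))
      \<cdot>\<^sub>D target.\<alpha>' (Fo A) (Fo B) (Fo E)
    = (Fa (source.\<alpha>' A B E) \<cdot>\<^sub>D Fa (Assoc C A B E)) \<cdot>\<^sub>D \<phi> (A \<otimes>\<^sub>C B) E \<cdot>\<^sub>D (\<phi> A B \<lhd>\<^sub>D Fo E)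
      \<cdot>\<^sub>D target.\<alpha>' (Fo A) (Fo B) (Fo E)"
    unfolding Phi_Assoc[OF assms, symmetric] by simp
  then show ?thesis by (simp add: FA_comp[symmetric] del: FA_comp)
qed

text \<open>\<sigma> consists of an inverse associator, a whiskered symmetry and an associator.
  \<phi> passes them in this order, the whiskering being handled by naturality.\<close>

lemma Phi_\<sigma>:
  assumes [simp]: "A \<in> Obj C" "B \<in> Obj C" "Z \<in> Obj C"
  shows "Fa (source.\<sigma> A B Z) \<cdot>\<^sub>D \<phi> A (B \<otimes>\<^sub>C Z) \<cdot>\<^sub>D (Fo A \<rhd>\<^sub>D \<phi> B Z)
    = \<phi> B (A \<otimes>\<^sub>C Z) \<cdot>\<^sub>D (Fo B \<rhd>\<^sub>D \<phi> A Z) \<cdot>\<^sub>D target.\<sigma> (Fo A) (Fo B) (Fo Z)"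
proof -
  have n: "Fa (Sym C A B \<lhd>\<^sub>C Z) \<cdot>\<^sub>D \<phi> (A \<otimes>\<^sub>C B) Z = \<phi> (B \<otimes>\<^sub>C A) Z \<cdot>\<^sub>D (Fa (Sym C A B) \<lhd>\<^sub>D Fo Z)"
    using Phi_naturality[of "Sym C A B" "Id C Z" "B \<otimes>\<^sub>C A" Z] by simp
  have "Fa (source.\<sigma> A B Z) \<cdot>\<^sub>D \<phi> A (B \<otimes>\<^sub>C Z) \<cdot>\<^sub>D (Fo A \<rhd>\<^sub>D \<phi> B Z)
    = Fa (Assoc C B A Z) \<cdot>\<^sub>D Fa (Sym C A B \<lhd>\<^sub>C Z)
      \<cdot>\<^sub>D (Fa (source.\<alpha>' A B Z) \<cdot>\<^sub>D \<phi> A (B \<otimes>\<^sub>C Z) \<cdot>\<^sub>D (Fo A \<rhd>\<^sub>D \<phi> B Z))"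
    by (simp add: source.\<sigma>_def)
  also have "\<dots> = Fa (Assoc C B A Z) \<cdot>\<^sub>D (Fa (Sym C A B \<lhd>\<^sub>C Z) \<cdot>\<^sub>D \<phi> (A \<otimes>\<^sub>C B) Z)
      \<cdot>\<^sub>D (\<phi> A B \<lhd>\<^sub>D Fo Z)
      \<cdot>\<^sub>D target.\<alpha>' (Fo A) (Fo B) (Fo Z)"
    unfolding Phi_Assoc_inv[OF assms] by simp
  also have "\<dots> = Fa (Assoc C B A Z) \<cdot>\<^sub>D \<phi> (B \<otimes>\<^sub>C A) Z \<cdot>\<^sub>D ((Fa (Sym C A B) \<cdot>\<^sub>D \<phi> A B) \<lhd>\<^sub>D Fo Z)
      \<cdot>\<^sub>D target.\<alpha>' (Fo A) (Fo B) (Fo Z)"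
    unfolding n by simp
  also have "\<dots> = (Fa (Assoc C B A Z) \<cdot>\<^sub>D \<phi> (B \<otimes>\<^sub>C A) Z \<cdot>\<^sub>D (\<phi> B A \<lhd>\<^sub>D Fo Z))
      \<cdot>\<^sub>D (Sym D (Fo A) (Fo B) \<lhd>\<^sub>D Fo Z)
      \<cdot>\<^sub>D target.\<alpha>' (Fo A) (Fo B) (Fo Z)"
    unfolding Phi_Sym[OF assms(1,2)] by simp
  also have "\<dots> = \<phi> B (A \<otimes>\<^sub>C Z) \<cdot>\<^sub>D (Fo B \<rhd>\<^sub>D \<phi> A Z) \<cdot>\<^sub>D target.\<sigma> (Fo A) (Fo B) (Fo Z)"
    unfolding Phi_Assoc[OF assms(2,1,3)] by (simp add: target.\<sigma>_def)
  finally show ?thesis .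
qed

text \<open>\<tau> is a whiskered \<sigma> between two associators, so the laws for \<sigma>, the
  associator and its inverse combine. Naturality in both categories moves the remaining factors of
  \<phi> out of the way.\<close>

lemma Phi_interchange:
  assumes [simp]: "M \<in> Obj C" "A \<in> Obj C" "N \<in> Obj C" "B \<in> Obj C"
  shows "Fa (interchange C M A N B) \<cdot>\<^sub>D \<phi> (M \<otimes>\<^sub>C A) (N \<otimes>\<^sub>C B) \<cdot>\<^sub>D (\<phi> M A \<boxtimes>\<^sub>D \<phi> N B)
    = \<phi> (M \<otimes>\<^sub>C N) (A \<otimes>\<^sub>C B) \<cdot>\<^sub>D (\<phi> M N \<boxtimes>\<^sub>D \<phi> A B) \<cdot>\<^sub>D interchange D (Fo M) (Fo A) (Fo N) (Fo B)"
proof -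
  let ?a = "Assoc D (Fo M) (Fo A) (Fo N \<otimes>\<^sub>D Fo B)" and ?b =
      "target.\<alpha>' (Fo M) (Fo N) (Fo A \<otimes>\<^sub>D Fo B)"
  have n1: "Assoc D (Fo M) (Fo A) (Fo (N \<otimes>\<^sub>C B)) \<cdot>\<^sub>D ((Fo M \<otimes>\<^sub>D Fo A) \<rhd>\<^sub>D \<phi> N B)
      = (Fo M \<rhd>\<^sub>D (Fo A \<rhd>\<^sub>D \<phi> N B)) \<cdot>\<^sub>D ?a"
    using target.assoc_naturality[of "Id D (Fo M)" "Id D (Fo A)" "\<phi> N B" "Fo M" "Fo A"
        "Fo (N \<otimes>\<^sub>C B)"] by simp
  have n2: "target.\<alpha>' (Fo M) (Fo N) (Fo (A \<otimes>\<^sub>C B)) \<cdot>\<^sub>D (Fo M \<rhd>\<^sub>D (Fo N \<rhd>\<^sub>D \<phi> A B))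
      = ((Fo M \<otimes>\<^sub>D Fo N) \<rhd>\<^sub>D \<phi> A B) \<cdot>\<^sub>D ?b"
    using target.assoc_inv_naturality[of "Id D (Fo M)" "Id D (Fo N)" "\<phi> A B" "Fo M" "Fo N"
        "Fo (A \<otimes>\<^sub>C B)"] by simp
  have n3: "Fa (M \<rhd>\<^sub>C source.\<sigma> A N B) \<cdot>\<^sub>D \<phi> M (A \<otimes>\<^sub>C (N \<otimes>\<^sub>C B)) = \<phi> M (N \<otimes>\<^sub>C (A \<otimes>\<^sub>C B))
      \<cdot>\<^sub>D (Fo M \<rhd>\<^sub>D Fa (source.\<sigma> A N B))"
    using Phi_naturality[of "Id C M" "source.\<sigma> A N B" M "N \<otimes>\<^sub>C (A \<otimes>\<^sub>C B)"] by simp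
  have "Fa (interchange C M A N B) \<cdot>\<^sub>D \<phi> (M \<otimes>\<^sub>C A) (N \<otimes>\<^sub>C B) \<cdot>\<^sub>D (\<phi> M A \<boxtimes>\<^sub>D \<phi> N B)
    = Fa (source.\<alpha>' M N (A \<otimes>\<^sub>C B)) \<cdot>\<^sub>D Fa (M \<rhd>\<^sub>C source.\<sigma> A N B)
      \<cdot>\<^sub>D (Fa (Assoc C M A (N \<otimes>\<^sub>C B)) \<cdot>\<^sub>D \<phi> (M \<otimes>\<^sub>C A) (N \<otimes>\<^sub>C B) \<cdot>\<^sub>D (\<phi> M A \<lhd>\<^sub>D Fo (N \<otimes>\<^sub>C B)))
          \<cdot>\<^sub>D ((Fo M \<otimes>\<^sub>D Fo A) \<rhd>\<^sub>D \<phi> N B)"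
    by (simp add: source.\<tau>_\<sigma>)
  also have "\<dots> = Fa (source.\<alpha>' M N (A \<otimes>\<^sub>C B)) \<cdot>\<^sub>D (Fa (M \<rhd>\<^sub>C source.\<sigma> A N B)
      \<cdot>\<^sub>D \<phi> M (A \<otimes>\<^sub>C (N \<otimes>\<^sub>C B)))
      \<cdot>\<^sub>D (Fo M \<rhd>\<^sub>D \<phi> A (N \<otimes>\<^sub>C B)) \<cdot>\<^sub>D (Assoc D (Fo M) (Fo A) (Fo (N \<otimes>\<^sub>C B))
          \<cdot>\<^sub>D ((Fo M \<otimes>\<^sub>D Fo A) \<rhd>\<^sub>D \<phi> N B))"
    unfolding Phi_Assoc[OF assms(1,2) source.TensorO_closed[OF assms(3,4)]] by simp
  also have "\<dots> = Fa (source.\<alpha>' M N (A \<otimes>\<^sub>C B)) \<cdot>\<^sub>D \<phi> M (N \<otimes>\<^sub>C (A \<otimes>\<^sub>C B))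
      \<cdot>\<^sub>D (Fo M \<rhd>\<^sub>D (Fa (source.\<sigma> A N B) \<cdot>\<^sub>D \<phi> A (N \<otimes>\<^sub>C B) \<cdot>\<^sub>D (Fo A \<rhd>\<^sub>D \<phi> N B))) \<cdot>\<^sub>D ?a"
    unfolding n1 n3 by simp
  also have "\<dots> = (Fa (source.\<alpha>' M N (A \<otimes>\<^sub>C B)) \<cdot>\<^sub>D \<phi> M (N \<otimes>\<^sub>C (A \<otimes>\<^sub>C B))
      \<cdot>\<^sub>D (Fo M \<rhd>\<^sub>D \<phi> N (A \<otimes>\<^sub>C B)))
      \<cdot>\<^sub>D (Fo M \<rhd>\<^sub>D (Fo N \<rhd>\<^sub>D \<phi> A B)) \<cdot>\<^sub>D (Fo M \<rhd>\<^sub>D target.\<sigma> (Fo A) (Fo N) (Fo B)) \<cdot>\<^sub>D ?a"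
    unfolding Phi_\<sigma>[OF assms(2,3,4)] by simp
  also have "\<dots> = \<phi> (M \<otimes>\<^sub>C N) (A \<otimes>\<^sub>C B) \<cdot>\<^sub>D (\<phi> M N \<lhd>\<^sub>D Fo (A \<otimes>\<^sub>C B))
      \<cdot>\<^sub>D (target.\<alpha>' (Fo M) (Fo N) (Fo (A \<otimes>\<^sub>C B)) \<cdot>\<^sub>D (Fo M \<rhd>\<^sub>D (Fo N \<rhd>\<^sub>D \<phi> A B)))
          \<cdot>\<^sub>D (Fo M \<rhd>\<^sub>D target.\<sigma> (Fo A) (Fo N) (Fo B)) \<cdot>\<^sub>D ?a"
    unfolding Phi_Assoc_inv[OF assms(1,3) source.TensorO_closed[OF assms(2,4)]] by simp
  also have "\<dots> = \<phi> (M \<otimes>\<^sub>C N) (A \<otimes>\<^sub>C B) \<cdot>\<^sub>D (\<phi> M N \<boxtimes>\<^sub>D \<phi> A B)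
      \<cdot>\<^sub>D interchange D (Fo M) (Fo A) (Fo N) (Fo B)"
    unfolding n2 by (simp add: target.\<tau>_\<sigma>)
  finally show ?thesis .
qed

section \<open>The induced functor on representatives\<close>

abbreviation optC where "optC S S' A A' M l r \<equiv> optic_of C (S, S') (A, A') (M, l, r)"
abbreviation optD where "optD S S' A A' M l r \<equiv> optic_of D (S, S') (A, A') (M, l, r)"
abbreviation OpF where "OpF \<equiv> Optic_map C D F"

text \<open>A change of residual along \<open>f\<close> becomes one along \<open>Fa f\<close>,
  because \<phi> is natural in the residual.\<close>

lemma Optic_map_optic:
  assumes l: "l \<in> Arr C" "Dom C l = S" "Cod C l = M \<otimes>\<^sub>C A" and r: "r \<in> Arr C" "Dom C r = M \<otimes>\<^sub>C A'"
      "Cod C r = S'"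
    and [simp]: "M \<in> Obj C" "A \<in> Obj C" "A' \<in> Obj C"
  shows "AMap OpF (optC S S' A A' M l r)
    = optD (Fo S) (Fo S') (Fo A) (Fo A') (Fo M) (\<phi>' M A \<cdot>\<^sub>D Fa l) (Fa r \<cdot>\<^sub>D \<phi> M A')"
proof -
  have [simp]: "S \<in> Obj C" "S' \<in> Obj C"
    using l r source.Dom_closed[of l] source.Cod_closed[of r] by simp_all
  have "(\<Union>x\<in>optic_class C (S, S') (A, A') (M, l, r). optic_class D (Fo S, Fo S') (Fo A, Fo A')
      (Fo (fst x), \<phi>' (fst x) A \<cdot>\<^sub>D Fa (fst (snd x)), Fa (snd (snd x)) \<cdot>\<^sub>D \<phi> (fst x) A'))
    = optic_class D (Fo S, Fo S') (Fo A, Fo A') (Fo M, \<phi>' M A \<cdot>\<^sub>D Fa l, Fa r \<cdot>\<^sub>D \<phi> M A')"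
  proof (subst UN_optic_class, goal_cases)
    case 1 show ?case using l r by auto
  next
    case (2 w z)
    then obtain f m n l1 r1 where w: "w = (n, (f \<lhd>\<^sub>C A) \<cdot>\<^sub>C l1, r1)" "z = (m, l1, r1
        \<cdot>\<^sub>C (f \<lhd>\<^sub>C A'))"
      and [simp]: "f \<in> Arr C" "Dom C f = m" "Cod C f = n" "m \<in> Obj C" "n \<in> Obj C"
        "l1 \<in> Arr C" "Dom C l1 = S" "Cod C l1 = m \<otimes>\<^sub>C A" "r1 \<in> Arr C" "Dom C r1 = n \<otimes>\<^sub>C A'"
            "Cod C r1 = S'"
      by (elim source.optic_step_elim) auto
    have e1: "(Fa f \<lhd>\<^sub>D Fo A) \<cdot>\<^sub>D \<phi>' m A = \<phi>' n A \<cdot>\<^sub>D Fa (f \<lhd>\<^sub>C A)"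
      using Phi_inv_naturality[of f "Id C A" n A] by simp
    have e2: "Fa (f \<lhd>\<^sub>C A') \<cdot>\<^sub>D \<phi> m A' = \<phi> n A' \<cdot>\<^sub>D (Fa f \<lhd>\<^sub>D Fo A')"
      using Phi_naturality[of f "Id C A'" n A'] by simp
    show ?case
      unfolding w optic_class_snd
      by (rule arg_cong[where f="\<lambda>u. snd (snd u)"], rule target.slide[of _ _ "Fa f", symmetric])
        (simp_all add: target.comp_extend2[OF e1] e2)
  qed simp
  moreover have "optC S S' A A' M l r \<in> Arr (Optic C)" using l r by (intro arr_optic_of) simp_all
  ultimately show ?thesis
    by (simp add: Optic_map_def Let_def optic_of_def split_def)
qed

text \<open>The image has residual \<open>Fo (Unit C)\<close>, whereas \<open>iota\<close> in
  \<open>D\<close> has the unit of \<open>D\<close>; the slide is along \<open>PhiI F\<close>. Both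
  halves are the left unit law of \<phi>, solved for inverse unitors in the left half.\<close>

lemma Optic_map_iota:
  assumes [simp]: "f \<in> Arr C" "g \<in> Arr C"
  shows "AMap OpF (iota C f g) = iota D (Fa f) (Fa g)"
proof -
  have L: "(PhiI F \<lhd>\<^sub>D Fo (Cod C f)) \<cdot>\<^sub>D target.\<l>' (Fo (Cod C f)) = \<phi>' (Unit C) (Cod C f)
      \<cdot>\<^sub>D Fa (source.\<l>' (Cod C f))"
  proof -
    let ?A = "Cod C f"
    have "\<phi>' (Unit C) ?A \<cdot>\<^sub>D Fa (source.\<l>' ?A)
      = \<phi>' (Unit C) ?A \<cdot>\<^sub>D Fa (source.\<l>' ?A) \<cdot>\<^sub>D LUnit D (Fo ?A) \<cdot>\<^sub>D target.\<l>' (Fo ?A)" by simp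
    also have "\<dots> = \<phi>' (Unit C) ?A \<cdot>\<^sub>D (Fa (source.\<l>' ?A) \<cdot>\<^sub>D Fa (LUnit C ?A)) \<cdot>\<^sub>D \<phi> (Unit C) ?A
        \<cdot>\<^sub>D (PhiI F \<lhd>\<^sub>D Fo ?A) \<cdot>\<^sub>D target.\<l>' (Fo ?A)"
      by (subst Phi_LUnit[symmetric]) simp_all
    also have "\<dots> = (PhiI F \<lhd>\<^sub>D Fo ?A) \<cdot>\<^sub>D target.\<l>' (Fo ?A)"
      by (simp add: FA_comp[symmetric] del: FA_comp)
    finally show ?thesis ..
  qed
  show ?thesis
    unfolding source.iota_eq[OF assms refl refl refl refl]
    by (subst target.iota_eq[OF _ _ refl refl refl refl], simp_all, subst Optic_map_optic, simp_all,
        rule target.slide[of _ _ "PhiI F", symmetric])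
      (simp_all add: target.comp_extend2[OF L] Phi_LUnit)
qed

interpretation OptC: symmetric_monoidal_category
    "Optic C" by (rule source.symmetric_monoidal_category_Optic)
interpretation OptD: symmetric_monoidal_category
    "Optic D" by (rule target.symmetric_monoidal_category_Optic)

text \<open>The residuals \<open>Fo M \<otimes>\<^sub>D Fo N\<close> and
  \<open>Fo (M \<otimes>\<^sub>C N)\<close> are related by \<open>\<phi> M N\<close>. The
  associators agree by \<open>Phi_Assoc\<close>, and the arrows of the second optic pass \<phi> by
  naturality.\<close>

lemma Optic_map_comp:
  assumes [simp]: "l1 \<in> Arr C" "Dom C l1 = R" "Cod C l1 = M \<otimes>\<^sub>C S" "r1 \<in> Arr C" "Dom C r1
      = M \<otimes>\<^sub>C S'" "Cod C r1 = R'"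
    and [simp]: "l2 \<in> Arr C" "Dom C l2 = S" "Cod C l2 = N \<otimes>\<^sub>C A" "r2 \<in> Arr C" "Dom C r2
        = N \<otimes>\<^sub>C A'" "Cod C r2 = S'"
    and [simp]: "M \<in> Obj C" "N \<in> Obj C" "A \<in> Obj C" "A' \<in> Obj C"
  shows "AMap OpF (optC S S' A A' N l2 r2 \<cdot>\<^bsub>Optic C\<^esub> optC R R' S S' M l1 r1)
    = AMap OpF (optC S S' A A' N l2 r2) \<cdot>\<^bsub>Optic D\<^esub> AMap OpF (optC R R' S S' M l1 r1)"
proof -
  have [simp]: "S \<in> Obj C" "S' \<in> Obj C"
    using source.Dom_closed[of l2] source.Cod_closed[of r2] by simp_all
  have n1: "\<phi>' M (N \<otimes>\<^sub>C A) \<cdot>\<^sub>D Fa (M \<rhd>\<^sub>C l2) = (Fo M \<rhd>\<^sub>D Fa l2) \<cdot>\<^sub>D \<phi>' M S"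
    using Phi_inv_naturality[of "Id C M" l2 M "N \<otimes>\<^sub>C A"] by simp
  have n2: "Fa (M \<rhd>\<^sub>C r2) \<cdot>\<^sub>D \<phi> M (N \<otimes>\<^sub>C A') = \<phi> M S' \<cdot>\<^sub>D (Fo M \<rhd>\<^sub>D Fa r2)"
    using Phi_naturality[of "Id C M" r2 M S'] by simp
  have a1: "(\<phi> M N \<lhd>\<^sub>D Fo A) \<cdot>\<^sub>D target.\<alpha>' (Fo M) (Fo N) (Fo A) \<cdot>\<^sub>D (Fo M \<rhd>\<^sub>D \<phi>' N A)
    = \<phi>' (M \<otimes>\<^sub>C N) A \<cdot>\<^sub>D Fa (source.\<alpha>' M N A) \<cdot>\<^sub>D \<phi> M (N \<otimes>\<^sub>C A)"
  proof -
    have "\<phi>' (M \<otimes>\<^sub>C N) A \<cdot>\<^sub>D Fa (source.\<alpha>' M N A) \<cdot>\<^sub>D \<phi> M (N \<otimes>\<^sub>C A)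
      = \<phi>' (M \<otimes>\<^sub>C N) A \<cdot>\<^sub>D (Fa (source.\<alpha>' M N A) \<cdot>\<^sub>D \<phi> M (N \<otimes>\<^sub>C A) \<cdot>\<^sub>D (Fo M \<rhd>\<^sub>D \<phi> N A))
          \<cdot>\<^sub>D (Fo M \<rhd>\<^sub>D \<phi>' N A)"
      by simp
    then show ?thesis unfolding Phi_Assoc_inv[OF assms(13,14,15)] by simp
  qed
  have L: "(\<phi> M N \<lhd>\<^sub>D Fo A) \<cdot>\<^sub>D target.\<alpha>' (Fo M) (Fo N) (Fo A) \<cdot>\<^sub>D (Fo M \<rhd>\<^sub>D (\<phi>' N A \<cdot>\<^sub>D Fa l2))
      \<cdot>\<^sub>D \<phi>' M S \<cdot>\<^sub>D Fa l1
    = \<phi>' (M \<otimes>\<^sub>C N) A \<cdot>\<^sub>D Fa (source.\<alpha>' M N A) \<cdot>\<^sub>D Fa (M \<rhd>\<^sub>C l2) \<cdot>\<^sub>D Fa l1"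
  proof -
    have "(\<phi> M N \<lhd>\<^sub>D Fo A) \<cdot>\<^sub>D target.\<alpha>' (Fo M) (Fo N) (Fo A) \<cdot>\<^sub>D (Fo M \<rhd>\<^sub>D (\<phi>' N A \<cdot>\<^sub>D Fa l2))
        \<cdot>\<^sub>D \<phi>' M S \<cdot>\<^sub>D Fa l1
      = ((\<phi> M N \<lhd>\<^sub>D Fo A) \<cdot>\<^sub>D target.\<alpha>' (Fo M) (Fo N) (Fo A) \<cdot>\<^sub>D (Fo M \<rhd>\<^sub>D \<phi>' N A))
          \<cdot>\<^sub>D ((Fo M \<rhd>\<^sub>D Fa l2) \<cdot>\<^sub>D \<phi>' M S) \<cdot>\<^sub>D Fa l1"
      by simp
    then show ?thesis unfolding a1 n1[symmetric] by simp
  qed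
  have R: "(Fa r1 \<cdot>\<^sub>D \<phi> M S') \<cdot>\<^sub>D (Fo M \<rhd>\<^sub>D (Fa r2 \<cdot>\<^sub>D \<phi> N A')) \<cdot>\<^sub>D Assoc D (Fo M) (Fo N) (Fo A')
    = (Fa r1 \<cdot>\<^sub>D Fa (M \<rhd>\<^sub>C r2) \<cdot>\<^sub>D Fa (Assoc C M N A') \<cdot>\<^sub>D \<phi> (M \<otimes>\<^sub>C N) A') \<cdot>\<^sub>D (\<phi> M N \<lhd>\<^sub>D Fo A')"
  proof -
    have "(Fa r1 \<cdot>\<^sub>D Fa (M \<rhd>\<^sub>C r2) \<cdot>\<^sub>D Fa (Assoc C M N A') \<cdot>\<^sub>D \<phi> (M \<otimes>\<^sub>C N) A') \<cdot>\<^sub>D (\<phi> M N \<lhd>\<^sub>D Fo A')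
      = Fa r1 \<cdot>\<^sub>D Fa (M \<rhd>\<^sub>C r2) \<cdot>\<^sub>D (Fa (Assoc C M N A') \<cdot>\<^sub>D \<phi> (M \<otimes>\<^sub>C N) A' \<cdot>\<^sub>D (\<phi> M N \<lhd>\<^sub>D Fo A'))"
      by simp
    also have "\<dots> = Fa r1 \<cdot>\<^sub>D (Fa (M \<rhd>\<^sub>C r2) \<cdot>\<^sub>D \<phi> M (N \<otimes>\<^sub>C A')) \<cdot>\<^sub>D (Fo M \<rhd>\<^sub>D \<phi> N A')
        \<cdot>\<^sub>D Assoc D (Fo M) (Fo N) (Fo A')"
      unfolding Phi_Assoc[OF assms(13,14,16)] by simp
    finally show ?thesis unfolding n2 by simp
  qed
  show ?thesis
    by (simp add: source.comp_optic target.comp_optic Optic_map_optic, rule target.slide[of _ _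
        "\<phi> M N", symmetric])
      (use L R in simp_all)
qed

text \<open>Naturality of the structure map of the induced functor. The slide is along
  \<open>\<phi> M N\<close>, and \<open>Phi_interchange\<close> is what both halves need.\<close>

lemma Optic_map_tensor:
  assumes [simp]: "l \<in> Arr C" "Dom C l = S" "Cod C l = M \<otimes>\<^sub>C A" "r \<in> Arr C" "Dom C r = M \<otimes>\<^sub>C A'"
      "Cod C r = S'"
    and [simp]: "l' \<in> Arr C" "Dom C l' = T" "Cod C l' = N \<otimes>\<^sub>C B" "r' \<in> Arr C" "Dom C r'
        = N \<otimes>\<^sub>C B'" "Cod C r' = T'"
    and [simp]: "M \<in> Obj C" "N \<in> Obj C" "A \<in> Obj C" "A' \<in> Obj C" "B \<in> Obj C" "B' \<in> Obj C"
  shows "target.iso_optic (\<phi> A B) (\<phi> A' B')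
      \<cdot>\<^bsub>Optic D\<^esub> (AMap OpF (optC S S' A A' M l r) \<otimes>\<^sub>a\<^bsub>Optic D\<^esub> AMap OpF (optC T T' B B' N l' r'))
    = AMap OpF (optC S S' A A' M l r \<otimes>\<^sub>a\<^bsub>Optic C\<^esub> optC T T' B B' N l' r')
      \<cdot>\<^bsub>Optic D\<^esub> target.iso_optic (\<phi> S T) (\<phi> S' T')"
proof -
  have [simp]: "S \<in> Obj C" "S' \<in> Obj C" "T \<in> Obj C" "T' \<in> Obj C"
    using source.Dom_closed[of l] source.Cod_closed[of r] source.Dom_closed[of l']
        source.Cod_closed[of r'] by simp_all
  have n1: "Fa (l \<boxtimes>\<^sub>C l') \<cdot>\<^sub>D \<phi> S T = \<phi> (M \<otimes>\<^sub>C A) (N \<otimes>\<^sub>C B) \<cdot>\<^sub>D (Fa l \<boxtimes>\<^sub>D Fa l')"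
    using Phi_naturality[of l l' "M \<otimes>\<^sub>C A" "N \<otimes>\<^sub>C B"] by simp
  have n2: "\<phi>' S' T' \<cdot>\<^sub>D Fa (r \<boxtimes>\<^sub>C r') = (Fa r \<boxtimes>\<^sub>D Fa r') \<cdot>\<^sub>D \<phi>' (M \<otimes>\<^sub>C A') (N \<otimes>\<^sub>C B')"
    using Phi_inv_naturality[of r r' S' T'] by simp
  have L: "(\<phi> M N \<boxtimes>\<^sub>D \<phi> A B) \<cdot>\<^sub>D target.\<tau> (Fo M) (Fo A) (Fo N) (Fo B) \<cdot>\<^sub>D ((\<phi>' M A
      \<cdot>\<^sub>D Fa l) \<boxtimes>\<^sub>D (\<phi>' N B \<cdot>\<^sub>D Fa l'))
    = \<phi>' (M \<otimes>\<^sub>C N) (A \<otimes>\<^sub>C B) \<cdot>\<^sub>D Fa (source.\<tau> M A N B) \<cdot>\<^sub>D Fa (l \<boxtimes>\<^sub>C l') \<cdot>\<^sub>D \<phi> S T"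
  proof -
    have "\<phi>' (M \<otimes>\<^sub>C N) (A \<otimes>\<^sub>C B) \<cdot>\<^sub>D Fa (source.\<tau> M A N B) \<cdot>\<^sub>D Fa (l \<boxtimes>\<^sub>C l') \<cdot>\<^sub>D \<phi> S T
      = \<phi>' (M \<otimes>\<^sub>C N) (A \<otimes>\<^sub>C B) \<cdot>\<^sub>D (Fa (source.\<tau> M A N B) \<cdot>\<^sub>D \<phi> (M \<otimes>\<^sub>C A) (N \<otimes>\<^sub>C B)
          \<cdot>\<^sub>D (\<phi> M A \<boxtimes>\<^sub>D \<phi> N B))
        \<cdot>\<^sub>D ((\<phi>' M A \<cdot>\<^sub>D Fa l) \<boxtimes>\<^sub>D (\<phi>' N B \<cdot>\<^sub>D Fa l'))"
      unfolding n1 by simp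
    then show ?thesis
      unfolding Phi_interchange[OF assms(13,15,14,17)] by simp
  qed
  have R: "((Fa r \<cdot>\<^sub>D \<phi> M A') \<boxtimes>\<^sub>D (Fa r' \<cdot>\<^sub>D \<phi> N B')) \<cdot>\<^sub>D target.\<tau> (Fo M) (Fo N) (Fo A') (Fo B')
      \<cdot>\<^sub>D ((Fo M \<otimes>\<^sub>D Fo N) \<rhd>\<^sub>D \<phi>' A' B')
    = \<phi>' S' T' \<cdot>\<^sub>D Fa (r \<boxtimes>\<^sub>C r') \<cdot>\<^sub>D Fa (source.\<tau> M N A' B') \<cdot>\<^sub>D \<phi> (M \<otimes>\<^sub>C N) (A' \<otimes>\<^sub>C B')
        \<cdot>\<^sub>D (\<phi> M N \<lhd>\<^sub>D Fo (A' \<otimes>\<^sub>C B'))"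
  proof -
    \<comment> \<open>The factor \<open>\<phi> A' B'\<close> is inserted together with its inverse,
      to complete the left side of \<open>Phi_interchange\<close>.\<close>
    have "\<phi>' S' T' \<cdot>\<^sub>D Fa (r \<boxtimes>\<^sub>C r') \<cdot>\<^sub>D Fa (source.\<tau> M N A' B') \<cdot>\<^sub>D \<phi> (M \<otimes>\<^sub>C N) (A' \<otimes>\<^sub>C B')
        \<cdot>\<^sub>D (\<phi> M N \<lhd>\<^sub>D Fo (A' \<otimes>\<^sub>C B'))
      = (\<phi>' S' T' \<cdot>\<^sub>D Fa (r \<boxtimes>\<^sub>C r')) \<cdot>\<^sub>D (Fa (source.\<tau> M N A' B') \<cdot>\<^sub>D \<phi> (M \<otimes>\<^sub>C N) (A' \<otimes>\<^sub>C B')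
          \<cdot>\<^sub>D (\<phi> M N \<boxtimes>\<^sub>D \<phi> A' B'))
        \<cdot>\<^sub>D ((Fo M \<otimes>\<^sub>D Fo N) \<rhd>\<^sub>D \<phi>' A' B')"
      by simp
    then show ?thesis
      unfolding Phi_interchange[OF assms(13,14,16,18)] n2 by simp
  qed
  show ?thesis unfolding target.iso_optic_def
    by (simp add: source.tensor_optic target.tensor_optic Optic_map_optic target.iota_comp_optic
        target.comp_iota,
        rule target.slide[of _ _ "\<phi> M N"])
      (use L R in simp_all)
qed

section \<open>The induced functor is strong symmetric monoidal\<close>

lemma Optic_map_iso_optic:
  assumes "f \<in> Arr C" "is_iso C g"
  shows "AMap OpF (source.iso_optic f g) = target.iso_optic (Fa f) (Fa g)"
  using assms by (simp add: source.iso_optic_def target.iso_optic_def Optic_map_iota)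

lemma Optic_map_simps:
  "\<lbrakk>S \<in> Obj C; S' \<in> Obj C\<rbrakk> \<Longrightarrow> OMap OpF (S, S') = (Fo S, Fo S')"
  "\<lbrakk>S \<in> Obj C; S' \<in> Obj C; T \<in> Obj C; T' \<in> Obj C\<rbrakk>
    \<Longrightarrow> Phi OpF ((S, S'), (T, T')) = target.iso_optic (\<phi> S T) (\<phi> S' T')"
  "PhiI OpF = target.iso_optic (PhiI F) (PhiI F)"
  by (simp_all add: Optic_map_def target.iso_optic_def Let_def)

lemma Optic_map_extensional:
  "OMap OpF \<in> extensional (Obj (Optic C))" "AMap OpF \<in> extensional (Arr (Optic C))"
  "Phi OpF \<in> extensional (Obj (Optic C) \<times> Obj (Optic C))"
  by (simp_all add: Optic_map_def Let_def)

lemma AMap_Optic_map_closed: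
  assumes "u \<in> Hom (Optic C) P Q"
  shows "AMap OpF u \<in> Hom (Optic D) (OMap OpF P) (OMap OpF Q)"
  using assms by (auto elim!: arr_OpticE simp: Optic_map_optic Optic_map_simps intro!: arr_optic_of)

text \<open>The coherence axioms involve only structure maps, and these are all of the form
  \<open>iso_optic\<close>; each axiom thus splits into the same axiom for \<open>F\<close> in two
  components. General optics enter only through typing, composition and naturality.\<close>

lemma strong_symmetric_monoidal_functor_Optic_map:
  "strong_symmetric_monoidal_functor (Optic C) (Optic D) OpF"
proof (intro strong_symmetric_monoidal_functor.intro strong_symmetric_monoidal_functor_axioms.intro
    cat_functor.intro cat_functor_axioms.intro source.symmetric_monoidal_category_Optic
    target.symmetric_monoidal_category_Optic source.category_Optic target.category_Optic
    AMap_Optic_map_closed Optic_map_extensional)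
  note [simp] = source.structure_Optic target.structure_Optic source.Id_Optic_iso
      target.Id_Optic_iso
    Optic_map_simps Optic_map_iso_optic
  let ?C = "Optic C" and ?D = "Optic D"
  fix P Q R P' Q' u v
  show "OMap OpF P \<in> Obj ?D" if "P \<in> Obj ?C"
    using that by auto
  show "AMap OpF (Id ?C P) = Id ?D (OMap OpF P)" if "P \<in> Obj ?C"
    using that by auto
  show "AMap OpF (v \<cdot>\<^bsub>?C\<^esub> u) = AMap OpF v \<cdot>\<^bsub>?D\<^esub> AMap OpF u" if "u \<in> Hom ?C P Q" "v \<in> Hom ?C Q R"
    using that by (auto elim!: arr_OpticE intro!: Optic_map_comp)
  show "Phi OpF (P, Q) \<in> Hom ?D (OMap OpF P \<otimes>\<^bsub>?D\<^esub> OMap OpF Q) (OMap OpF (P \<otimes>\<^bsub>?C\<^esub> Q))"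
    "is_iso ?D (Phi OpF (P, Q))" if "P \<in> Obj ?C" "Q \<in> Obj ?C"
    using that by auto
  show "Phi OpF (P', Q') \<cdot>\<^bsub>?D\<^esub> (AMap OpF u \<otimes>\<^sub>a\<^bsub>?D\<^esub> AMap OpF v) = AMap OpF (u \<otimes>\<^sub>a\<^bsub>?C\<^esub> v)
      \<cdot>\<^bsub>?D\<^esub> Phi OpF (P, Q)"
    if "u \<in> Hom ?C P P'" "v \<in> Hom ?C Q Q'"
    using that by (auto elim!: arr_OpticE simp: Optic_map_tensor)
  show "PhiI OpF \<in> Hom ?D (Unit ?D) (OMap OpF (Unit ?C))" "is_iso ?D (PhiI OpF)"
    by simp_all
  show "AMap OpF (Assoc ?C P Q R) \<cdot>\<^bsub>?D\<^esub> Phi OpF (P \<otimes>\<^bsub>?C\<^esub> Q, R)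
      \<cdot>\<^bsub>?D\<^esub> (Phi OpF (P, Q) \<otimes>\<^sub>a\<^bsub>?D\<^esub> Id ?D (OMap OpF R))
      = Phi OpF (P, Q \<otimes>\<^bsub>?C\<^esub> R) \<cdot>\<^bsub>?D\<^esub> (Id ?D (OMap OpF P) \<otimes>\<^sub>a\<^bsub>?D\<^esub> Phi OpF (Q, R))
          \<cdot>\<^bsub>?D\<^esub> Assoc ?D (OMap OpF P) (OMap OpF Q) (OMap OpF R)"
    if "P \<in> Obj ?C" "Q \<in> Obj ?C" "R \<in> Obj ?C"
    using that by (auto simp: Phi_Assoc)
  show "AMap OpF (LUnit ?C P) \<cdot>\<^bsub>?D\<^esub> Phi OpF (Unit ?C, P) \<cdot>\<^bsub>?D\<^esub> (PhiI OpF \<otimes>\<^sub>a\<^bsub>?D\<^esub> Id ?D (OMap OpF P))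
      = LUnit ?D (OMap OpF P)" if "P \<in> Obj ?C"
    using that by (auto simp: Phi_LUnit)
  show "AMap OpF (RUnit ?C P) \<cdot>\<^bsub>?D\<^esub> Phi OpF (P, Unit ?C) \<cdot>\<^bsub>?D\<^esub> (Id ?D (OMap OpF P) \<otimes>\<^sub>a\<^bsub>?D\<^esub> PhiI OpF)
      = RUnit ?D (OMap OpF P)" if "P \<in> Obj ?C"
    using that by (auto simp: Phi_RUnit)
  show "AMap OpF (Sym ?C P Q) \<cdot>\<^bsub>?D\<^esub> Phi OpF (P, Q) = Phi OpF (Q, P)
      \<cdot>\<^bsub>?D\<^esub> Sym ?D (OMap OpF P) (OMap OpF Q)"
    if "P \<in> Obj ?C" "Q \<in> Obj ?C"
    using that by (auto simp: Phi_Sym)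
qed

end

section \<open>The category of symmetric monoidal categories\<close>

text \<open>All maps in the record are extensional, so agreement on the source category is
  equality.\<close>

lemma smf_eqI:
  assumes "strong_symmetric_monoidal_functor C D F" "strong_symmetric_monoidal_functor C D G"
    and "\<And>A. A \<in> Obj C \<Longrightarrow> OMap F A = OMap G A"
    and "\<And>f. f \<in> Arr C \<Longrightarrow> AMap F f = AMap G f"
    and "\<And>A B. A \<in> Obj C \<Longrightarrow> B \<in> Obj C \<Longrightarrow> Phi F (A, B) = Phi G (A, B)"
    and "PhiI F = PhiI G"
  shows "F = G"
proof (rule smf_data.equality)
  interpret F: strong_symmetric_monoidal_functor C D F by fact
  interpret G: strong_symmetric_monoidal_functor C D G by fact
  show "OMap F = OMap G" using F.OMap_ext G.OMap_ext assms(3) by (rule extensionalityI)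
  show "AMap F = AMap G" using F.AMap_ext G.AMap_ext assms(4) by (rule extensionalityI)
  show "Phi F = Phi G" using F.Phi_ext G.Phi_ext by (rule extensionalityI) (auto intro: assms(5))
qed (simp_all add: assms(6))

lemma id_smf_simps [simp]:
  "A \<in> Obj C \<Longrightarrow> OMap (id_smf C) A = A"
  "f \<in> Arr C \<Longrightarrow> AMap (id_smf C) f = f"
  "\<lbrakk>A \<in> Obj C; B \<in> Obj C\<rbrakk> \<Longrightarrow> Phi (id_smf C) (A, B) = Id C (A \<otimes>\<^bsub>C\<^esub> B)"
  "PhiI (id_smf C) = Id C (Unit C)"
  "OMap (id_smf C) \<in> extensional (Obj C)"
  "AMap (id_smf C) \<in> extensional (Arr C)"
  "Phi (id_smf C) \<in> extensional (Obj C \<times> Obj C)"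
  by (simp_all add: id_smf_def)

lemma comp_smf_simps [simp]:
  "A \<in> Obj C \<Longrightarrow> OMap (comp_smf C E G F) A = OMap G (OMap F A)"
  "f \<in> Arr C \<Longrightarrow> AMap (comp_smf C E G F) f = AMap G (AMap F f)"
  "\<lbrakk>A \<in> Obj C; B \<in> Obj C\<rbrakk>
    \<Longrightarrow> Phi (comp_smf C E G F) (A, B) = AMap G (Phi F (A, B)) \<cdot>\<^bsub>E\<^esub> Phi G (OMap F A, OMap F B)"
  "PhiI (comp_smf C E G F) = AMap G (PhiI F) \<cdot>\<^bsub>E\<^esub> PhiI G"
  "OMap (comp_smf C E G F) \<in> extensional (Obj C)"
  "AMap (comp_smf C E G F) \<in> extensional (Arr C)"
  "Phi (comp_smf C E G F) \<in> extensional (Obj C \<times> Obj C)"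
  by (simp_all add: comp_smf_def)

context symmetric_monoidal_category
begin

lemma strong_symmetric_monoidal_functor_id: "strong_symmetric_monoidal_functor C C (id_smf C)"
  by unfold_locales (auto simp: Sym_closed)

end

text \<open>Each coherence law of the composite is the law of \<open>F\<close> under
  \<open>AMap G\<close> joined to the law of \<open>G\<close>. Naturality of the structure map of
  \<open>G\<close> brings the factors of each law together.\<close>

lemma strong_symmetric_monoidal_functor_comp:
  assumes "strong_symmetric_monoidal_functor C D F" "strong_symmetric_monoidal_functor D E G"
  shows "strong_symmetric_monoidal_functor C E (comp_smf C E G F)"
proof -
  interpret F: strong_symmetric_monoidal_functor C D F by fact
  interpret G: strong_symmetric_monoidal_functor D E G by fact
  let ?F = "OMap F" and ?G = "OMap G" and ?H = "comp_smf C E G F"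
  let ?p = "\<lambda>A B. Phi F (A, B)" and ?q = "\<lambda>A B. Phi G (A, B)"
  show ?thesis
  proof (intro strong_symmetric_monoidal_functor.intro
      strong_symmetric_monoidal_functor_axioms.intro
      cat_functor.intro cat_functor_axioms.intro F.source.symmetric_monoidal_category_axioms
      G.target.symmetric_monoidal_category_axioms F.source.category_axioms G.target.category_axioms)
    show "OMap ?H \<in> extensional (Obj C)" "AMap ?H \<in> extensional (Arr C)"
        "Phi ?H \<in> extensional (Obj C \<times> Obj C)"
      by simp_all
    fix A B A' B' K f g
    show "OMap ?H A \<in> Obj E" if "A \<in> Obj C" using that by simp
    show "AMap ?H f \<in> Hom E (OMap ?H A) (OMap ?H B)" if "f \<in> Hom C A B" using that by auto
    show "AMap ?H (Id C A) = Id E (OMap ?H A)" if "A \<in> Obj C" using that by simp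
    show "AMap ?H (g \<cdot>\<^bsub>C\<^esub> f) = AMap ?H g \<cdot>\<^bsub>E\<^esub> AMap ?H f" if "f \<in> Hom C A B"
        "g \<in> Hom C B K" using that by auto
    show "Phi ?H (A, B) \<in> Hom E (OMap ?H A \<otimes>\<^bsub>E\<^esub> OMap ?H B) (OMap ?H (A \<otimes>\<^bsub>C\<^esub> B))"
        "is_iso E (Phi ?H (A, B))"
      if "A \<in> Obj C" "B \<in> Obj C" using that by simp_all
    show "PhiI ?H \<in> Hom E (Unit E) (OMap ?H (Unit C))" "is_iso E (PhiI ?H)" by simp_all
    show "Phi ?H (A', B') \<cdot>\<^bsub>E\<^esub> (AMap ?H f \<otimes>\<^sub>a\<^bsub>E\<^esub> AMap ?H g) = AMap ?H (f \<otimes>\<^sub>a\<^bsub>C\<^esub> g)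
        \<cdot>\<^bsub>E\<^esub> Phi ?H (A, B)"
      if "f \<in> Hom C A A'" "g \<in> Hom C B B'"
    proof -
      have [simp]: "f \<in> Arr C" "g \<in> Arr C" "Dom C f = A" "Cod C f = A'" "Dom C g = B" "Cod C g
          = B'" using that by auto
      have [simp]: "A \<in> Obj C" "A' \<in> Obj C" "B \<in> Obj C" "B' \<in> Obj C"
        using F.source.Dom_closed[of f] F.source.Cod_closed[of f] F.source.Dom_closed[of g]
            F.source.Cod_closed[of g] by simp_all
      have "Phi ?H (A', B') \<cdot>\<^bsub>E\<^esub> (AMap ?H f \<otimes>\<^sub>a\<^bsub>E\<^esub> AMap ?H g)
        = AMap G (?p A' B') \<cdot>\<^bsub>E\<^esub> (?q (?F A') (?F B')
            \<cdot>\<^bsub>E\<^esub> (AMap G (AMap F f) \<otimes>\<^sub>a\<^bsub>E\<^esub> AMap G (AMap F g)))"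
        by simp
      also have "\<dots> = AMap G (?p A' B' \<cdot>\<^bsub>D\<^esub> (AMap F f \<otimes>\<^sub>a\<^bsub>D\<^esub> AMap F g)) \<cdot>\<^bsub>E\<^esub> ?q (?F A) (?F B)"
        using G.Phi_naturality[of "AMap F f" "AMap F g" "?F A'" "?F B'"] by simp
      also have "\<dots> = AMap ?H (f \<otimes>\<^sub>a\<^bsub>C\<^esub> g) \<cdot>\<^bsub>E\<^esub> Phi ?H (A, B)"
        using F.Phi_naturality[of f g A' B', symmetric] by simp
      finally show ?thesis .
    qed
    show "AMap ?H (Assoc C A B K) \<cdot>\<^bsub>E\<^esub> Phi ?H (A \<otimes>\<^bsub>C\<^esub> B, K)
        \<cdot>\<^bsub>E\<^esub> (Phi ?H (A, B) \<otimes>\<^sub>a\<^bsub>E\<^esub> Id E (OMap ?H K))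
      = Phi ?H (A, B \<otimes>\<^bsub>C\<^esub> K) \<cdot>\<^bsub>E\<^esub> (Id E (OMap ?H A) \<otimes>\<^sub>a\<^bsub>E\<^esub> Phi ?H (B, K))
          \<cdot>\<^bsub>E\<^esub> Assoc E (OMap ?H A) (OMap ?H B) (OMap ?H K)"
      if [simp]: "A \<in> Obj C" "B \<in> Obj C" "K \<in> Obj C"
    proof -
      let ?GK = "Id E (?G (?F K))" and ?GA = "Id E (?G (?F A))"
      have n1: "?q (?F (A \<otimes>\<^bsub>C\<^esub> B)) (?F K) \<cdot>\<^bsub>E\<^esub> (AMap G (?p A B) \<otimes>\<^sub>a\<^bsub>E\<^esub> ?GK)
        = AMap G (?p A B \<otimes>\<^sub>a\<^bsub>D\<^esub> Id D (?F K)) \<cdot>\<^bsub>E\<^esub> ?q (?F A \<otimes>\<^bsub>D\<^esub> ?F B) (?F K)"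
        using G.Phi_naturality[of "?p A B" "Id D (?F K)" "?F (A \<otimes>\<^bsub>C\<^esub> B)" "?F K"] by simp
      have n2: "AMap G (Id D (?F A) \<otimes>\<^sub>a\<^bsub>D\<^esub> ?p B K) \<cdot>\<^bsub>E\<^esub> ?q (?F A) (?F B \<otimes>\<^bsub>D\<^esub> ?F K)
        = ?q (?F A) (?F (B \<otimes>\<^bsub>C\<^esub> K)) \<cdot>\<^bsub>E\<^esub> (?GA \<otimes>\<^sub>a\<^bsub>E\<^esub> AMap G (?p B K))"
        using G.Phi_naturality[of "Id D (?F A)" "?p B K" "?F A" "?F (B \<otimes>\<^bsub>C\<^esub> K)"] by simp
      have "AMap ?H (Assoc C A B K) \<cdot>\<^bsub>E\<^esub> Phi ?H (A \<otimes>\<^bsub>C\<^esub> B, K)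
          \<cdot>\<^bsub>E\<^esub> (Phi ?H (A, B) \<otimes>\<^sub>a\<^bsub>E\<^esub> Id E (OMap ?H K))
        = AMap G (AMap F (Assoc C A B K)) \<cdot>\<^bsub>E\<^esub> AMap G (?p (A \<otimes>\<^bsub>C\<^esub> B) K)
          \<cdot>\<^bsub>E\<^esub> (?q (?F (A \<otimes>\<^bsub>C\<^esub> B)) (?F K) \<cdot>\<^bsub>E\<^esub> (AMap G (?p A B) \<otimes>\<^sub>a\<^bsub>E\<^esub> ?GK))
              \<cdot>\<^bsub>E\<^esub> (?q (?F A) (?F B) \<otimes>\<^sub>a\<^bsub>E\<^esub> ?GK)"
        by simp
      also have "\<dots> = AMap G (AMap F (Assoc C A B K) \<cdot>\<^bsub>D\<^esub> ?p (A \<otimes>\<^bsub>C\<^esub> B) K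
          \<cdot>\<^bsub>D\<^esub> (?p A B \<otimes>\<^sub>a\<^bsub>D\<^esub> Id D (?F K)))
          \<cdot>\<^bsub>E\<^esub> ?q (?F A \<otimes>\<^bsub>D\<^esub> ?F B) (?F K) \<cdot>\<^bsub>E\<^esub> (?q (?F A) (?F B) \<otimes>\<^sub>a\<^bsub>E\<^esub> ?GK)"
        unfolding n1 by simp
      also have "\<dots> = AMap G (?p A (B \<otimes>\<^bsub>C\<^esub> K)) \<cdot>\<^bsub>E\<^esub> AMap G (Id D (?F A) \<otimes>\<^sub>a\<^bsub>D\<^esub> ?p B K)
          \<cdot>\<^bsub>E\<^esub> (AMap G (Assoc D (?F A) (?F B) (?F K)) \<cdot>\<^bsub>E\<^esub> ?q (?F A \<otimes>\<^bsub>D\<^esub> ?F B) (?F K)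
              \<cdot>\<^bsub>E\<^esub> (?q (?F A) (?F B) \<otimes>\<^sub>a\<^bsub>E\<^esub> ?GK))"
        unfolding F.Phi_Assoc[OF that] by simp
      also have "\<dots> = AMap G (?p A (B \<otimes>\<^bsub>C\<^esub> K)) \<cdot>\<^bsub>E\<^esub> (AMap G (Id D (?F A) \<otimes>\<^sub>a\<^bsub>D\<^esub> ?p B K)
          \<cdot>\<^bsub>E\<^esub> ?q (?F A) (?F B \<otimes>\<^bsub>D\<^esub> ?F K))
          \<cdot>\<^bsub>E\<^esub> (?GA \<otimes>\<^sub>a\<^bsub>E\<^esub> ?q (?F B) (?F K)) \<cdot>\<^bsub>E\<^esub> Assoc E (?G (?F A)) (?G (?F B)) (?G (?F K))"
        by (subst G.Phi_Assoc) simp_all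
      finally show ?thesis unfolding n2 by simp
    qed
    show "AMap ?H (LUnit C A) \<cdot>\<^bsub>E\<^esub> Phi ?H (Unit C, A) \<cdot>\<^bsub>E\<^esub> (PhiI ?H \<otimes>\<^sub>a\<^bsub>E\<^esub> Id E (OMap ?H A))
        = LUnit E (OMap ?H A)"
      if [simp]: "A \<in> Obj C"
    proof -
      let ?GA = "Id E (?G (?F A))"
      have n: "?q (?F (Unit C)) (?F A) \<cdot>\<^bsub>E\<^esub> (AMap G (PhiI F) \<otimes>\<^sub>a\<^bsub>E\<^esub> ?GA)
        = AMap G (PhiI F \<otimes>\<^sub>a\<^bsub>D\<^esub> Id D (?F A)) \<cdot>\<^bsub>E\<^esub> ?q (Unit D) (?F A)"
        using G.Phi_naturality[of "PhiI F" "Id D (?F A)" "?F (Unit C)" "?F A"] by simp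
      have "AMap ?H (LUnit C A) \<cdot>\<^bsub>E\<^esub> Phi ?H (Unit C, A) \<cdot>\<^bsub>E\<^esub> (PhiI ?H \<otimes>\<^sub>a\<^bsub>E\<^esub> Id E (OMap ?H A))
        = AMap G (AMap F (LUnit C A)) \<cdot>\<^bsub>E\<^esub> AMap G (?p (Unit C) A)
          \<cdot>\<^bsub>E\<^esub> (?q (?F (Unit C)) (?F A) \<cdot>\<^bsub>E\<^esub> (AMap G (PhiI F) \<otimes>\<^sub>a\<^bsub>E\<^esub> ?GA)) \<cdot>\<^bsub>E\<^esub> (PhiI G \<otimes>\<^sub>a\<^bsub>E\<^esub> ?GA)"
        by simp
      also have "\<dots> = AMap G (AMap F (LUnit C A) \<cdot>\<^bsub>D\<^esub> ?p (Unit C) A \<cdot>\<^bsub>D\<^esub> (PhiI F \<otimes>\<^sub>a\<^bsub>D\<^esub> Id D (?F A)))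
          \<cdot>\<^bsub>E\<^esub> ?q (Unit D) (?F A) \<cdot>\<^bsub>E\<^esub> (PhiI G \<otimes>\<^sub>a\<^bsub>E\<^esub> ?GA)"
        unfolding n by simp
      \<comment> \<open>With functoriality removed from the rewrite rules, the composite under
        \<open>AMap G\<close> stays whole and matches the unit law of \<open>F\<close>.\<close>
      finally show ?thesis by (simp add: F.Phi_LUnit G.Phi_LUnit del: F.FA_comp G.FA_comp)
    qed
    show "AMap ?H (RUnit C A) \<cdot>\<^bsub>E\<^esub> Phi ?H (A, Unit C) \<cdot>\<^bsub>E\<^esub> (Id E (OMap ?H A) \<otimes>\<^sub>a\<^bsub>E\<^esub> PhiI ?H)
        = RUnit E (OMap ?H A)"
      if [simp]: "A \<in> Obj C"
    proof -
      let ?GA = "Id E (?G (?F A))"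
      have n: "?q (?F A) (?F (Unit C)) \<cdot>\<^bsub>E\<^esub> (?GA \<otimes>\<^sub>a\<^bsub>E\<^esub> AMap G (PhiI F))
        = AMap G (Id D (?F A) \<otimes>\<^sub>a\<^bsub>D\<^esub> PhiI F) \<cdot>\<^bsub>E\<^esub> ?q (?F A) (Unit D)"
        using G.Phi_naturality[of "Id D (?F A)" "PhiI F" "?F A" "?F (Unit C)"] by simp
      have "AMap ?H (RUnit C A) \<cdot>\<^bsub>E\<^esub> Phi ?H (A, Unit C) \<cdot>\<^bsub>E\<^esub> (Id E (OMap ?H A) \<otimes>\<^sub>a\<^bsub>E\<^esub> PhiI ?H)
        = AMap G (AMap F (RUnit C A)) \<cdot>\<^bsub>E\<^esub> AMap G (?p A (Unit C))
          \<cdot>\<^bsub>E\<^esub> (?q (?F A) (?F (Unit C)) \<cdot>\<^bsub>E\<^esub> (?GA \<otimes>\<^sub>a\<^bsub>E\<^esub> AMap G (PhiI F))) \<cdot>\<^bsub>E\<^esub> (?GA \<otimes>\<^sub>a\<^bsub>E\<^esub> PhiI G)"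
        by simp
      also have "\<dots> = AMap G (AMap F (RUnit C A) \<cdot>\<^bsub>D\<^esub> ?p A (Unit C) \<cdot>\<^bsub>D\<^esub> (Id D (?F A) \<otimes>\<^sub>a\<^bsub>D\<^esub> PhiI F))
          \<cdot>\<^bsub>E\<^esub> ?q (?F A) (Unit D) \<cdot>\<^bsub>E\<^esub> (?GA \<otimes>\<^sub>a\<^bsub>E\<^esub> PhiI G)"
        unfolding n by simp
      finally show ?thesis by (simp add: F.Phi_RUnit G.Phi_RUnit del: F.FA_comp G.FA_comp)
    qed
    show "AMap ?H (Sym C A B) \<cdot>\<^bsub>E\<^esub> Phi ?H (A, B) = Phi ?H (B, A) \<cdot>\<^bsub>E\<^esub> Sym E (OMap ?H A) (OMap ?H B)"
      if [simp]: "A \<in> Obj C" "B \<in> Obj C"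
    proof -
      have "AMap ?H (Sym C A B) \<cdot>\<^bsub>E\<^esub> Phi ?H (A, B) = AMap G (AMap F (Sym C A B) \<cdot>\<^bsub>D\<^esub> ?p A B)
          \<cdot>\<^bsub>E\<^esub> ?q (?F A) (?F B)"
        by simp
      also have "\<dots> = AMap G (?p B A) \<cdot>\<^bsub>E\<^esub> (AMap G (Sym D (?F A) (?F B)) \<cdot>\<^bsub>E\<^esub> ?q (?F A) (?F B))"
        unfolding F.Phi_Sym[OF that] by simp
      also have "\<dots> = Phi ?H (B, A) \<cdot>\<^bsub>E\<^esub> Sym E (OMap ?H A) (OMap ?H B)"
        by (subst G.Phi_Sym) simp_all
      finally show ?thesis .
    qed
  qed
qed

section \<open>Preservation of identities and composition\<close>

context symmetric_monoidal_category
begin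

text \<open>The structure maps are identities, so every representative is sent to itself and no
  slide occurs.\<close>

lemma Optic_map_id: "Optic_map C C (id_smf C) = id_smf (Optic C)"
proof -
  interpret F: strong_symmetric_monoidal_functor C C "id_smf C"
    by (rule strong_symmetric_monoidal_functor_id)
  interpret Opt: symmetric_monoidal_category "Optic C" by (rule symmetric_monoidal_category_Optic)
  show ?thesis
  proof (rule smf_eqI[OF F.strong_symmetric_monoidal_functor_Optic_map
      Opt.strong_symmetric_monoidal_functor_id])
    show "AMap (Optic_map C C (id_smf C)) u = AMap (id_smf (Optic C)) u" if
        "u \<in> Arr (Optic C)" for u
      using that by (auto elim!: arr_OpticE simp: F.Optic_map_optic intro!: arr_optic_of)
  qed (auto simp: F.Optic_map_simps Id_Optic_iso)
qed

end

text \<open>Both sides produce the same representative: the inverse of a composite structure map is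
  the composite of the inverses in reverse order. Again no slide occurs.\<close>

lemma Optic_map_comp_smf:
  assumes "strong_symmetric_monoidal_functor C D F" "strong_symmetric_monoidal_functor D E G"
  shows "Optic_map C E (comp_smf C E G F)
    = comp_smf (Optic C) (Optic E) (Optic_map D E G) (Optic_map C D F)"
proof -
  interpret F: strong_symmetric_monoidal_functor C D F by fact
  interpret G: strong_symmetric_monoidal_functor D E G by fact
  interpret H: strong_symmetric_monoidal_functor C E "comp_smf C E G F"
    by (rule strong_symmetric_monoidal_functor_comp[OF assms])
  show ?thesis
  proof (rule smf_eqI[OF H.strong_symmetric_monoidal_functor_Optic_map
        strong_symmetric_monoidal_functor_comp[OF F.strong_symmetric_monoidal_functor_Optic_map
          G.strong_symmetric_monoidal_functor_Optic_map]])
    show "AMap (Optic_map C E (comp_smf C E G F)) u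
        = AMap (comp_smf (Optic C) (Optic E) (Optic_map D E G) (Optic_map C D F)) u"
      if "u \<in> Arr (Optic C)" for u
      using that by (auto elim!: arr_OpticE simp: F.Optic_map_optic G.Optic_map_optic
          H.Optic_map_optic)
  qed (auto simp: F.Optic_map_simps G.Optic_map_simps H.Optic_map_simps G.Optic_map_iso_optic)
qed

section \<open>Category laws for strong symmetric monoidal functors\<close>

lemma comp_smf_id:
  assumes "strong_symmetric_monoidal_functor C D F"
  shows "comp_smf C D F (id_smf C) = F" "comp_smf C D (id_smf D) F = F"
proof -
  interpret F: strong_symmetric_monoidal_functor C D F by fact
  show "comp_smf C D F (id_smf C) = F"
    by (rule smf_eqI[OF strong_symmetric_monoidal_functor_comp[OF
            F.source.strong_symmetric_monoidal_functor_id assms] assms]) simp_all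
  show "comp_smf C D (id_smf D) F = F"
    by (rule smf_eqI[OF strong_symmetric_monoidal_functor_comp[OF assms
            F.target.strong_symmetric_monoidal_functor_id] assms]) simp_all
qed

lemma comp_smf_assoc:
  assumes "strong_symmetric_monoidal_functor C D F" "strong_symmetric_monoidal_functor D E G"
    "strong_symmetric_monoidal_functor E K H"
  shows "comp_smf C K (comp_smf D K H G) F = comp_smf C K H (comp_smf C E G F)"
proof -
  interpret F: strong_symmetric_monoidal_functor C D F by fact
  interpret G: strong_symmetric_monoidal_functor D E G by fact
  interpret H: strong_symmetric_monoidal_functor E K H by fact
  show ?thesis
  proof (rule smf_eqI)
    show "strong_symmetric_monoidal_functor C K (comp_smf C K (comp_smf D K H G) F)"
      "strong_symmetric_monoidal_functor C K (comp_smf C K H (comp_smf C E G F))"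
      by (blast intro: assms strong_symmetric_monoidal_functor_comp)+
  qed simp_all
qed

text \<open>Arrows carry their source and target, so fixing a hom-set leaves only the functor free
  and reduces the category laws to laws of \<open>comp_smf\<close>.\<close>

lemma Hom_SymmMonCat:
  "u \<in> Hom SymmMonCat C D \<longleftrightarrow> (\<exists>F. u = (C, D, F) \<and> strong_symmetric_monoidal_functor C D F)"
  by (cases u) (auto simp: SymmMonCat_def)

lemma SymmMonCat_simps:
  "C \<in> Obj SymmMonCat \<longleftrightarrow> symmetric_monoidal_category C"
  "Id SymmMonCat C = (C, C, id_smf C)"
  "(D', E, G) \<cdot>\<^bsub>SymmMonCat\<^esub> (C, D, F) = (C, E, comp_smf C E G F)"
  by (simp_all add: SymmMonCat_def)

lemma category_SymmMonCat:
  "category (SymmMonCat :: (('o, 'm) smc_data, ('o, 'm) smc_arrow) cat_data)"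
proof
  fix f g h :: "('o, 'm) smc_arrow" and A B D E :: "('o, 'm) smc_data"
  show "Dom SymmMonCat f \<in> Obj SymmMonCat" "Cod SymmMonCat f \<in> Obj SymmMonCat" if
      "f \<in> Arr SymmMonCat"
    using that by (auto simp: SymmMonCat_def strong_symmetric_monoidal_functor_def)
  show "Id SymmMonCat A \<in> Hom SymmMonCat A A" if "A \<in> Obj SymmMonCat"
    using that symmetric_monoidal_category.strong_symmetric_monoidal_functor_id
    by (auto simp: Hom_SymmMonCat SymmMonCat_simps simp del: hom_iff)
  show "g \<cdot>\<^bsub>SymmMonCat\<^esub> f \<in> Hom SymmMonCat A D" if "f \<in> Hom SymmMonCat A B" "g \<in> Hom SymmMonCat B D"
    using that strong_symmetric_monoidal_functor_comp
    by (auto simp: Hom_SymmMonCat SymmMonCat_simps simp del: hom_iff)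
  show "f \<cdot>\<^bsub>SymmMonCat\<^esub> Id SymmMonCat A = f" "Id SymmMonCat B \<cdot>\<^bsub>SymmMonCat\<^esub> f = f" if
      "f \<in> Hom SymmMonCat A B"
    using that by (auto simp: Hom_SymmMonCat SymmMonCat_simps comp_smf_id simp del: hom_iff)
  show "(h \<cdot>\<^bsub>SymmMonCat\<^esub> g) \<cdot>\<^bsub>SymmMonCat\<^esub> f = h \<cdot>\<^bsub>SymmMonCat\<^esub> g \<cdot>\<^bsub>SymmMonCat\<^esub> f"
    if "f \<in> Hom SymmMonCat A B" "g \<in> Hom SymmMonCat B D" "h \<in> Hom SymmMonCat D E"
    using that by (auto simp: Hom_SymmMonCat SymmMonCat_simps comp_smf_assoc simp del: hom_iff)
qed

text \<open>Passing to optics changes the types of objects and arrows, so the two copies of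
  \<open>SymmMonCat\<close> in the last conjunct live over different types. All categories in one
  copy share their types; the preceding conjuncts about functors also cover categories over
  unrelated types.\<close>

theorem theorem2p0p8:
  shows "(\<forall>C :: ('o, 'm) smc_data.
            symmetric_monoidal_category C \<longrightarrow> symmetric_monoidal_category (Optic C))
       \<and> (\<forall>(C :: ('o, 'm) smc_data) (D :: ('p, 'n) smc_data) F.
            strong_symmetric_monoidal_functor C D F \<longrightarrow>
            strong_symmetric_monoidal_functor (Optic C) (Optic D) (Optic_map C D F))
       \<and> (\<forall>C :: ('o, 'm) smc_data.
            symmetric_monoidal_category C \<longrightarrow> Optic_map C C (id_smf C) = id_smf (Optic C))
       \<and> (\<forall>(C :: ('o, 'm) smc_data) (D :: ('p, 'n) smc_data) (E :: ('q, 'k) smc_data) F G.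
            strong_symmetric_monoidal_functor C D F \<longrightarrow>
            strong_symmetric_monoidal_functor D E G \<longrightarrow>
            Optic_map C E (comp_smf C E G F)
              = comp_smf (Optic C) (Optic E) (Optic_map D E G) (Optic_map C D F))
       \<and> cat_functor (SymmMonCat :: (('o, 'm) smc_data, ('o, 'm) smc_arrow) cat_data) SymmMonCat
            Optic (\<lambda>(C, D, F). (Optic C, Optic D, Optic_map C D F))"
proof (intro conjI allI impI)
  show "symmetric_monoidal_category (Optic C)" if "symmetric_monoidal_category C" for C ::
      "('o, 'm) smc_data"
    using that by (rule symmetric_monoidal_category.symmetric_monoidal_category_Optic)
  show "strong_symmetric_monoidal_functor (Optic C) (Optic D) (Optic_map C D F)"
    if "strong_symmetric_monoidal_functor C D F" for C :: "('o, 'm) smc_data" and D ::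
        "('p, 'n) smc_data" and F
    using that by (rule strong_symmetric_monoidal_functor.strong_symmetric_monoidal_functor_Optic_map)
  show "Optic_map C C (id_smf C) = id_smf (Optic C)" if "symmetric_monoidal_category C" for C ::
      "('o, 'm) smc_data"
    using that by (rule symmetric_monoidal_category.Optic_map_id)
  show "Optic_map C E (comp_smf C E G F)
      = comp_smf (Optic C) (Optic E) (Optic_map D E G) (Optic_map C D F)"
    if "strong_symmetric_monoidal_functor C D F" "strong_symmetric_monoidal_functor D E G"
    for C :: "('o, 'm) smc_data" and D :: "('p, 'n) smc_data" and E :: "('q, 'k) smc_data" and F G
    using that by (rule Optic_map_comp_smf)
  show "cat_functor (SymmMonCat :: (('o, 'm) smc_data, ('o, 'm) smc_arrow) cat_data) SymmMonCat
      Optic (\<lambda>(C, D, F). (Optic C, Optic D, Optic_map C D F))"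
    by (intro cat_functor.intro cat_functor_axioms.intro category_SymmMonCat)
      (auto simp: Hom_SymmMonCat SymmMonCat_simps symmetric_monoidal_category.Optic_map_id
        Optic_map_comp_smf
        intro: symmetric_monoidal_category.symmetric_monoidal_category_Optic
          strong_symmetric_monoidal_functor.strong_symmetric_monoidal_functor_Optic_map simp del:
              hom_iff)
qed

end
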